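(* Let $g(n)$ be defined as in the context. Then: (i) There exists a real number $\alpha<\frac{1}{2}$ such that $g(n)<n^{\alpha}$ for all sufficiently large integers $n$. (ii) For every $\varepsilon>0$ there is a constant $C_\varepsilon>0$, depending only on $\varepsilon$, such that for all sufficiently large $X$, $$\#\{n\le X:\ g(n)\ge n^{\varepsilon}\}\le C_\varepsilon\, X\exp\!\big(-(\log X)^{\frac{1}{3}-\varepsilon}\big).$$
   Context: For integers $n>1$ and $k\ge 1$, say that $(n,k)$ has a prime representation if there are distinct primes $P_1,\dots,P_k$ with $P_j\mid (n+j)$ for $1\le j\le k$. Define $g(n)$ to be the largest positive integer $k$ such that $(n,k)$ has a prime representation. *)

theory Defs
  imports "HOL-Analysis.Analysis" "HOL-Computational_Algebra.Primes"
begin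

definition prime_rep :: "nat \<Rightarrow> nat \<Rightarrow> bool" where
  "prime_rep n k \<longleftrightarrow> (\<exists>P :: nat \<Rightarrow> nat. inj_on P {1..k} \<and>
      (\<forall>j\<in>{1..k}. prime (P j) \<and> P j dvd n + j))"

definition g :: "nat \<Rightarrow> nat" where
  "g n = (GREATEST k. k \<ge> 1 \<and> prime_rep n k)"

end

theory Submission
  imports Defs "HOL-Number_Theory.Totient" "HOL-Real_Asymp.Real_Asymp"
begin

text \<open>
  If an interval \<open>(n, n + K]\<close> contains more than \<open>y\<close> integers all of whose prime factors are at
  most \<open>y\<close>, then these cannot be given distinct primes, so \<open>g n < K\<close>. Both parts produce such
  smooth integers as products of several small factors.

  For (i) the products are \<open>D a b\<close> with \<open>D\<close> about \<open>n powr (2/9)\<close> and \<open>a, b\<close> about \<open>n powr (7/18)\<close>.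
  Around a point \<open>A\<close> with \<open>n / (D A\<^sup>2) = p / q\<close> the function \<open>n / (D a)\<close> is nearly linear
  of slope \<open>- p / q\<close>, so every block of \<open>q\<close> consecutive \<open>a\<close> contains one for which \<open>n / (D a)\<close>
  lies just below an integer \<open>b\<close>. Varying \<open>D\<close>, \<open>p\<close>, \<open>q\<close> gives enough products,
  even for some \<open>K\<close> smaller than \<open>sqrt n\<close> by a power of \<open>n\<close>.

  For (ii) the products have \<open>r\<close> factors of size \<open>n powr (1/r)\<close>. Their logarithms are detected
  by Fejer kernels; the variance over \<open>n\<close> is controlled by a mean value theorem for the trigonometric
  sums involved, together with van der Corput's power saving in a single factor
  \<open>\<Sum> a powr (i t)\<close>. Since one sums over integers rather than primes, the exceptional set
  even has size \<open>X powr (1 - c)\<close>.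
\<close>

subsection \<open>Prime representations and smooth numbers\<close>

text \<open>In (i) the extra factor \<open>D\<close> reconciles two demands. Let \<open>D\<close>
  have size \<open>n powr d\<close>, so that \<open>a\<close> and \<open>b\<close> have size
  \<open>n powr ((1 - d) / 2)\<close>. The curvature of \<open>n / (D a)\<close> over a block limits
  \<open>q\<close> to about the cube root of \<open>a\<close>. The length \<open>D a / q\<close> and
  the number \<open>D q^2\<close> of triples \<open>(D, p, q)\<close> then both have exponent
  \<open>1/3 + 2 d / 3\<close>. A length below \<open>sqrt n\<close> asks for
  \<open>d < 1/4\<close>; outnumbering the primes up to the size of \<open>a\<close> asks for
  \<open>d > 1/7\<close>. The value 2/9 lies between and leaves room for divisor losses.

  In (ii) the obstacle is the low frequencies, where a sum of \<open>a powr (i t)\<close> saves no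
  more than \<open>1 / t\<close>; the main term sits there. It is not evaluated: a long kernel is
  compared with a short one. The short kernel sum is always large, an exceptional \<open>n\<close>
  makes the long one small, and a Chebyshev argument bounds how often they can differ that much. One
  of the \<open>r\<close> factors is bounded pointwise, the other \<open>r - 1\<close> enter the
  mean value theorem. Taking \<open>r\<close> large in terms of \<open>\<epsilon>\<close> keeps the
  primes far below \<open>n powr \<epsilon>\<close>.\<close>

lemma prime_rep_antimono:
  assumes "prime_rep n k" "j \<le> k"
  shows "prime_rep n j"
proof -
  obtain P where P: "inj_on P {1..k}" "\<forall>i\<in>{1..k}. prime (P i) \<and> P i dvd n + i"
    using assms(1) unfolding prime_rep_def by blast
  have "inj_on P {1..j}" using P(1) assms(2) by (auto intro: inj_on_subset)
  with P(2) assms(2) show ?thesis unfolding prime_rep_def by (intro exI[of _ P]) auto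
qed

text \<open>\<open>GREATEST\<close> is informative only with a witness and a bound:
  \<open>k = 1\<close> is a witness because \<open>n + 1\<close> has a prime factor, and by
  antitonicity a failure at \<open>K\<close> excludes everything from \<open>K\<close> on.\<close>

lemma g_less:
  assumes "n \<ge> 1" "\<not> prime_rep n K"
  shows "g n < K"
proof -
  obtain p :: nat where p: "prime p" "p dvd n + 1"
    using prime_factor_nat[of "n + 1"] assms(1) by auto
  have 1: "1 \<ge> (1::nat) \<and> prime_rep n 1"
    unfolding prime_rep_def by (intro conjI exI[of _ "\<lambda>_. p"]) (use p in auto)
  have bd: "\<forall>k. k \<ge> 1 \<and> prime_rep n k \<longrightarrow> k \<le> K"
    using prime_rep_antimono assms(2) nat_le_linear by blast
  have "g n \<ge> 1 \<and> prime_rep n (g n)"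
    unfolding g_def by (rule GreatestI_nat[where P = "\<lambda>k. k \<ge> 1 \<and> prime_rep n k", OF 1]) (use bd in blast)
  thus ?thesis using prime_rep_antimono assms(2) not_le by blast
qed

text \<open>Hall's condition fails on the smooth numbers of the interval as soon as they outnumber the
  primes available to them.\<close>
lemma not_prime_rep_if_many_smooth:
  assumes S: "S \<subseteq> {n<..n + K}" and smooth: "\<And>m p. m \<in> S \<Longrightarrow> prime p \<Longrightarrow> p dvd m \<Longrightarrow> p \<le> y"
    and card: "card S > y"
  shows "\<not> prime_rep n K"
proof
  assume "prime_rep n K"
  then obtain P where P: "inj_on P {1..K}" "\<forall>i\<in>{1..K}. prime (P i) \<and> P i dvd n + i"
    unfolding prime_rep_def by blast
  have mem: "m - n \<in> {1..K}" "n + (m - n) = m" if "m \<in> S" for m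
    using subsetD[OF S that] by auto
  have "inj_on (\<lambda>m. P (m - n)) S"
  proof (rule inj_onI)
    fix a b assume "a \<in> S" "b \<in> S" "P (a - n) = P (b - n)"
    hence "a - n = b - n" using P(1) mem by (meson inj_onD)
    thus "a = b" using mem[OF \<open>a \<in> S\<close>] mem[OF \<open>b \<in> S\<close>] by metis
  qed
  moreover have "(\<lambda>m. P (m - n)) ` S \<subseteq> {1..y}"
  proof
    fix q assume "q \<in> (\<lambda>m. P (m - n)) ` S"
    then obtain m where m: "m \<in> S" "q = P (m - n)" by blast
    have "prime q" "q dvd m" using P(2) mem[OF m(1)] m(2) by metis+
    thus "q \<in> {1..y}" using smooth[OF m(1)] prime_ge_1_nat by auto
  qed
  ultimately have "card S \<le> card {1..y}"
    using card_inj_on_le by blast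
  thus False using card by simp
qed

section \<open>The divisor bound and a lower bound for the totient\<close>

definition num_divs :: "nat \<Rightarrow> nat" where "num_divs m = card {d. d dvd m}"

lemma num_divs_prime_power_mult:
  assumes "prime p" "m > 0"
  shows "num_divs (p ^ e * m) \<le> (e + 1) * num_divs m"
proof -
  have fin: "finite {d. d dvd m}" using assms(2) by simp
  have "{d. d dvd p ^ e * m} \<subseteq> (\<lambda>(i, d). p ^ i * d) ` ({..e} \<times> {d. d dvd m})"
  proof
    fix d assume "d \<in> {d. d dvd p ^ e * m}"
    then obtain b c where "d = b * c" "b dvd p ^ e" "c dvd m"
      using division_decomp[of d "p ^ e" m] by blast
    moreover then obtain i where "i \<le> e" "b = p ^ i"
      using divides_primepow_nat[OF assms(1)] by blast
    ultimately show "d \<in> (\<lambda>(i, d). p ^ i * d) ` ({..e} \<times> {d. d dvd m})" by force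
  qed
  hence "num_divs (p ^ e * m) \<le> card ({..e} \<times> {d. d dvd m})"
    unfolding num_divs_def using fin by (meson finite_SigmaI finite_atMost surj_card_le)
  thus ?thesis by (simp add: num_divs_def card_cartesian_product)
qed

text \<open>Prime by prime, the factor \<open>e + 1\<close> is compared with
  \<open>p powr (e * \<delta>)\<close>. From \<open>2 powr (1/\<delta>)\<close> on the comparison
  holds outright; each smaller prime costs a constant \<open>c\<close>, and there are at most
  \<open>B\<close> of them, so \<open>c ^ B\<close> works.\<close>

lemma num_divs_bound:
  fixes \<delta> :: real
  assumes "\<delta> > 0"
  shows "\<exists>C\<ge>1. \<forall>m>0. real (num_divs m) \<le> C * real m powr \<delta>"
proof -
  define B where "B = nat \<lceil>2 powr (1/\<delta>)\<rceil>"
  \<comment> \<open>\<open>2 powr (e * \<delta>)\<close> is at least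
    \<open>1 + e * \<delta> * ln 2\<close>; this \<open>c\<close> lifts that to
    \<open>e + 1\<close>.\<close>
  define c where "c = 1 + 1 / (\<delta> * ln 2)"
  have c1: "c \<ge> 1" unfolding c_def using assms by simp
  have pow2: "real p powr \<delta> \<ge> 2" if "p \<ge> B" for p
  proof -
    have "2 powr (1/\<delta>) \<le> real p" using that unfolding B_def by linarith
    hence "(2 powr (1/\<delta>)) powr \<delta> \<le> real p powr \<delta>" using assms by (intro powr_mono2) auto
    thus ?thesis using assms by (simp add: powr_powr)
  qed
  have small: "real e + 1 \<le> c * real (p ^ e) powr \<delta>" if "prime p" for p e :: nat
  proof -
    have "1 + real e * \<delta> * ln 2 \<le> exp (real e * \<delta> * ln 2)" by (rule exp_ge_add_one_self)
    also have "\<dots> = 2 powr (real e * \<delta>)" by (simp add: powr_def mult_ac)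
    also have "\<dots> \<le> real p powr (real e * \<delta>)"
      using assms prime_ge_2_nat[OF that] by (intro powr_mono2) auto
    also have "\<dots> = real (p ^ e) powr \<delta>"
      using prime_gt_0_nat[OF that] by (simp add: powr_powr flip: powr_realpow)
    finally have "c * (1 + real e * \<delta> * ln 2) \<le> c * real (p ^ e) powr \<delta>"
      using c1 by (intro mult_left_mono) auto
    moreover have "c * (1 + real e * \<delta> * ln 2) = 1 + real e * \<delta> * ln 2 + (1 / (\<delta> * ln 2) + real e)"
      unfolding c_def using assms by (simp add: field_simps)
    moreover have "real e * \<delta> * ln 2 \<ge> 0" "1 / (\<delta> * ln 2) \<ge> 0" using assms by auto
    ultimately show ?thesis by linarith
  qed
  have large: "real e + 1 \<le> real (p ^ e) powr \<delta>" if "prime p" "p \<ge> B" for p e :: nat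
  proof -
    have "real e + 1 \<le> 2 ^ e"
      using less_exp[of e] by (metis Suc_leI of_nat_Suc of_nat_le_iff of_nat_numeral of_nat_power add.commute)
    also have "\<dots> \<le> (real p powr \<delta>) ^ e" using pow2[OF that(2)] by (intro power_mono) auto
    also have "\<dots> = real (p ^ e) powr \<delta>"
      using prime_gt_0_nat[OF that(1)] by (simp add: powr_powr mult_ac flip: powr_realpow)
    finally show ?thesis .
  qed
  \<comment> \<open>The induction strips one full prime power at a time and pays \<open>c\<close>
    only for the small primes counted by \<open>w\<close>.\<close>
  define w where "w = (\<lambda>m::nat. card {p. prime p \<and> p dvd m \<and> p < B})"
  have main: "real (num_divs m) \<le> c ^ w m * real m powr \<delta>" if "m > 0" for m
    using that
  proof (induction m rule: less_induct)
    case (less m)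
    show ?case
    proof (cases "m = 1")
      case True
      thus ?thesis using c1 by (simp add: num_divs_def)
    next
      case False
      then obtain p where p: "prime p" "p dvd m" using prime_factor_nat by blast
      have "\<not> is_unit p" using p by auto
      then obtain k where k: "m = p ^ multiplicity p m * k" "\<not> p dvd k"
        using multiplicity_decompose'[of m p] less.prems by (metis neq0_conv)
      define e where "e = multiplicity p m"
      have e: "e > 0" unfolding e_def using p less.prems by (simp add: prime_multiplicity_gt_zero_iff)
      have k0: "k > 0" using k less.prems by (metis gr0I mult_0_right)
      have "p ^ e > 1" using e prime_gt_1_nat[OF p(1)] by (meson one_less_power)
      hence "k < m" using k(1) k0 e_def by (metis mult.commute mult_less_cancel1 nat_mult_1_right n_less_m_mult_n)
      hence IH: "real (num_divs k) \<le> c ^ w k * real k powr \<delta>" using less.IH k0 by blast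
      have nd: "real (num_divs m) \<le> (real e + 1) * real (num_divs k)"
        using num_divs_prime_power_mult[OF p(1) k0, of e] k(1) e_def
        by (metis of_nat_1 of_nat_add of_nat_le_iff of_nat_mult)
      have set: "{q. prime q \<and> q dvd m \<and> q < B} = {q. prime q \<and> q dvd k \<and> q < B} \<union> {q. q = p \<and> q < B}"
      proof -
        have "q dvd m \<longleftrightarrow> q dvd k \<or> q = p" if "prime q" for q
          using that p(1) e k(1) unfolding e_def
          by (metis dvd_refl prime_dvd_mult_iff prime_dvd_power_iff primes_dvd_imp_eq)
        thus ?thesis using p(1) by blast
      qed
      have fin: "finite {q. prime q \<and> q dvd k \<and> q < B}"
        by (rule finite_subset[of _ "{..<B}"]) auto
      have wm: "w m = w k + (if p < B then 1 else 0)"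
      proof -
        have "{q. q = p \<and> q < B} = (if p < B then {p} else {})" by auto
        moreover have "{q. prime q \<and> q dvd k \<and> q < B} \<inter> {q. q = p \<and> q < B} = {}" using k(2) by blast
        ultimately show ?thesis
          unfolding w_def set by (subst card_Un_disjoint) (use fin in auto)
      qed
      have pe: "real (p ^ e) powr \<delta> * real k powr \<delta> = real m powr \<delta>"
        using arg_cong[OF k(1), of "\<lambda>x. real x powr \<delta>"] unfolding e_def[symmetric] of_nat_mult by (simp add: powr_mult)
      have fac: "real e + 1 \<le> c ^ (if p < B then 1 else 0) * real (p ^ e) powr \<delta>"
        using small[OF p(1), of e] large[OF p(1), of e] by auto
      have "real (num_divs m) \<le> (c ^ (if p < B then 1 else 0) * real (p ^ e) powr \<delta>) * (c ^ w k * real k powr \<delta>)"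
        using nd mult_mono[OF fac IH] c1 by (smt (verit) mult_nonneg_nonneg of_nat_0_le_iff powr_ge_zero zero_le_power)
      also have "\<dots> = c ^ w m * real m powr \<delta>"
        unfolding wm pe[symmetric] power_add by (simp only: mult_ac)
      finally show ?thesis .
    qed
  qed
  have "real (num_divs m) \<le> c ^ B * real m powr \<delta>" if "m > 0" for m
  proof -
    have "w m \<le> card {..<B}" unfolding w_def by (intro card_mono) auto
    hence "c ^ w m \<le> c ^ B" using c1 by (intro power_increasing) auto
    thus ?thesis using main[OF that] by (meson mult_right_mono order_trans powr_ge_zero)
  qed
  moreover have "c ^ B \<ge> 1" using c1 by simp
  ultimately show ?thesis by blast
qed

text \<open>In Gauss's identity each divisor of \<open>q\<close> contributes at most
  \<open>totient q\<close>. With the divisor bound this makes \<open>totient q\<close> almost as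
  large as \<open>q\<close>, so fractions with denominator \<open>q\<close> are plentiful.\<close>

lemma le_num_divs_mult_totient:
  "q \<le> num_divs q * totient q"
proof (cases "q = 0")
  case False
  have "q = (\<Sum>d | d dvd q. totient d)" by (simp add: totient_divisor_sum)
  also have "\<dots> \<le> (\<Sum>d | d dvd q. totient q)"
    using False by (intro sum_mono totient_dvd_mono) auto
  finally show ?thesis by (simp add: num_divs_def)
qed simp

subsection \<open>Products of three factors in short intervals\<close>

text \<open>Put \<open>X = n / D\<close> and \<open>a = A + s\<close>. As
  \<open>A\<^sup>2 = X * q / p\<close>, the quotient \<open>q * X / a\<close> equals
  \<open>p * (2 * A - a)\<close> plus a curvature term \<open>p * s\<^sup>2 / a\<close> in
  \<open>[0, 1]\<close>. The linear part moves by \<open>p\<close> per unit of \<open>a\<close>, so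
  a suitable residue of \<open>a\<close> modulo \<open>q\<close> puts \<open>q * X / a\<close> below
  a multiple \<open>q * b\<close> by at most 2. Then \<open>D * a * b\<close> overshoots
  \<open>n\<close> by at most \<open>2 * D * a / q\<close>.\<close>

lemma product_in_short_interval:
  fixes n k D p q :: nat and A :: real
  assumes A: "A = sqrt (real n * real q / (real D * real p))"
    and pos: "n > 0" "D > 0" "p > 0" "q > 0" and cop: "coprime p q"
    and large: "real p * real q ^ 2 \<le> A" and len: "2 * real D * (A + real q) \<le> real q * real k"
  shows "\<exists>a b. n < D * a * b \<and> D * a * b \<le> n + k \<and> A \<le> real a \<and> real a \<le> A + real q"
proof -
  have A0: "A > 0" unfolding A using pos by simp
  define X where "X = real n / real D"
  have X: "X * real q = A\<^sup>2 * real p" unfolding A X_def using pos by simp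
  define B where "B = real p * (2 * A - \<lceil>A\<rceil>)"
  define u where "u = \<lfloor>B\<rfloor>"
  \<comment> \<open>The offset 2 covers the fractional part of \<open>B\<close> (below 1) and the
    curvature term (at most 1): \<open>q * b'\<close> ends strictly above \<open>q * X / a\<close>,
    but by no more than 2.\<close>
  obtain x where x: "[int p * x = u + 2 - int p * 0] (mod int q)"
    using cong_solve_dvd_int[of "int p" "int q" "u + 2"] cop by auto
  define h where "h = nat (x mod int q)"
  have h: "int h = x mod int q" "h < q" unfolding h_def using pos by (auto simp: nat_less_iff)
  have "[int p * int h = u + 2] (mod int q)"
    using x unfolding h(1) by (simp add: cong_def mod_mult_right_eq)
  then obtain b' where b': "u + 2 - int p * int h = int q * b'"
    by (metis cong_iff_dvd_diff cong_sym dvdE)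
  define a where "a = nat \<lceil>A\<rceil> + h"
  define s where "s = real a - A"
  have a: "real a = of_int \<lceil>A\<rceil> + real h" unfolding a_def using A0 by simp
  have s: "0 \<le> s" "s \<le> real q" unfolding s_def a using h(2) by linarith+
  have apos: "real a > 0" using s(1) A0 unfolding s_def by linarith
  define E where "E = real p * s\<^sup>2 / real a"
  have E0: "E \<ge> 0" unfolding E_def by simp
  have "real p * s\<^sup>2 \<le> real p * real q ^ 2" using s by (intro mult_left_mono power_mono) auto
  also have "\<dots> \<le> real a" using large s(1) unfolding s_def by linarith
  finally have E1: "E \<le> 1" unfolding E_def using apos by simp
  have "A\<^sup>2 = (2 * A - real a) * real a + s\<^sup>2" unfolding s_def by (simp add: power2_eq_square algebra_simps)
  hence "real p * A\<^sup>2 = real p * (2 * A - real a) * real a + real p * s\<^sup>2"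
    by (simp only: distrib_left mult.assoc)
  hence "real p * A\<^sup>2 / real a = real p * (2 * A - real a) + E"
    unfolding E_def using apos by (simp add: add_divide_distrib)
  hence key: "real q * (X / real a) = B - real p * real h + E"
    using X unfolding B_def a by (simp add: algebra_simps)
  have qb: "real q * of_int b' = of_int u + 2 - real p * real h"
    using b' by (metis (no_types, opaque_lifting) of_int_add of_int_diff of_int_mult of_int_numeral of_int_of_nat_eq)
  have u: "of_int u \<le> B" "B < of_int u + 1" unfolding u_def by linarith+
  have "real q * (X / real a) < real q * of_int b'" using key qb u E1 by linarith
  hence 1: "X / real a < of_int b'" using pos by (simp only: mult_less_cancel_left_pos of_nat_0_less_iff)
  have "real q * of_int b' \<le> real q * (X / real a) + 2" using key qb u E0 by linarith
  hence 2: "of_int b' \<le> X / real a + 2 / real q" using pos by (simp add: field_simps)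
  have "X / real a > 0" unfolding X_def using pos apos by simp
  with 1 have b0: "b' > 0" by linarith
  define b where "b = nat b'"
  have b: "real b = of_int b'" unfolding b_def using b0 by simp
  have low: "real n < real D * real a * real b"
    using 1 apos pos unfolding b X_def by (simp add: field_simps)
  have "real D * real a * real b \<le> real D * real a * (X / real a + 2 / real q)"
    using 2 unfolding b by (intro mult_left_mono) auto
  also have "\<dots> = real n + 2 * real D * real a / real q"
    unfolding X_def using apos pos by (simp add: field_simps)
  also have "2 * real D * real a / real q \<le> real k"
  proof -
    have "2 * real D * real a \<le> 2 * real D * (A + real q)"
      using s unfolding s_def by (intro mult_left_mono) auto
    also have "\<dots> \<le> real q * real k" by (rule len)
    finally show ?thesis using pos by (simp add: field_simps)
  qed
  finally have up: "real D * real a * real b \<le> real n + real k" by simp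
  have "n < D * a * b" using low by (metis of_nat_less_iff of_nat_mult)
  moreover have "D * a * b \<le> n + k" using up by (metis of_nat_le_iff of_nat_mult of_nat_add)
  ultimately show ?thesis using s unfolding s_def by (intro exI[of _ a] exI[of _ b]) auto
qed

text \<open>Distinct fractions with denominators at most \<open>R\<close> differ by at least \<open>1 / R\<^sup>2\<close>,
  so the blocks around the corresponding points \<open>A\<close> are disjoint.\<close>
lemma fraction_determined_by_block:
  fixes n D p q p' q' a :: nat and R A A' :: real
  assumes A: "A = sqrt (real n * real q / (real D * real p))"
    and A': "A' = sqrt (real n * real q' / (real D * real p'))"
    and pos: "n > 0" "D > 0" "p > 0" "q > 0" "p' > 0" "q' > 0"
    and cop: "coprime p q" "coprime p' q'"
    and le: "q \<le> p" "real p \<le> R" "q' \<le> p'" "real p' \<le> R"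
    and a: "A \<le> real a" "real a \<le> A + real q" "A' \<le> real a" "real a \<le> A' + real q'"
    and large: "4 * R ^ 3 < A"
  shows "p = p' \<and> q = q'"
proof (rule ccontr)
  assume neq: "\<not> (p = p' \<and> q = q')"
  have "p * q' \<noteq> p' * q"
  proof
    assume eq: "p * q' = p' * q"
    have "p dvd p'" using eq cop(1) by (metis coprime_dvd_mult_left_iff dvd_triv_left)
    moreover have "p' dvd p" using eq cop(2) by (metis coprime_dvd_mult_left_iff dvd_triv_left)
    ultimately have "p = p'" by (simp add: dvd_antisym)
    thus False using eq neq pos by simp
  qed
  hence "\<bar>real p * real q' - real p' * real q\<bar> \<ge> 1"
  proof -
    have "int p * int q' \<noteq> int p' * int q" using \<open>p * q' \<noteq> _\<close> by (metis of_nat_eq_iff of_nat_mult)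
    hence "\<bar>int p * int q' - int p' * int q\<bar> \<ge> 1" by linarith
    hence "real_of_int \<bar>int p * int q' - int p' * int q\<bar> \<ge> 1" by linarith
    thus ?thesis by simp
  qed
  hence diff: "1 / (real p * real p') \<le> \<bar>real q' / real p' - real q / real p\<bar>"
  proof -
    have "real q' / real p' - real q / real p = (real p * real q' - real p' * real q) / (real p * real p')"
      using pos by (simp add: field_simps)
    thus ?thesis using \<open>1 \<le> _\<close> pos by (simp add: divide_right_mono)
  qed
  \<comment> \<open>A gap between the fractions is a gap between \<open>A\<^sup>2\<close> and
    \<open>A'\<^sup>2\<close>, of size at least \<open>X / R\<^sup>2\<close>, hence at least
    \<open>A\<^sup>2 / R\<^sup>2\<close>. A common \<open>a\<close> forces
    \<open>\<bar>A' - A\<bar> \<le> R\<close>, which leaves a gap of at most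
    \<open>4 * R * A\<close>.\<close>
  define X where "X = real n / real D"
  have X0: "X > 0" unfolding X_def using pos by simp
  have sq: "A\<^sup>2 = X * (real q / real p)" "A'\<^sup>2 = X * (real q' / real p')"
    unfolding A A' X_def using pos by simp_all
  have A0: "A > 0" "A' > 0" unfolding A A' using pos by simp_all
  have R1: "R \<ge> 1" using le pos by linarith
  have AX: "A\<^sup>2 \<le> X"
    unfolding sq using X0 le(1) pos by (simp add: field_simps)
  have "R \<le> R ^ 3" using R1 self_le_power[of R 3] by simp
  hence RA: "R \<le> A" using large R1 by linarith
  have "\<bar>A' - A\<bar> \<le> R" using a le by linarith
  moreover have "A' + A \<le> 4 * A" using a le RA by linarith
  ultimately have "\<bar>A' - A\<bar> * (A' + A) \<le> R * (4 * A)" using A0 by (intro mult_mono) auto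
  moreover have "\<bar>A'\<^sup>2 - A\<^sup>2\<bar> = \<bar>A' - A\<bar> * (A' + A)"
  proof -
    have "A'\<^sup>2 - A\<^sup>2 = (A' - A) * (A' + A)" by (simp add: power2_eq_square algebra_simps)
    thus ?thesis using A0 by (simp only: abs_mult)
  qed
  ultimately have "X * \<bar>real q' / real p' - real q / real p\<bar> \<le> 4 * R * A"
    unfolding sq using X0 by (simp only: abs_mult abs_of_pos flip: right_diff_distrib)
  hence "X * (1 / (real p * real p')) \<le> 4 * R * A"
    using diff X0 by (smt (verit) mult_left_mono)
  hence "X \<le> 4 * R * A * (real p * real p')" using pos by (simp add: field_simps)
  also have "\<dots> \<le> 4 * R * A * (R * R)" using le R1 A0 by (intro mult_left_mono mult_mono) auto
  also have "\<dots> = 4 * R ^ 3 * A" by (simp add: power3_eq_cube)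
  also have "\<dots> < A * A" using large A0 by simp
  finally show False using AX by (simp add: power2_eq_square)
qed

text \<open>The totatives of \<open>q\<close> are shifted by \<open>q\<close>. Numerators in this
  range keep \<open>p / q\<close> between 1 and 2, so all points \<open>A\<close> have the same
  order of magnitude.\<close>

lemma card_coprime_interval_ge_totient: "totient q \<le> card {p \<in> {q<..2 * q}. coprime p q}"
proof -
  have "totient q = card ((+) q ` totatives q)"
    unfolding totient_def by (rule card_image[symmetric]) simp
  also have "\<dots> \<le> card {p \<in> {q<..2 * q}. coprime p q}"
    by (intro card_mono) (auto simp: totatives_def coprime_iff_gcd_eq_1 add.commute[of q])
  finally show ?thesis .
qed

section \<open>Part (i): counting the products\<close>

text \<open>In powers of \<open>s\<close>: \<open>D\<close> is about \<open>s ^ 16\<close>,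
  \<open>p\<close> and \<open>q\<close> about \<open>s ^ 9\<close>, \<open>a\<close> and
  \<open>b\<close> about \<open>s ^ 28\<close>, and the required length about \<open>s ^ 35\<close>,
  below \<open>sqrt n = s ^ 36\<close>. The divisor exponent 1/72 makes each divisor count cost one
  factor \<open>s\<close>. Of the roughly \<open>s ^ 34\<close> triples, one \<open>s\<close> is
  lost to the totient and two to coinciding products, so about \<open>s ^ 31\<close> smooth numbers
  face the primes up to \<open>4 * s ^ 28\<close>.\<close>

lemma not_prime_rep_below_sqrt:
  fixes n :: nat and s C :: real
  assumes s: "s = real n powr (1/72)" and s300: "s \<ge> 600" and sC: "s > 256 * C ^ 3" and C: "C \<ge> 1"
    and nd: "\<And>m. m > 0 \<Longrightarrow> real (num_divs m) \<le> C * real m powr (1/72)"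
  shows "\<not> prime_rep n (nat \<lfloor>real n powr (71/144)\<rfloor>)"
proof -
  have n0: "n > 0" using s s300 by (cases "n = 0") auto
  have s0: "s > 0" using s300 by simp
  have ns: "real n = s ^ 72"
  proof -
    have "s ^ 72 = s powr real 72" using s0 by (subst powr_realpow) auto
    also have "\<dots> = real n powr ((1/72) * real 72)" unfolding s powr_powr ..
    finally show ?thesis using n0 by simp
  qed
  have powle: "c * s ^ i \<le> s ^ j" if "i < j" "c \<le> 600" for c :: real and i j :: nat
  proof -
    have "c * s ^ i \<le> s * s ^ i" using that s300 s0 by (intro mult_right_mono) auto
    also have "\<dots> = s ^ Suc i" by simp
    also have "\<dots> \<le> s ^ j" using that s300 by (intro power_increasing) auto
    finally show ?thesis .
  qed
  define k where "k = nat \<lfloor>real n powr (71/144)\<rfloor>"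
  have kreal: "real n powr (71/144) = s ^ 35 * sqrt s"
  proof -
    have "real n powr (71/144) = (real n powr (1/72)) powr (real 35 + 1/2)" by (simp add: powr_powr)
    also have "\<dots> = s powr real 35 * s powr (1/2)" unfolding s[symmetric] by (rule powr_add)
    finally show ?thesis using s0 by (simp add: powr_realpow powr_half_sqrt)
  qed
  \<comment> \<open>The spare factor \<open>sqrt s\<close> in the length pays for the constants: the
    blocks require \<open>8 * s ^ 35\<close>.\<close>
  have "sqrt s \<ge> sqrt 256" using s300 by (intro real_sqrt_le_mono) auto
  hence s16: "sqrt s \<ge> 16" by simp
  have "s ^ 35 * sqrt s \<ge> s ^ 35 * 16" using s16 s0 by (intro mult_left_mono) auto
  moreover have "s ^ 35 \<ge> 1" using s300 by (intro one_le_power) auto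
  ultimately have k_ge: "real k \<ge> 8 * s ^ 35" unfolding k_def kreal by linarith
  have k_le: "real k \<le> real n"
  proof -
    have "sqrt s \<le> s" using s300 by (simp add: real_le_lsqrt self_le_power)
    hence "s ^ 35 * sqrt s \<le> s ^ 35 * s" using s0 by (intro mult_left_mono) auto
    also have "\<dots> \<le> s ^ 72" using powle[of 36 72 1] by (simp add: power_Suc2[symmetric] del: power_Suc)
    finally have "s ^ 35 * sqrt s \<le> real n" unfolding ns .
    moreover have "s ^ 35 * sqrt s \<ge> 0" using s0 by simp
    ultimately show ?thesis unfolding k_def kreal by linarith
  qed
  \<comment> \<open>A common bound for \<open>D\<close>, \<open>a\<close> and \<open>b\<close>,
    hence for every prime factor of a product.\<close>
  define y where "y = nat \<lfloor>4 * s ^ 28\<rfloor>"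
  define d where "d = nat \<lfloor>s ^ 16\<rfloor>"
  define Q where "Q = nat \<lfloor>s ^ 9\<rfloor>"
  have big: "s ^ 16 \<ge> 2" "s ^ 9 \<ge> 2"
    using powle[of 0 16 2] powle[of 0 9 2] by simp_all
  have d: "real d \<le> s ^ 16" "s ^ 16 < real d + 1" "real d \<ge> s ^ 16 / 2"
    unfolding d_def using big by linarith+
  have Q: "real Q \<le> s ^ 9" "s ^ 9 < real Q + 1" "real Q \<ge> s ^ 9 / 2"
    unfolding Q_def using big by linarith+
  define P where "P = (\<lambda>q::nat. {p \<in> {q<..2 * q}. coprime p q})"
  define T where "T = (SIGMA D:{d<..2 * d}. SIGMA q:{Q<..2 * Q}. P q)"
  define S where "S = {m \<in> {n<..n + k}. \<forall>p. prime p \<longrightarrow> p dvd m \<longrightarrow> p \<le> y}"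
  define A where "A = (\<lambda>(D::nat, q::nat, p::nat). sqrt (real n * real q / (real D * real p)))"
  have Tbounds: "s ^ 16 < real D" "real D \<le> 2 * s ^ 16" "s ^ 9 < real q" "real q \<le> 2 * s ^ 9"
      "q < p" "real p \<le> 4 * s ^ 9" "coprime p q" "D > 0" "p > 0" "q > 0"
      "A (D, q, p) \<le> s ^ 28" "A (D, q, p) \<ge> s ^ 28 / 2"
    if "(D, q, p) \<in> T" for D q p
  proof -
    have D: "d + 1 \<le> D" "D \<le> 2 * d" and q: "Q + 1 \<le> q" "q \<le> 2 * Q"
      and p: "q < p" "p \<le> 2 * q" "coprime p q"
      using that unfolding T_def P_def by auto
    show b1: "s ^ 16 < real D" "real D \<le> 2 * s ^ 16" using D d by linarith+
    show b2: "s ^ 9 < real q" "real q \<le> 2 * s ^ 9" using q Q by linarith+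
    show "q < p" "coprime p q" by fact+
    show "real p \<le> 4 * s ^ 9" using p b2 by linarith
    show pos: "D > 0" "p > 0" "q > 0" using D p q by auto
    have "A (D, q, p) \<le> sqrt (s ^ 56)"
      unfolding A_def prod.case
    proof (intro real_sqrt_le_mono)
      have "real n * real q \<le> s ^ 72 * real p" unfolding ns using p s0 by (intro mult_left_mono) auto
      also have "\<dots> = s ^ 56 * (s ^ 16 * real p)" by (simp flip: power_add mult.assoc)
      also have "\<dots> \<le> s ^ 56 * (real D * real p)" using b1 s0 by (intro mult_left_mono mult_right_mono) auto
      finally show "real n * real q / (real D * real p) \<le> s ^ 56" using pos by (simp add: field_simps)
    qed
    also have "sqrt (s ^ 56) = s ^ 28"
      using s0 by (intro real_sqrt_unique) (auto simp flip: power_mult)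
    finally show "A (D, q, p) \<le> s ^ 28" .
    have "s ^ 28 / 2 = sqrt (s ^ 56 / 4)"
      using s0 by (intro real_sqrt_unique[symmetric]) (auto simp: power_divide simp flip: power_mult)
    also have "\<dots> \<le> A (D, q, p)"
      unfolding A_def prod.case
    proof (intro real_sqrt_le_mono)
      have "s ^ 56 / 4 * (real D * real p) \<le> s ^ 56 / 4 * ((2 * s ^ 16) * (2 * real q))"
        using b1 p s0 by (intro mult_left_mono mult_mono) auto
      also have "\<dots> = real n * real q" unfolding ns by (simp flip: power_add mult.assoc)
      finally show "s ^ 56 / 4 \<le> real n * real q / (real D * real p)" using pos by (simp add: field_simps)
    qed
    finally show "A (D, q, p) \<ge> s ^ 28 / 2" .
  qed
  have ex: "\<exists>a b. n < D * a * b \<and> D * a * b \<le> n + k \<and> A (D, q, p) \<le> real a \<and> real a \<le> A (D, q, p) + real q"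
    if "(D, q, p) \<in> T" for D q p
  proof (rule product_in_short_interval)
    note b = Tbounds[OF that]
    show "A (D, q, p) = sqrt (real n * real q / (real D * real p))" by (simp add: A_def)
    show "n > 0" "D > 0" "p > 0" "q > 0" "coprime p q" using n0 b by auto
    have "real p * real q ^ 2 \<le> (4 * s ^ 9) * (2 * s ^ 9) ^ 2"
      using b s0 by (intro mult_mono power_mono) auto
    also have "\<dots> = 16 * s ^ 27" by (simp add: power_mult_distrib flip: power_add power_mult)
    also have "\<dots> \<le> s ^ 28 / 2" using powle[of 27 28 32] by simp
    finally show "real p * (real q)\<^sup>2 \<le> A (D, q, p)" using b by linarith
    have "real q \<le> s ^ 28" using b powle[of 9 28 2] by linarith
    hence "2 * real D * (A (D, q, p) + real q) \<le> 2 * (2 * s ^ 16) * (2 * s ^ 28)"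
      using b s0 by (intro mult_mono) (auto simp: A_def)
    also have "\<dots> = s ^ 9 * (8 * s ^ 35)" by (simp flip: power_add mult.assoc)
    also have "\<dots> \<le> real q * real k" using b k_ge s0 by (intro mult_mono) auto
    finally show "2 * real D * (A (D, q, p) + real q) \<le> real q * real k" .
  qed
  have "\<exists>f. \<forall>t\<in>T. n < fst t * fst (f t) * snd (f t) \<and> fst t * fst (f t) * snd (f t) \<le> n + k \<and>
      A t \<le> real (fst (f t)) \<and> real (fst (f t)) \<le> A t + real (fst (snd t))"
  proof (intro bchoice ballI)
    fix t assume t: "t \<in> T"
    obtain D q p where t': "t = (D, q, p)" by (cases t)
    from ex[of D q p] t show "\<exists>z. n < fst t * fst z * snd z \<and> fst t * fst z * snd z \<le> n + k \<and>
      A t \<le> real (fst z) \<and> real (fst z) \<le> A t + real (fst (snd t))" unfolding t' by simp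
  qed
  then obtain f where f: "\<And>t. t \<in> T \<Longrightarrow> n < fst t * fst (f t) * snd (f t)"
      "\<And>t. t \<in> T \<Longrightarrow> fst t * fst (f t) * snd (f t) \<le> n + k"
      "\<And>t. t \<in> T \<Longrightarrow> A t \<le> real (fst (f t))" "\<And>t. t \<in> T \<Longrightarrow> real (fst (f t)) \<le> A t + real (fst (snd t))"
    by blast
  \<comment> \<open>Remembering the divisors \<open>D\<close> and \<open>a\<close> makes the map
    injective, because the block around \<open>a\<close> determines \<open>(q, p)\<close>. Each
    product \<open>m\<close> therefore arises from at most \<open>num_divs m\<close> squared
    triples.\<close>
  define \<Phi> where "\<Phi> = (\<lambda>t. (fst t * fst (f t) * snd (f t), fst t, fst (f t)))"
  have inj: "inj_on \<Phi> T"
  proof (rule inj_onI)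
    fix t t' assume t: "t \<in> T" "t' \<in> T" and eq: "\<Phi> t = \<Phi> t'"
    obtain D q p where tt: "t = (D, q, p)" by (cases t)
    obtain D' q' p' where tt': "t' = (D', q', p')" by (cases t')
    have D: "D' = D" "fst (f t') = fst (f t)" using eq unfolding \<Phi>_def tt tt' by auto
    note b = Tbounds[OF t(1)[unfolded tt]] and b' = Tbounds[OF t(2)[unfolded tt']]
    have "p = p' \<and> q = q'"
    proof (rule fraction_determined_by_block[where R = "4 * s ^ 9" and n = n and D = D and a = "fst (f t)"])
      show "A t = sqrt (real n * real q / (real D * real p))" by (simp add: A_def tt)
      show "A t' = sqrt (real n * real q' / (real D * real p'))" by (simp add: A_def tt' D)
      \<comment> \<open>Separation of the blocks needs \<open>512 < s\<close>; it is also why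
        \<open>q\<close> stays at \<open>s ^ 9\<close>, just below the cube root of
        \<open>s ^ 28\<close>.\<close>
      show "4 * (4 * s ^ 9) ^ 3 < A t"
      proof -
        have "4 * (4 * s ^ 9) ^ 3 = 256 * s ^ 27" by (simp add: power_mult_distrib flip: power_mult)
        also have "\<dots> < s ^ 28 / 2"
        proof -
          have "512 * s ^ 27 < 600 * s ^ 27" using s0 by simp
          also have "\<dots> \<le> s ^ 28" using powle[of 27 28 600] by simp
          finally show ?thesis by simp
        qed
        finally show ?thesis using b(12) tt by simp
      qed
    qed (use b b' n0 f(3,4)[OF t(1)] f(3,4)[OF t(2)] D tt tt' in auto)
    thus "t = t'" by (simp add: tt tt' D)
  qed
  have range: "\<Phi> ` T \<subseteq> (SIGMA m:S. {e. e dvd m} \<times> {e. e dvd m})"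
  proof
    fix z assume "z \<in> \<Phi> ` T"
    then obtain t where t: "t \<in> T" "z = \<Phi> t" by blast
    obtain D q p where tt: "t = (D, q, p)" by (cases t)
    obtain a b where ab: "f (D, q, p) = (a, b)" by (cases "f (D, q, p)")
    note bd = Tbounds[OF t(1)[unfolded tt]]
    have lo: "n < D * a * b" and up: "D * a * b \<le> n + k" and a: "A t \<le> real a" "real a \<le> A t + real q"
      using f[OF t(1)] by (simp_all add: tt ab)
    have a1: "real a \<le> 4 * s ^ 28" using a bd powle[of 9 28 2] tt by auto
    have a2: "real a \<ge> s ^ 28 / 2" using a bd tt by auto
    have D1: "real D \<le> 4 * s ^ 28" using bd powle[of 16 28 2] by auto
    \<comment> \<open>\<open>D\<close> and \<open>a\<close> are bounded below, so a larger
      \<open>b\<close> would push the product beyond \<open>2 * n\<close>.\<close>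
    have b1: "real b \<le> 4 * s ^ 28"
    proof (rule ccontr)
      assume "\<not> real b \<le> 4 * s ^ 28"
      moreover have "real a > 0" using a2 s0 by (smt (verit) divide_pos_pos zero_less_power)
      ultimately have "real D * real a * (4 * s ^ 28) < real D * real a * real b" using bd by simp
      moreover have "s ^ 16 * (s ^ 28 / 2) * (4 * s ^ 28) \<le> real D * real a * (4 * s ^ 28)"
        using bd a2 s0 by (intro mult_right_mono mult_mono) auto
      ultimately have "s ^ 16 * (s ^ 28 / 2) * (4 * s ^ 28) < real D * real a * real b" by linarith
      also have "s ^ 16 * (s ^ 28 / 2) * (4 * s ^ 28) = 2 * s ^ 72" by (simp flip: power_add mult.assoc)
      finally have "2 * real n < real (D * a * b)" unfolding ns by simp
      thus False using up k_le by linarith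
    qed
    have "p' \<le> y" if p': "prime p'" "p' dvd D * a * b" for p'
    proof -
      have nz: "D > 0" "a > 0" "b > 0" using lo by (auto intro!: Nat.gr0I)
      have "p' dvd D \<or> p' dvd a \<or> p' dvd b" using p' prime_dvd_mult_iff by blast
      hence "p' \<le> D \<or> p' \<le> a \<or> p' \<le> b" using nz dvd_imp_le by blast
      hence "real p' \<le> 4 * s ^ 28" using D1 a1 b1 by (smt (verit) of_nat_le_iff)
      thus ?thesis unfolding y_def by (simp add: le_nat_floor)
    qed
    hence "D * a * b \<in> S" unfolding S_def using lo up by auto
    thus "z \<in> (SIGMA m:S. {e. e dvd m} \<times> {e. e dvd m})" unfolding t(2) \<Phi>_def tt
      using ab tt by auto
  qed
  have nds: "real (num_divs m) \<le> 2 * C * s" if "m > 0" "m \<le> 2 * n" for m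
  proof -
    have "real m powr (1/72) \<le> (2 * real n) powr (1/72)" using that by (intro powr_mono2) auto
    also have "\<dots> = 2 powr (1/72) * s" unfolding s by (simp add: powr_mult)
    also have "\<dots> \<le> 2 powr 1 * s" using s0 by (intro mult_right_mono powr_mono) auto
    finally have "C * real m powr (1/72) \<le> C * (2 * s)" using C by (intro mult_left_mono) auto
    thus ?thesis using nd[OF that(1)] by simp
  qed
  have finS: "finite S" unfolding S_def by simp
  have finT: "finite T" unfolding T_def P_def by (intro finite_SigmaI) auto
  have "card T \<le> card (SIGMA m:S. {e. e dvd m} \<times> {e. e dvd m})"
    using finS by (intro card_inj_on_le[OF inj range] finite_SigmaI finite_cartesian_product) (auto simp: S_def)
  also have "\<dots> = (\<Sum>m\<in>S. num_divs m * num_divs m)"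
    using finS by (subst card_SigmaI) (auto simp: S_def num_divs_def card_cartesian_product)
  finally have "real (card T) \<le> (\<Sum>m\<in>S. real (num_divs m) * real (num_divs m))"
    by (metis (no_types, lifting) of_nat_le_iff of_nat_mult of_nat_sum sum.cong)
  also have "\<dots> \<le> (\<Sum>m\<in>S. (2 * C * s) * (2 * C * s))"
    using nds k_le C s0 by (intro sum_mono mult_mono) (auto simp: S_def)
  also have "\<dots> = real (card S) * (2 * C * s)\<^sup>2" by (simp add: power2_eq_square)
  finally have up: "real (card T) \<le> real (card S) * (2 * C * s)\<^sup>2" .
  have low: "s ^ 16 / 2 * (s ^ 9 / 2 * (s ^ 9 / (2 * C * s))) \<le> real (card T)"
  proof -
    have qbound: "s ^ 9 / (2 * C * s) \<le> real (card (P q))" if "q \<in> {Q<..2 * Q}" for q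
    proof -
      have "q \<le> 2 * n"
      proof -
        have "real q \<le> 2 * s ^ 9" using that Q by auto
        also have "\<dots> \<le> real n" unfolding ns using powle[of 9 72 2] by simp
        finally show ?thesis by simp
      qed
      have q1: "s ^ 9 < real q" "q > 0" using that Q by auto
      have "real q \<le> real (num_divs q) * real (card (P q))"
        using le_num_divs_mult_totient[of q] card_coprime_interval_ge_totient[of q] unfolding P_def
        by (metis (no_types, lifting) of_nat_le_iff of_nat_mult mult_le_mono2 order_trans)
      also have "\<dots> \<le> (2 * C * s) * real (card (P q))"
        using nds[OF q1(2) \<open>q \<le> 2 * n\<close>] by (intro mult_right_mono) auto
      finally have "s ^ 9 \<le> real (card (P q)) * (2 * C * s)" using q1 by (simp add: mult_ac)
      thus ?thesis using C s0 by (subst pos_divide_le_eq) auto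
    qed
    have "card T = d * (\<Sum>q\<in>{Q<..2 * Q}. card (P q))"
      unfolding T_def by (subst card_SigmaI; (subst card_SigmaI)?) (auto simp: P_def)
    hence cT: "real (card T) = real d * (\<Sum>q\<in>{Q<..2 * Q}. real (card (P q)))" by simp
    have "s ^ 9 / 2 * (s ^ 9 / (2 * C * s)) \<le> real Q * (s ^ 9 / (2 * C * s))"
      using Q C s0 by (intro mult_right_mono) auto
    also have "\<dots> = (\<Sum>q\<in>{Q<..2 * Q}. s ^ 9 / (2 * C * s))" by simp
    also have "\<dots> \<le> (\<Sum>q\<in>{Q<..2 * Q}. real (card (P q)))" by (intro sum_mono qbound)
    finally show ?thesis unfolding cT using d C s0 by (intro mult_mono) auto
  qed
  have "s ^ 16 / 2 * (s ^ 9 / 2 * (s ^ 9 / (2 * C * s))) \<le> real (card S) * (2 * C * s)\<^sup>2"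
    using low up by linarith
  hence "s ^ 34 \<le> 32 * C ^ 3 * s ^ 3 * real (card S)"
    using C s0 by (simp add: field_simps power2_eq_square power3_eq_cube flip: power_add)
  moreover have "s ^ 34 = s ^ 31 * s ^ 3" by (simp flip: power_add)
  ultimately have "s ^ 31 * s ^ 3 \<le> (32 * C ^ 3 * real (card S)) * s ^ 3" by (simp only: mult_ac)
  hence "s ^ 31 \<le> 32 * C ^ 3 * real (card S)" using s0 by (simp only: mult_le_cancel_right_pos zero_less_power)
  moreover have "32 * C ^ 3 * (4 * s ^ 28) < s ^ 31"
  proof -
    have "32 * C ^ 3 * 4 < s" using sC C zero_less_power[of C 3] by linarith
    hence "32 * C ^ 3 * 4 * s ^ 28 < s * s ^ 28" using s0 by (intro mult_strict_right_mono) auto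
    hence "32 * C ^ 3 * (4 * s ^ 28) < s * s ^ 28" by (simp only: mult.assoc)
    also have "\<dots> \<le> s ^ 31" using powle[of 29 31 1] by (simp add: power_Suc[symmetric] del: power_Suc)
    finally show ?thesis .
  qed
  ultimately have "32 * C ^ 3 * (4 * s ^ 28) < 32 * C ^ 3 * real (card S)" by linarith
  hence "4 * s ^ 28 < real (card S)" using C by simp
  hence "y < card S" unfolding y_def using s0 by (simp add: nat_less_iff floor_less_iff)
  thus ?thesis unfolding k_def[symmetric]
    by (intro not_prime_rep_if_many_smooth[of S]) (auto simp: S_def)
qed

lemma g_eventually_less_powr: "\<forall>\<^sub>F n in sequentially. real (g n) < real n powr (71/144)"
proof -
  obtain C where C: "C \<ge> 1" "\<And>m. m > 0 \<Longrightarrow> real (num_divs m) \<le> C * real m powr (1/72)"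
    using num_divs_bound[of "1/72"] by auto
  have lim: "filterlim (\<lambda>n::nat. real n powr (1/72)) at_top sequentially" by real_asymp
  have "\<forall>\<^sub>F n in sequentially. real n powr (1/72) \<ge> max 600 (256 * C ^ 3 + 1)"
    using lim unfolding filterlim_at_top by blast
  thus ?thesis
    using eventually_gt_at_top[of 0]
  proof eventually_elim
    case (elim n)
    hence "\<not> prime_rep n (nat \<lfloor>real n powr (71/144)\<rfloor>)"
      by (intro not_prime_rep_below_sqrt[OF refl _ _ C]) auto
    hence "g n < nat \<lfloor>real n powr (71/144)\<rfloor>" using elim by (intro g_less) auto
    thus ?case by linarith
  qed
qed

subsection \<open>Exponential sums\<close>

lemma le_tan:
  fixes x :: real
  assumes "0 \<le> x" "x \<le> 1"
  shows "x \<le> tan x"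
proof -
  have c: "cos y > 0" if "0 \<le> y" "y \<le> 1" for y :: real
    using that pi_gt3 by (intro cos_gt_zero_pi) auto
  have "tan 0 - 0 \<le> tan x - x"
  proof (rule DERIV_nonneg_imp_nondecreasing[of 0 x "\<lambda>y. tan y - y"])
    fix y assume y: "0 \<le> y" "y \<le> x"
    have cy: "cos y > 0" using c y assms by simp
    have "((\<lambda>y. tan y - y) has_real_derivative inverse ((cos y)\<^sup>2) - 1) (at y)"
      using cy by (intro derivative_intros) auto
    moreover have "inverse ((cos y)\<^sup>2) \<ge> 1"
      using cy by (intro one_le_inverse) (auto simp: abs_square_le_1)
    ultimately show "\<exists>D. ((\<lambda>y. tan y - y) has_real_derivative D) (at y) \<and> 0 \<le> D" by auto
  qed (use assms in auto)
  thus ?thesis by simp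
qed

text \<open>Abel summation against unimodular values, which leaves only the end weights and the
  total variation of the weights.\<close>

lemma sum_by_parts_bound:
  fixes c E :: "nat \<Rightarrow> complex"
  assumes "\<And>x. norm (E x) = 1"
  shows "norm (\<Sum>x<Suc m. c x * (E (Suc x) - E x)) \<le> norm (c m) + norm (c 0) + (\<Sum>x<m. norm (c (Suc x) - c x))"
proof -
  have "(\<Sum>x<Suc m. c x * (E (Suc x) - E x)) = c m * E (Suc m) - c 0 * E 0 - (\<Sum>x<m. (c (Suc x) - c x) * E (Suc x))"
    by (induction m) (simp_all add: algebra_simps)
  also have "norm \<dots> \<le> norm (c m * E (Suc m)) + norm (c 0 * E 0) + norm (\<Sum>x<m. (c (Suc x) - c x) * E (Suc x))"
    by (meson norm_triangle_ineq4 norm_triangle_le_diff order_trans add_mono order_refl)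
  also have "\<dots> \<le> norm (c m) + norm (c 0) + (\<Sum>x<m. norm (c (Suc x) - c x))"
    using assms by (auto simp: norm_mult intro!: order_trans[OF norm_sum])
  finally show ?thesis .
qed

text \<open>The identity \<open>1 / (cis d - 1) = - 1/2 - \<i>/2 cot (d/2)\<close> turns the sum into an almost telescoping one
  with weights of bounded variation.\<close>
lemma Kusmin_Landau:
  fixes f :: "nat \<Rightarrow> real"
  assumes l: "0 < l" and d: "\<And>x. x < n \<Longrightarrow> l \<le> f (Suc x) - f x" "\<And>x. x < n \<Longrightarrow> f (Suc x) - f x \<le> 1"
    and anti: "\<And>x. Suc x < n \<Longrightarrow> f (Suc (Suc x)) - f (Suc x) \<le> f (Suc x) - f x"
  shows "norm (\<Sum>x<n. cis (f x)) \<le> 4 / l"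
proof (cases n)
  case 0
  thus ?thesis using l by simp
next
  case (Suc m)
  define \<delta> where "\<delta> = (\<lambda>x. f (Suc x) - f x)"
  define v where "v = (\<lambda>x. 1 / (2 * tan (\<delta> x / 2)))"
  define c where "c = (\<lambda>x. Complex (- 1 / 2) (- v x))"
  have \<delta>: "l \<le> \<delta> x" "\<delta> x \<le> 1" if "x < n" for x using d[OF that] unfolding \<delta>_def by auto
  have l1: "l \<le> 1" using \<delta>[of 0] Suc by auto
  have tan: "\<delta> x / 2 \<le> tan (\<delta> x / 2)" "tan (\<delta> x / 2) > 0" if "x < n" for x
    using le_tan[of "\<delta> x / 2"] \<delta>[OF that] l by linarith+
  have v: "0 \<le> v x" "v x \<le> 1 / l" if "x < n" for x
  proof -
    show "0 \<le> v x" unfolding v_def using tan[OF that] by simp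
    have "l \<le> 2 * tan (\<delta> x / 2)" using tan[OF that] \<delta>[OF that] by linarith
    thus "v x \<le> 1 / l" unfolding v_def using l by (intro divide_left_mono) auto
  qed
  \<comment> \<open>The differences decrease, so the half cotangents \<open>v\<close> increase;
    their total variation telescopes to \<open>v m - v 0\<close>.\<close>
  have vmono: "v x \<le> v (Suc x)" if "Suc x < n" for x
  proof -
    have "tan (\<delta> (Suc x) / 2) \<le> tan (\<delta> x / 2)"
      using anti[OF that] \<delta>[OF that] \<delta>[of x] that l pi_gt3
      by (intro tan_mono_le) (auto simp: \<delta>_def)
    thus ?thesis unfolding v_def using tan[OF that] tan[of x] that
      by (intro divide_left_mono) auto
  qed
  have eq: "cis (f x) = c x * (cis (f (Suc x)) - cis (f x))" if "x < n" for x
  proof -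
    define y where "y = \<delta> x / 2"
    have sy: "sin y \<noteq> 0" "cos y \<noteq> 0" using tan(2)[OF that] unfolding y_def[symmetric] tan_def by auto
    have vy: "v x = cos y / (2 * sin y)" unfolding v_def y_def[symmetric] tan_def using sy by simp
    have "cis (\<delta> x) = cis (2 * y)" unfolding y_def by simp
    hence cd: "cis (\<delta> x) = Complex (1 - 2 * (sin y)\<^sup>2) (2 * sin y * cos y)"
      by (simp add: complex_eq_iff cos_double_sin sin_double)
    have "cos y * (cos y * 2) + sin y * (sin y * 2) = 2"
      using sin_cos_squared_add[of y] by (simp add: power2_eq_square)
    hence "c x * (cis (\<delta> x) - 1) = 1"
      unfolding cd c_def vy using sy
      by (simp add: complex_eq_iff field_simps power2_eq_square)
    moreover have "cis (f (Suc x)) = cis (f x) * cis (\<delta> x)" unfolding \<delta>_def by (simp add: cis_mult)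
    moreover have "c x * (cis (f x) * cis (\<delta> x) - cis (f x)) = c x * (cis (\<delta> x) - 1) * cis (f x)"
      by (simp add: algebra_simps)
    ultimately show ?thesis by simp
  qed
  have nc: "norm (c x) \<le> 1 / 2 + 1 / l" if "x < n" for x
    using complex_abs_le_norm[of "c x"] cmod_le[of "c x"] v[OF that] unfolding c_def by simp
  have "(\<Sum>x<m. norm (c (Suc x) - c x)) = (\<Sum>x<m. v (Suc x) - v x)"
  proof (intro sum.cong refl)
    fix x assume "x \<in> {..<m}"
    hence "v x \<le> v (Suc x)" using vmono Suc by simp
    moreover have "c (Suc x) - c x = Complex 0 (v x - v (Suc x))" unfolding c_def by (simp add: complex_eq_iff)
    ultimately show "norm (c (Suc x) - c x) = v (Suc x) - v x" by (simp add: cmod_def)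
  qed
  also have "\<dots> = v m - v 0" by (rule sum_lessThan_telescope)
  also have "\<dots> \<le> 1 / l" using v[of m] v[of 0] Suc by simp
  finally have var: "(\<Sum>x<m. norm (c (Suc x) - c x)) \<le> 1 / l" .
  have "(\<Sum>x<n. cis (f x)) = (\<Sum>x<Suc m. c x * (cis (f (Suc x)) - cis (f x)))"
    unfolding Suc[symmetric] by (intro sum.cong eq) auto
  hence "norm (\<Sum>x<n. cis (f x)) \<le> norm (c m) + norm (c 0) + (\<Sum>x<m. norm (c (Suc x) - c x))"
    using sum_by_parts_bound[of "\<lambda>x. cis (f x)" c m] by simp
  also have "\<dots> \<le> (1 / 2 + 1 / l) + (1 / 2 + 1 / l) + 1 / l"
    using nc[of m] nc[of 0] var Suc by (intro add_mono) auto
  also have "\<dots> \<le> 4 / l" using l l1 by (simp add: field_simps)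
  finally show ?thesis .
qed

text \<open>For fixed \<open>h\<close> a distance \<open>d \<ge> 1\<close> is attained at most
  twice, at \<open>h - d\<close> and at \<open>h + d\<close>.\<close>

lemma sum_abs_diff_le:
  fixes T :: "nat \<Rightarrow> real"
  assumes "\<And>d. T d \<ge> 0" "h < H"
  shows "(\<Sum>h'<H. T (if h \<le> h' then h' - h else h - h')) \<le> T 0 + 2 * (\<Sum>d\<in>{1..<H}. T d)"
proof -
  have split: "{..<H} = {..<h} \<union> ({h} \<union> {h<..<H})" using assms(2) by auto
  have "(\<Sum>h'\<in>{..<h}. T (if h \<le> h' then h' - h else h - h')) = (\<Sum>d\<in>{1..h}. T d)"
    by (rule sum.reindex_bij_witness[of _ "\<lambda>d. h - d" "\<lambda>d. h - d"]) auto
  also have "\<dots> \<le> (\<Sum>d\<in>{1..<H}. T d)" using assms by (intro sum_mono2) auto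
  finally have 1: "(\<Sum>h'\<in>{..<h}. T (if h \<le> h' then h' - h else h - h')) \<le> (\<Sum>d\<in>{1..<H}. T d)" .
  have "(\<Sum>h'\<in>{h<..<H}. T (if h \<le> h' then h' - h else h - h')) = (\<Sum>d\<in>{1..<H-h}. T d)"
    by (rule sum.reindex_bij_witness[of _ "\<lambda>d. d + h" "\<lambda>d. d - h"]) auto
  also have "\<dots> \<le> (\<Sum>d\<in>{1..<H}. T d)" using assms by (intro sum_mono2) auto
  finally have 2: "(\<Sum>h'\<in>{h<..<H}. T (if h \<le> h' then h' - h else h - h')) \<le> (\<Sum>d\<in>{1..<H}. T d)" .
  have "(\<Sum>h'<H. T (if h \<le> h' then h' - h else h - h')) = 
     (\<Sum>h'\<in>{..<h}. T (if h \<le> h' then h' - h else h - h')) + (T 0 +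
     (\<Sum>h'\<in>{h<..<H}. T (if h \<le> h' then h' - h else h - h')))"
    unfolding split by (subst sum.union_disjoint; (subst sum.union_disjoint)?) auto
  thus ?thesis using 1 2 by linarith
qed

lemma sum_squared_le_card_mult:
  fixes a :: "'a \<Rightarrow> real"
  shows "(\<Sum>i\<in>I. a i)\<^sup>2 \<le> real (card I) * (\<Sum>i\<in>I. (a i)\<^sup>2)"
  using Cauchy_Schwarz_ineq_sum[of "\<lambda>_. 1" a I] by simp

text \<open>\<open>H\<close> times the sum is the sum of all windows of \<open>H\<close> consecutive
  terms. Cauchy-Schwarz over the \<open>n + H\<close> window positions and expansion of the squares
  leave correlations that depend only on the distance of the two shifts.\<close>

lemma van_der_Corput_inequality:
  fixes z :: "nat \<Rightarrow> complex"
  assumes H: "H \<ge> 1"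
  shows "(norm (\<Sum>x<n. z x))\<^sup>2 \<le> (real n + real H) / real H *
    ((\<Sum>x<n. (norm (z x))\<^sup>2) + 2 * (\<Sum>d\<in>{1..<H}. norm (\<Sum>x<n - d. z (x + d) * cnj (z x))))"
proof -
  \<comment> \<open>Extension by zero to the integers frees the shifts of boundary terms.\<close>
  define Z where "Z = (\<lambda>i::int. if 0 \<le> i \<and> i < int n then z (nat i) else 0)"
  define I where "I = {0..<int n + int H}"
  define W where "W = (\<lambda>y. \<Sum>h<H. Z (y - int h))"
  define S where "S = (\<Sum>x<n. z x)"
  define T where "T = (\<lambda>d. norm (\<Sum>x<n - d. z (x + d) * cnj (z x)))"
  have sumZ: "(\<Sum>y\<in>I. Z (y - int h)) = S" if "h < H" for h
  proof -
    have "(\<Sum>y\<in>I. Z (y - int h)) = (\<Sum>y\<in>{int h..<int n + int h}. Z (y - int h))"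
      unfolding I_def using that by (intro sum.mono_neutral_right) (auto simp: Z_def)
    also have "\<dots> = S" unfolding S_def
      by (rule sum.reindex_bij_witness[of _ "\<lambda>x. int x + int h" "\<lambda>y. nat (y - int h)"]) (auto simp: Z_def)
    finally show ?thesis .
  qed
  have "(\<Sum>y\<in>I. W y) = (\<Sum>h<H. \<Sum>y\<in>I. Z (y - int h))" unfolding W_def by (rule sum.swap)
  also have "\<dots> = of_nat H * S" using sumZ by simp
  finally have "real H * norm S = norm (\<Sum>y\<in>I. W y)" by (simp add: norm_mult)
  also have "\<dots> \<le> (\<Sum>y\<in>I. norm (W y))" by (rule norm_sum)
  finally have "(real H * norm S)\<^sup>2 \<le> (\<Sum>y\<in>I. norm (W y))\<^sup>2" by (intro power_mono) auto
  also have "\<dots> \<le> real (card I) * (\<Sum>y\<in>I. (norm (W y))\<^sup>2)" by (rule sum_squared_le_card_mult)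
  also have "real (card I) = real n + real H" by (simp add: I_def)
  finally have CS: "(real H * norm S)\<^sup>2 \<le> (real n + real H) * (\<Sum>y\<in>I. (norm (W y))\<^sup>2)" .
  have corr: "(\<Sum>y\<in>I. Z (y - int h) * cnj (Z (y - int h'))) = (\<Sum>x<n - (h' - h). z (x + (h' - h)) * cnj (z x))"
    if "h \<le> h'" "h' < H" for h h'
  proof -
    have "(\<Sum>y\<in>I. Z (y - int h) * cnj (Z (y - int h'))) = 
        (\<Sum>y\<in>{int h'..<int n + int h}. Z (y - int h) * cnj (Z (y - int h')))"
      unfolding I_def using that by (intro sum.mono_neutral_right) (auto simp: Z_def)
    also have "\<dots> = (\<Sum>x<n - (h' - h). z (x + (h' - h)) * cnj (z x))"
      by (rule sum.reindex_bij_witness[of _ "\<lambda>x. int x + int h'" "\<lambda>y. nat (y - int h')"])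
         (use that in \<open>auto simp: Z_def nat_diff_distrib intro!: arg_cong[of _ _ z]\<close>)
    finally show ?thesis .
  qed
  have C: "norm (\<Sum>y\<in>I. Z (y - int h) * cnj (Z (y - int h'))) \<le> T (if h \<le> h' then h' - h else h - h')"
    if "h < H" "h' < H" for h h'
  proof (cases "h \<le> h'")
    case True
    thus ?thesis using corr[OF True] that unfolding T_def by simp
  next
    case False
    have "(\<Sum>y\<in>I. Z (y - int h) * cnj (Z (y - int h'))) = cnj (\<Sum>y\<in>I. Z (y - int h') * cnj (Z (y - int h)))"
      by (simp add: mult.commute)
    thus ?thesis using corr[of h' h] that False unfolding T_def by (simp del: cnj_sum)
  qed
  have "complex_of_real (\<Sum>y\<in>I. (norm (W y))\<^sup>2) = (\<Sum>y\<in>I. W y * cnj (W y))"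
    by (simp add: complex_norm_square flip: of_real_power)
  also have "\<dots> = (\<Sum>y\<in>I. \<Sum>h<H. \<Sum>h'<H. Z (y - int h) * cnj (Z (y - int h')))"
    unfolding W_def by (simp add: sum_product)
  also have "\<dots> = (\<Sum>h<H. \<Sum>y\<in>I. \<Sum>h'<H. Z (y - int h) * cnj (Z (y - int h')))" by (rule sum.swap)
  also have "\<dots> = (\<Sum>h<H. \<Sum>h'<H. \<Sum>y\<in>I. Z (y - int h) * cnj (Z (y - int h')))"
    by (intro sum.cong refl sum.swap)
  finally have "norm (complex_of_real (\<Sum>y\<in>I. (norm (W y))\<^sup>2)) = norm (\<Sum>h<H. \<Sum>h'<H. \<Sum>y\<in>I. Z (y - int h) * cnj (Z (y - int h')))"
    by (rule arg_cong)
  also have "norm (complex_of_real (\<Sum>y\<in>I. (norm (W y))\<^sup>2)) = (\<Sum>y\<in>I. (norm (W y))\<^sup>2)"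
    by (simp only: norm_of_real abs_of_nonneg sum_nonneg zero_le_power2)
  also have "norm (\<Sum>h<H. \<Sum>h'<H. \<Sum>y\<in>I. Z (y - int h) * cnj (Z (y - int h'))) \<le>
      (\<Sum>h<H. \<Sum>h'<H. T (if h \<le> h' then h' - h else h - h'))"
    using C by (intro sum_norm_le) auto
  also have "\<dots> \<le> (\<Sum>h<H. T 0 + 2 * (\<Sum>d\<in>{1..<H}. T d))"
    by (intro sum_mono sum_abs_diff_le) (auto simp: T_def)
  also have "\<dots> = real H * (T 0 + 2 * (\<Sum>d\<in>{1..<H}. T d))" by simp
  also have "T 0 \<le> (\<Sum>x<n. (norm (z x))\<^sup>2)"
    unfolding T_def by (auto intro!: order_trans[OF norm_sum] simp: norm_mult power2_eq_square)
  finally have "(\<Sum>y\<in>I. (norm (W y))\<^sup>2) \<le> real H * ((\<Sum>x<n. (norm (z x))\<^sup>2) + 2 * (\<Sum>d\<in>{1..<H}. T d))"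
    by (simp add: mult_left_mono)
  hence "(real n + real H) * (\<Sum>y\<in>I. (norm (W y))\<^sup>2) \<le>
      (real n + real H) * (real H * ((\<Sum>x<n. (norm (z x))\<^sup>2) + 2 * (\<Sum>d\<in>{1..<H}. T d)))"
    by (intro mult_left_mono) auto
  with CS have "((norm S)\<^sup>2 * real H) * real H \<le> ((real n + real H) * ((\<Sum>x<n. (norm (z x))\<^sup>2) + 2 * (\<Sum>d\<in>{1..<H}. T d))) * real H"
    by (simp only: power_mult_distrib power2_eq_square mult_ac)
  hence "(norm S)\<^sup>2 * real H \<le> (real n + real H) * ((\<Sum>x<n. (norm (z x))\<^sup>2) + 2 * (\<Sum>d\<in>{1..<H}. T d))"
    using H by (simp only: mult_le_cancel_right_pos of_nat_0_less_iff)
  thus ?thesis unfolding S_def[symmetric] T_def[symmetric] using H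
    by (simp add: pos_le_divide_eq)
qed

section \<open>Finite differences and iterated differencing\<close>

definition fdiff :: "(nat \<Rightarrow> real) \<Rightarrow> nat \<Rightarrow> real" where
  "fdiff f x = f (Suc x) - f x"

lemma fdiff_shift: "(fdiff ^^ k) (\<lambda>x. f (x + h) - f x) x = (fdiff ^^ k) f (x + h) - (fdiff ^^ k) f x"
  by (induction k arbitrary: x) (simp_all add: fdiff_def)

text \<open>This is the gain from working with differences: the shift by \<open>h\<close> turns an
  order \<open>k\<close> difference into a sum of \<open>h\<close> differences of order
  \<open>k + 1\<close>. Bounds are multiplied by \<open>h\<close>, and monotonicity is
  inherited.\<close>

lemma fdiff_shift_sum: "(fdiff ^^ k) (\<lambda>x. f (x + h) - f x) x = (\<Sum>i<h. (fdiff ^^ Suc k) f (x + i))"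
proof -
  have "(\<Sum>i<h. (fdiff ^^ Suc k) f (x + i)) = (fdiff ^^ k) f (x + h) - (fdiff ^^ k) f x"
    using sum_lessThan_telescope[of "\<lambda>i. (fdiff ^^ k) f (x + i)" h] by (simp add: fdiff_def)
  thus ?thesis by (simp add: fdiff_shift)
qed

text \<open>\<open>F i\<close> plays the role of the \<open>i\<close>-th derivative. One difference
  is moved inside the whole derivative sequence, giving \<open>G\<close>; the induction hypothesis
  handles \<open>G\<close>, and the mean value theorem turns \<open>G k\<close> into a value of
  \<open>F (Suc k)\<close>.\<close>

lemma fdiff_mean_value:
  fixes F :: "nat \<Rightarrow> real \<Rightarrow> real"
  assumes "\<And>i x. x > 0 \<Longrightarrow> (F i has_real_derivative F (Suc i) x) (at x)" "a > 0"
  shows "\<exists>\<xi>. a + real x \<le> \<xi> \<and> \<xi> \<le> a + real x + real k \<and> (fdiff ^^ k) (\<lambda>x. F 0 (a + real x)) x = F k \<xi>"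
  using assms(1)
proof (induction k arbitrary: F)
  case 0
  show ?case by (intro exI[of _ "a + real x"]) simp
next
  case (Suc k)
  define G where "G = (\<lambda>i y. F i (y + 1) - F i y)"
  have "(G i has_real_derivative G (Suc i) y) (at y)" if "y > 0" for i y
    unfolding G_def using Suc.prems[of y i] Suc.prems[of "y + 1" i] that
    by (intro derivative_intros) (simp_all add: DERIV_shift[symmetric] add.commute)
  from Suc.IH[of G, OF this] obtain \<xi> where \<xi>: "a + real x \<le> \<xi>" "\<xi> \<le> a + real x + real k"
    "(fdiff ^^ k) (\<lambda>x. G 0 (a + real x)) x = G k \<xi>" by blast
  have pos: "\<xi> > 0" using \<xi>(1) assms(2) by linarith
  have "\<exists>z>\<xi>. z < \<xi> + 1 \<and> F k (\<xi> + 1) - F k \<xi> = (\<xi> + 1 - \<xi>) * F (Suc k) z"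
    using pos by (intro MVT2 Suc.prems) auto
  then obtain z where z: "z > \<xi>" "z < \<xi> + 1" "G k \<xi> = F (Suc k) z" unfolding G_def by auto
  have "(fdiff ^^ Suc k) (\<lambda>x. F 0 (a + real x)) x = (fdiff ^^ k) (\<lambda>x. G 0 (a + real x)) x"
    unfolding funpow_Suc_right by (simp add: fdiff_def[abs_def] G_def algebra_simps)
  with \<xi> z show ?case by (intro exI[of _ z]) auto
qed

text \<open>Repeated Cauchy-Schwarz. Only \<open>card I \<le> H\<close> is asked because the shifts
  run over \<open>{1..<H}\<close> while the average is taken over \<open>H\<close>.\<close>

lemma power_mean_two_power:
  fixes a :: "'a \<Rightarrow> real"
  assumes "\<And>i. i \<in> I \<Longrightarrow> a i \<ge> 0" "real (card I) \<le> H" "H > 0"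
  shows "((\<Sum>i\<in>I. a i) / H) ^ (2 ^ j) \<le> (\<Sum>i\<in>I. a i ^ (2 ^ j)) / H"
  using assms(1)
proof (induction j arbitrary: a)
  case (Suc j)
  have "((\<Sum>i\<in>I. a i) / H)\<^sup>2 \<le> (\<Sum>i\<in>I. (a i)\<^sup>2) / H"
  proof -
    have "(\<Sum>i\<in>I. a i)\<^sup>2 \<le> H * (\<Sum>i\<in>I. (a i)\<^sup>2)"
      using sum_squared_le_card_mult[of a I] assms(2)
      by (meson mult_right_mono order_trans sum_nonneg zero_le_power2)
    thus ?thesis using assms(3) by (simp add: power_divide field_simps power2_eq_square)
  qed
  hence "(((\<Sum>i\<in>I. a i) / H)\<^sup>2) ^ (2 ^ j) \<le> ((\<Sum>i\<in>I. (a i)\<^sup>2) / H) ^ (2 ^ j)"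
    by (intro power_mono) auto
  also have "\<dots> \<le> (\<Sum>i\<in>I. ((a i)\<^sup>2) ^ (2 ^ j)) / H" by (intro Suc.IH) auto
  finally show ?case by (simp flip: power_mult)
qed simp

lemma add_power_le:
  fixes a b :: real
  assumes "a \<ge> 0" "b \<ge> 0"
  shows "(a + b) ^ q \<le> 2 ^ q * (a ^ q + b ^ q)"
proof -
  have "(a + b) ^ q \<le> (2 * max a b) ^ q" using assms by (intro power_mono) auto
  also have "\<dots> = 2 ^ q * max a b ^ q" by (rule power_mult_distrib)
  also have "\<dots> \<le> 2 ^ q * (a ^ q + b ^ q)" using assms by (intro mult_left_mono) (auto simp: max_def)
  finally show ?thesis .
qed

text \<open>A differencing step squares the sum and lowers the order of the difference by one; averaging
  \<open>1 / h\<close> over the shifts \<open>h\<close> costs a factor \<open>harm H\<close>.\<close>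
lemma van_der_Corput_iterated:
  "\<exists>C\<ge>1. \<forall>(f :: nat \<Rightarrow> real) n N H l U. 1 \<le> H \<longrightarrow> H \<le> N \<longrightarrow> n \<le> N \<longrightarrow> 0 < l \<longrightarrow>
     (\<forall>x<n. l \<le> (fdiff ^^ Suc j) f x \<and> (fdiff ^^ Suc j) f x \<le> U) \<longrightarrow> U * real H ^ j \<le> 1 \<longrightarrow>
     (\<forall>x. Suc x < n \<longrightarrow> (fdiff ^^ Suc j) f (Suc x) \<le> (fdiff ^^ Suc j) f x) \<longrightarrow>
     norm (\<Sum>x<n. cis (f x)) ^ (2 ^ j) \<le>
       C * real N ^ (2 ^ j) * (1 / real H + harm H ^ j / (real N * l * real H ^ j))"
proof (induction j)
  case 0
  show ?case
  proof (intro exI[of _ 4] conjI allI impI)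
    fix f :: "nat \<Rightarrow> real" and n N H :: nat and l U :: real
    assume H: "1 \<le> H" "H \<le> N" "n \<le> N" "0 < l"
      "\<forall>x<n. l \<le> (fdiff ^^ Suc 0) f x \<and> (fdiff ^^ Suc 0) f x \<le> U" "U * real H ^ 0 \<le> 1"
      "\<forall>x. Suc x < n \<longrightarrow> (fdiff ^^ Suc 0) f (Suc x) \<le> (fdiff ^^ Suc 0) f x"
    have "norm (\<Sum>x<n. cis (f x)) \<le> 4 / l"
      by (rule Kusmin_Landau) (use H in \<open>force simp: fdiff_def\<close>)+
    also have "\<dots> \<le> 4 * real N * (1 / real H + 1 / (real N * l))"
      using H by (simp add: field_simps)
    finally show "norm (\<Sum>x<n. cis (f x)) ^ (2 ^ 0) \<le> 4 * real N ^ (2 ^ 0) * (1 / real H + harm H ^ 0 / (real N * l * real H ^ 0))"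
      by simp
  qed simp
next
  case (Suc j)
  define q :: nat where "q = 2 ^ j"
  have q1: "q \<ge> 1" by (simp add: q_def)
  from Suc obtain C where C: "C \<ge> 1" and IH: "\<And>(f :: nat \<Rightarrow> real) n N H l U. \<lbrakk>1 \<le> H; H \<le> N; n \<le> N; 0 < l;
     \<forall>x<n. l \<le> (fdiff ^^ Suc j) f x \<and> (fdiff ^^ Suc j) f x \<le> U; U * real H ^ j \<le> 1;
     \<forall>x. Suc x < n \<longrightarrow> (fdiff ^^ Suc j) f (Suc x) \<le> (fdiff ^^ Suc j) f x\<rbrakk> \<Longrightarrow>
     norm (\<Sum>x<n. cis (f x)) ^ q \<le> C * real N ^ q * (1 / real H + harm H ^ j / (real N * l * real H ^ j))"
    unfolding q_def by blast
  show ?case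
  \<comment> \<open>The outer \<open>2 ^ q\<close> splits the power of a sum; inside,
    \<open>2 ^ q\<close> comes from the diagonal term and \<open>4 ^ q * C\<close> from the
    correlations.\<close>
  proof (intro exI[of _ "2 ^ q * (2 ^ q + 4 ^ q * C)"] conjI allI impI)
    have "1 * (1 + 0) \<le> 2 ^ q * (2 ^ q + 4 ^ q * C)" using C by (intro mult_mono add_mono) auto
    thus "1 \<le> 2 ^ q * (2 ^ q + 4 ^ q * C)" by simp
    fix f :: "nat \<Rightarrow> real" and n N H :: nat and l U :: real
    assume H: "1 \<le> H" "H \<le> N" "n \<le> N" "0 < l"
      and D: "\<forall>x<n. l \<le> (fdiff ^^ Suc (Suc j)) f x \<and> (fdiff ^^ Suc (Suc j)) f x \<le> U" and U: "U * real H ^ Suc j \<le> 1"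
      and anti: "\<forall>x. Suc x < n \<longrightarrow> (fdiff ^^ Suc (Suc j)) f (Suc x) \<le> (fdiff ^^ Suc (Suc j)) f x"
    define \<Lambda> where "\<Lambda> = harm H ^ Suc j / (real N * l * real H ^ Suc j)"
    have \<Lambda>0: "\<Lambda> \<ge> 0" unfolding \<Lambda>_def using H by (auto intro!: divide_nonneg_nonneg mult_nonneg_nonneg harm_nonneg zero_le_power)
    have N: "real N > 0" "real H > 0" using H by auto
    define s where "s = (\<lambda>h. norm (\<Sum>x<n - h. cis (f (x + h) - f x)))"
    have sh: "s h ^ q \<le> C * real N ^ q * (1 / real H + harm H ^ j / (real N * (real h * l) * real H ^ j))"
      if h: "h \<in> {1..<H}" for h
      unfolding s_def
    \<comment> \<open>The shift multiplies both bounds by \<open>h\<close>, and the extra factor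
      \<open>h \<le> H\<close> is what one more power of \<open>H\<close> in the hypothesis on
      \<open>U\<close> allows. The shifted sum is shorter than \<open>n\<close> but is measured
      against the same \<open>N\<close>.\<close>
    proof (rule IH[where U = "real h * U"])
      let ?D = "(fdiff ^^ Suc (Suc j)) f"
      show "\<forall>x<n - h. real h * l \<le> (fdiff ^^ Suc j) (\<lambda>x. f (x + h) - f x) x \<and> (fdiff ^^ Suc j) (\<lambda>x. f (x + h) - f x) x \<le> real h * U"
      proof (intro allI impI conjI)
        fix x assume x: "x < n - h"
        have "real h * l = (\<Sum>i<h. l)" by simp
        also have "\<dots> \<le> (\<Sum>i<h. ?D (x + i))" using D x by (intro sum_mono) auto
        finally show "real h * l \<le> (fdiff ^^ Suc j) (\<lambda>x. f (x + h) - f x) x" unfolding fdiff_shift_sum .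
        have "(\<Sum>i<h. ?D (x + i)) \<le> (\<Sum>i<h. U)" using D x by (intro sum_mono) auto
        thus "(fdiff ^^ Suc j) (\<lambda>x. f (x + h) - f x) x \<le> real h * U" unfolding fdiff_shift_sum by simp
      qed
      show "\<forall>x. Suc x < n - h \<longrightarrow> (fdiff ^^ Suc j) (\<lambda>x. f (x + h) - f x) (Suc x) \<le> (fdiff ^^ Suc j) (\<lambda>x. f (x + h) - f x) x"
        unfolding fdiff_shift_sum using anti by (auto intro!: sum_mono simp del: funpow.simps)
      show "real h * U * real H ^ j \<le> 1"
      \<comment> \<open>\<open>U\<close> can be negative when \<open>n = 0\<close>, where it bounds
        nothing.\<close>
      proof (cases "U \<ge> 0")
        case True
        have "real h * (U * real H ^ j) \<le> real H * (U * real H ^ j)" using h True by (intro mult_right_mono) auto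
        thus ?thesis using U by (simp add: mult_ac)
      next
        case False
        have "real h * U * real H ^ j \<le> 0" using False by (intro mult_nonpos_nonneg mult_nonneg_nonpos) auto
        thus ?thesis by linarith
      qed
    qed (use H h in auto)
    define m where "m = (\<Sum>h\<in>{1..<H}. s h) / real H"
    have m0: "m \<ge> 0" unfolding m_def s_def by (intro divide_nonneg_nonneg sum_nonneg) auto
    have "m ^ q \<le> (\<Sum>h\<in>{1..<H}. s h ^ q) / real H"
      unfolding m_def q_def using N by (intro power_mean_two_power) (auto simp: s_def)
    also have "\<dots> \<le> (\<Sum>h\<in>{1..<H}. C * real N ^ q * (1 / real H + harm H ^ j / (real N * (real h * l) * real H ^ j))) / real H"
      using N by (intro divide_right_mono sum_mono sh) auto
    also have "(\<Sum>h\<in>{1..<H}. C * real N ^ q * (1 / real H + harm H ^ j / (real N * (real h * l) * real H ^ j))) =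
        C * real N ^ q * ((\<Sum>h\<in>{1..<H}. 1 / real H) + (\<Sum>h\<in>{1..<H}. inverse (real h)) * (harm H ^ j / (real N * l * real H ^ j)))"
      by (simp only: sum_distrib_left[symmetric] sum.distrib sum_distrib_right) (simp add: divide_simps mult_ac)
    also have "(\<Sum>h\<in>{1..<H}. 1 / real H) \<le> 1" by (simp add: divide_simps)
    also have "(\<Sum>h\<in>{1..<H}. inverse (real h)) \<le> harm H"
      unfolding harm_def by (intro sum_mono2) auto
    finally have "m ^ q \<le> C * real N ^ q * (1 + harm H * (harm H ^ j / (real N * l * real H ^ j))) / real H"
      using N C H by (simp add: divide_right_mono mult_left_mono mult_right_mono harm_nonneg)
    also have "\<dots> = C * real N ^ q * (1 / real H + \<Lambda>)"
      unfolding \<Lambda>_def using N by (simp add: field_simps)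
    finally have mq: "m ^ q \<le> C * real N ^ q * (1 / real H + \<Lambda>)" .
    have "(norm (\<Sum>x<n. cis (f x)))\<^sup>2 \<le> (real n + real H) / real H *
      ((\<Sum>x<n. (norm (cis (f x)))\<^sup>2) + 2 * (\<Sum>d\<in>{1..<H}. norm (\<Sum>x<n - d. cis (f (x + d)) * cnj (cis (f x)))))"
      by (rule van_der_Corput_inequality) fact
    also have "\<dots> = (real n + real H) / real H * (real n + 2 * (\<Sum>h\<in>{1..<H}. s h))"
      unfolding s_def by (simp add: cis_cnj cis_mult)
    also have "\<dots> \<le> (2 * real N) / real H * (real N + 2 * (\<Sum>h\<in>{1..<H}. s h))"
      using H by (intro mult_mono divide_right_mono add_mono) (auto simp: s_def sum_nonneg)
    also have "\<dots> = 2 * (real N)\<^sup>2 / real H + 4 * real N * m"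
      unfolding m_def using N by (simp add: field_simps power2_eq_square)
    finally have "((norm (\<Sum>x<n. cis (f x)))\<^sup>2) ^ q \<le> (2 * (real N)\<^sup>2 / real H + 4 * real N * m) ^ q"
      by (intro power_mono) auto
    also have "\<dots> \<le> 2 ^ q * ((2 * (real N)\<^sup>2 / real H) ^ q + (4 * real N * m) ^ q)"
      using m0 by (intro add_power_le) auto
    also have "(2 * (real N)\<^sup>2 / real H) ^ q \<le> 2 ^ q * real N ^ (2 * q) * (1 / real H + \<Lambda>)"
    proof -
      have "(2 * (real N)\<^sup>2 / real H) ^ q = 2 ^ q * real N ^ (2 * q) * (1 / real H ^ q)"
        by (simp add: power_mult_distrib power_divide power_mult)
      also have "1 / real H ^ q \<le> 1 / real H"
        using H q1 self_le_power[of "real H" q] by (intro divide_left_mono) auto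
      also have "\<dots> \<le> 1 / real H + \<Lambda>" using \<Lambda>0 by simp
      finally show ?thesis by (simp add: mult_left_mono)
    qed
    also have "(4 * real N * m) ^ q = 4 ^ q * real N ^ q * m ^ q" by (simp add: power_mult_distrib)
    also have "\<dots> \<le> 4 ^ q * real N ^ q * (C * real N ^ q * (1 / real H + \<Lambda>))"
      using mq by (intro mult_left_mono) auto
    also have "\<dots> = 4 ^ q * C * real N ^ (2 * q) * (1 / real H + \<Lambda>)"
      unfolding mult_2 power_add by (simp only: mult_ac)
    finally have "((norm (\<Sum>x<n. cis (f x)))\<^sup>2) ^ q \<le> 2 ^ q * (2 ^ q * real N ^ (2 * q) * (1 / real H + \<Lambda>) +
        4 ^ q * C * real N ^ (2 * q) * (1 / real H + \<Lambda>))" by simp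
    also have "\<dots> = 2 ^ q * (2 ^ q + 4 ^ q * C) * real N ^ (2 * q) * (1 / real H + \<Lambda>)"
      by (simp only: distrib_left distrib_right mult_ac)
    finally show "norm (\<Sum>x<n. cis (f x)) ^ (2 ^ Suc j) \<le>
       2 ^ q * (2 ^ q + 4 ^ q * C) * real N ^ (2 ^ Suc j) * (1 / real H + harm H ^ Suc j / (real N * l * real H ^ Suc j))"
      unfolding \<Lambda>_def q_def by (simp flip: power_mult)
  qed
qed

text \<open>Turns the logarithmic losses of the differencing into an arbitrarily small power of
  \<open>H\<close>.\<close>

lemma harm_le_powr:
  assumes "H \<ge> 1" "a > 0"
  shows "harm H \<le> (1 + 1 / a) * real H powr a"
proof -
  have "harm H \<le> 1 + ln (real H)"
    using assms(1)
  proof (induction H rule: nat_induct_at_least)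
    case base
    show ?case by (simp add: harm_def)
  next
    case (Suc n)
    have "inverse (real (Suc n)) \<le> ln (real (Suc n)) - ln (real n)"
    proof -
      have "ln (real n / real (Suc n)) \<le> real n / real (Suc n) - 1"
        using Suc by (intro ln_le_minus_one) auto
      also have "\<dots> = - inverse (real (Suc n))" by (simp add: field_simps)
      finally show ?thesis using Suc by (simp add: ln_div)
    qed
    thus ?case using Suc.IH by (simp add: harm_Suc)
  qed
  also have "\<dots> \<le> real H powr a + real H powr a / a"
    using assms by (intro add_mono ln_powr_bound ge_one_powr_ge_zero) auto
  finally show ?thesis by (simp add: algebra_simps)
qed

lemma norm_sum_cis_uminus: "norm (\<Sum>x\<in>I. cis (- f x)) = norm (\<Sum>x\<in>I. cis (f x))"
proof -
  have "(\<Sum>x\<in>I. cis (- f x)) = cnj (\<Sum>x\<in>I. cis (f x))" by (simp add: cis_cnj)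
  thus ?thesis by (simp only: complex_mod_cnj)
qed

text \<open>The derivative of order \<open>j + 1\<close> of \<open>t * ln y\<close> has size
  \<open>t * fact j / M ^ Suc j\<close>. Differencing with shifts up to \<open>H\<close>, about
  \<open>sqrt M\<close>, is repeated until the first-order differences are at most 1; the power of
  \<open>M\<close> bounding \<open>t\<close> bounds the depth. Depth 0 is the range of small
  \<open>t\<close> and yields the term \<open>1 / t\<close>, any greater depth a power
  saving.\<close>

lemma zeta_sum_bound:
  fixes R :: nat
  shows "\<exists>c>0. \<exists>C\<ge>1. c \<le> 1 / 4 \<and> (\<forall>M\<ge>1. \<forall>t. 0 < t \<longrightarrow> t \<le> real M ^ R \<longrightarrow>
    norm (\<Sum>a\<in>{M..<32 * M}. cis (t * ln (real a))) \<le> C * real M * (1 / t + real M powr (- c)))"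
proof -
  \<comment> \<open>Each differencing gains a factor \<open>H / M \<le> M powr (- 1/2)\<close>, so
    \<open>2 * R\<close> of them compensate \<open>t \<le> M ^ R\<close>.\<close>
  define J where "J = 2 * R"
  \<comment> \<open>The saving before the final root is about \<open>M powr (- 1/4)\<close>; a root
    of order \<open>2 ^ j\<close> with \<open>j \<le> J\<close> is then taken.\<close>
  define c :: real where "c = 1 / (4 * 2 ^ J)"
  have c: "c > 0" "c \<le> 1 / 4" unfolding c_def by (auto intro!: divide_left_mono)
  obtain Cf :: "nat \<Rightarrow> real" where Cf: "\<And>j. Cf j \<ge> 1" and vdc: "\<And>j f n N H l U. \<lbrakk>1 \<le> H; H \<le> N; n \<le> N; 0 < l;
     \<forall>x<n. l \<le> (fdiff ^^ Suc j) f x \<and> (fdiff ^^ Suc j) f x \<le> U; U * real H ^ j \<le> 1;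
     \<forall>x. Suc x < n \<longrightarrow> (fdiff ^^ Suc j) f (Suc x) \<le> (fdiff ^^ Suc j) f x\<rbrakk> \<Longrightarrow>
     norm (\<Sum>x<n. cis (f x)) ^ (2 ^ j) \<le> Cf j * real N ^ (2 ^ j) * (1 / real H + harm H ^ j / (real N * l * real H ^ j))"
    using van_der_Corput_iterated by metis
  define CC where "CC = (\<Sum>j\<le>J. Cf j)"
  have CC: "Cf j \<le> CC" if "j \<le> J" for j
    unfolding CC_def using that Cf by (intro member_le_sum) (auto intro: order_trans[OF zero_le_one])
  have CC1: "CC \<ge> 1" using CC[of 0] Cf[of 0] by simp
  define M0 :: nat where "M0 = fact J + J + 1"
  define K :: real where "K = 2 * 33 ^ (J + 1) * (1 + 2 * real J) ^ J"
  have K1: "K \<ge> 1"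
  proof -
    have "1 * 1 * 1 \<le> 2 * 33 ^ (J + 1) * (1 + 2 * real J) ^ J"
      by (intro mult_mono one_le_power) auto
    thus ?thesis unfolding K_def by simp
  qed
  define C where "C = 64 * CC * K + 31 * real M0"
  have CK: "CC * K \<ge> 1" using mult_mono[of 1 CC 1 K] CC1 K1 by simp
  have C: "C \<ge> 64 * CC * K" "C \<ge> 31 * real M0" "C \<ge> 64 * CC"
  proof -
    have "64 * CC * 1 \<le> 64 * CC * K" using CC1 K1 by (intro mult_left_mono) auto
    thus "C \<ge> 64 * CC * K" "C \<ge> 31 * real M0" "C \<ge> 64 * CC" unfolding C_def using CC1 by linarith+
  qed
  have main: "norm (\<Sum>a\<in>{M..<32 * M}. cis (t * ln (real a))) \<le> C * real M * (1 / t + real M powr (- c))"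
    if M: "M \<ge> 1" and t: "0 < t" "t \<le> real M ^ R" for M t
  proof (cases "M < M0")
    case True
    have "norm (\<Sum>a\<in>{M..<32 * M}. cis (t * ln (real a))) \<le> (\<Sum>a\<in>{M..<32 * M}. 1)"
      by (intro sum_norm_le) simp
    also have "\<dots> = 31 * real M" by simp
    also have "\<dots> \<le> (31 * real M0) * real M * (real M powr (- c))"
    proof -
      have "real M powr c \<le> real M powr 1" using M c by (intro powr_mono) auto
      also have "\<dots> \<le> real M0" using True M by simp
      finally have "real M powr c \<le> real M0" .
      hence "1 \<le> real M0 * real M powr (- c)" using M by (simp add: powr_minus field_simps)
      hence "31 * real M * 1 \<le> 31 * real M * (real M0 * real M powr (- c))" by (intro mult_left_mono) auto
      thus ?thesis by (simp add: mult_ac)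
    qed
    also have "\<dots> \<le> C * real M * (1 / t + real M powr (- c))"
      using C t CK by (intro mult_mono) auto
    finally show ?thesis .
  next
    case False
    define H where "H = nat \<lfloor>sqrt (real M)\<rfloor>"
    have sq1: "sqrt (real M) \<ge> 1" using M by simp
    have H: "real H \<le> sqrt (real M)" "real H \<ge> sqrt (real M) / 2" "H \<ge> 1"
    proof -
      show "H \<ge> 1" unfolding H_def using sq1 by (simp add: le_nat_floor)
      moreover show "real H \<le> sqrt (real M)" unfolding H_def using sq1 by linarith
      moreover have "real H > sqrt (real M) - 1" unfolding H_def using sq1 by linarith
      ultimately show "real H \<ge> sqrt (real M) / 2" by linarith
    qed
    have H2: "real H ^ 2 \<le> real M" using H(1) power_mono[of "real H" "sqrt (real M)" 2] by simp
    have HM: "H \<le> 32 * M"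
    proof -
      have "sqrt (real M) \<le> real M" using M by (simp add: real_le_lsqrt self_le_power)
      thus ?thesis using H(1) by linarith
    qed
    have Mpos: "real M > 0" "real H > 0" using M H(3) by auto
    define P where "P = (\<lambda>j. t * fact j / real M ^ Suc j * real H ^ j \<le> 1)"
    have "P J"
    proof -
      have "t * fact J * real H ^ J \<le> real M ^ R * fact J * (real H ^ 2) ^ R"
        using t Mpos by (intro mult_mono) (auto simp: J_def power_mult)
      also have "\<dots> \<le> real M ^ R * fact J * real M ^ R"
        using H2 by (intro mult_left_mono power_mono) auto
      also have "\<dots> = real M ^ J * fact J" by (simp add: J_def mult_2 power_add)
      also have "\<dots> \<le> real M ^ J * real M"
      proof (intro mult_left_mono)
        have "fact J \<le> M" using False unfolding M0_def by linarith
        thus "fact J \<le> real M" by (metis of_nat_fact of_nat_le_iff)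
      qed auto
      finally show ?thesis unfolding P_def using Mpos by (simp add: field_simps)
    qed
    \<comment> \<open>At the least depth the upper bound required for differencing holds, while its
      failure one level earlier bounds the differences from below.\<close>
    define j where "j = (LEAST j. P j)"
    have j: "P j" "j \<le> J" "\<And>i. i < j \<Longrightarrow> \<not> P i"
      unfolding j_def using LeastI[of P, OF \<open>P J\<close>] Least_le[of P, OF \<open>P J\<close>] not_less_Least by auto
    \<comment> \<open>The sign \<open>(-1) ^ j\<close> makes the derivative of order
      \<open>j + 1\<close> positive and the next one negative, as monotone decreasing differences
      require; for odd \<open>j\<close> it amounts to complex conjugation of the sum.\<close>
    define F where "F = (\<lambda>i y. case i of 0 \<Rightarrow> (-1) ^ j * t * ln y | Suc i \<Rightarrow> (-1) ^ j * (-1) ^ i * t * fact i / y ^ Suc i)"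
    have F: "(F i has_real_derivative F (Suc i) x) (at x)" if "x > 0" for i x
    proof (cases i)
      case 0
      have "((\<lambda>y. (-1) ^ j * t * ln y) has_real_derivative (-1) ^ j * t * (1 / x)) (at x)"
        using that by (auto intro!: derivative_eq_intros)
      thus ?thesis unfolding F_def 0 by simp
    next
      case (Suc i')
      have "((\<lambda>y. (-1) ^ j * (-1) ^ i' * t * fact i' * inverse (y ^ Suc i')) has_real_derivative
          (-1) ^ j * (-1) ^ i' * t * fact i' * (- (inverse (x ^ Suc i') * (real (Suc i') * x ^ i') * inverse (x ^ Suc i')))) (at x)"
        using that by (auto intro!: derivative_eq_intros simp del: power_Suc)
      also have "(-1) ^ j * (-1) ^ i' * t * fact i' * (- (inverse (x ^ Suc i') * (real (Suc i') * x ^ i') * inverse (x ^ Suc i'))) =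
          (-1) ^ j * (-1) ^ Suc i' * t * fact (Suc i') / x ^ Suc (Suc i')"
        using that by (simp add: field_simps)
      finally show ?thesis unfolding F_def Suc by (simp add: field_simps)
    qed
    define f where "f = (\<lambda>x. F 0 (real M + real x))"
    have D: "\<exists>\<xi>. real M + real x \<le> \<xi> \<and> \<xi> \<le> real M + real x + real k \<and> (fdiff ^^ k) f x = F k \<xi>" for x k
      unfolding f_def using F Mpos by (intro fdiff_mean_value) auto
    have sgn: "(-1) ^ j * (-1) ^ j = (1::real)" by (simp flip: power_add)
    \<comment> \<open>The intermediate point may exceed \<open>32 * M\<close> by up to
      \<open>Suc j \<le> M\<close>, hence \<open>33 * M\<close>.\<close>
    define l where "l = t * fact j / (33 * real M) ^ Suc j"
    define U where "U = t * fact j / real M ^ Suc j"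
    have S: "norm (\<Sum>x<31 * M. cis (f x)) ^ (2 ^ j) \<le> Cf j * real (32 * M) ^ (2 ^ j) *
        (1 / real H + harm H ^ j / (real (32 * M) * l * real H ^ j))"
    proof (rule vdc[where U = U])
      show "1 \<le> H" "H \<le> 32 * M" by fact+
      show "31 * M \<le> 32 * M" by simp
      show "0 < l" unfolding l_def using t Mpos by simp
      show "U * real H ^ j \<le> 1" using j(1) unfolding P_def U_def .
      show "\<forall>x<31 * M. l \<le> (fdiff ^^ Suc j) f x \<and> (fdiff ^^ Suc j) f x \<le> U"
      proof (intro allI impI)
        fix x assume x: "x < 31 * M"
        obtain \<xi> where \<xi>: "real M + real x \<le> \<xi>" "\<xi> \<le> real M + real x + real (Suc j)" "(fdiff ^^ Suc j) f x = F (Suc j) \<xi>"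
          using D by blast
        have "Suc j \<le> M" using False j(2) unfolding M0_def by linarith
        hence \<xi>': "\<xi> > 0" "real M \<le> \<xi>" "\<xi> \<le> 33 * real M" using \<xi> x Mpos by linarith+
        have "F (Suc j) \<xi> = t * fact j / \<xi> ^ Suc j" unfolding F_def using sgn by simp
        moreover have "t * fact j / \<xi> ^ Suc j \<le> U"
          unfolding U_def using t Mpos \<xi>' by (intro divide_left_mono power_mono mult_pos_pos zero_less_power) auto
        moreover have "l \<le> t * fact j / \<xi> ^ Suc j"
          unfolding l_def using t Mpos \<xi>' by (intro divide_left_mono power_mono mult_pos_pos zero_less_power) auto
        ultimately show "l \<le> (fdiff ^^ Suc j) f x \<and> (fdiff ^^ Suc j) f x \<le> U" using \<xi>(3) by simp
      qed
      show "\<forall>x. Suc x < 31 * M \<longrightarrow> (fdiff ^^ Suc j) f (Suc x) \<le> (fdiff ^^ Suc j) f x"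
      proof (intro allI impI)
        fix x assume "Suc x < 31 * M"
        obtain \<xi> where \<xi>: "real M + real x \<le> \<xi>" "(fdiff ^^ Suc (Suc j)) f x = F (Suc (Suc j)) \<xi>"
          using D by blast
        have "\<xi> > 0" using \<xi>(1) Mpos by linarith
        hence "F (Suc (Suc j)) \<xi> \<le> 0" unfolding F_def using sgn t by (simp add: divide_nonneg_pos)
        thus "(fdiff ^^ Suc j) f (Suc x) \<le> (fdiff ^^ Suc j) f x" using \<xi>(2) by (simp add: fdiff_def)
      qed
    qed
    have "norm (\<Sum>a\<in>{M..<32 * M}. cis (t * ln (real a))) = norm (\<Sum>x<31 * M. cis (t * ln (real M + real x)))"
      by (intro arg_cong[of _ _ norm] sum.reindex_bij_witness[of _ "\<lambda>x. M + x" "\<lambda>a. a - M"]) auto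
    also have "\<dots> = norm (\<Sum>x<31 * M. cis (f x))"
    proof (cases "even j")
      case True
      thus ?thesis unfolding f_def F_def by simp
    next
      case False
      thus ?thesis unfolding f_def F_def by (simp add: norm_sum_cis_uminus)
    qed
    finally have eq: "norm (\<Sum>a\<in>{M..<32 * M}. cis (t * ln (real a))) = norm (\<Sum>x<31 * M. cis (f x))" .
    show ?thesis
    proof (cases "j = 0")
      case True
      have "norm (\<Sum>x<31 * M. cis (f x)) \<le> Cf j * real (32 * M) * (1 / real H + 1 / (real (32 * M) * l))"
        using S unfolding True by simp
      also have "\<dots> \<le> CC * real (32 * M) * (2 * real M powr (- c) + 2 * (1 / t))"
      proof (intro mult_mono add_mono)
        have "real M powr c \<le> real M powr (1/2)" using M c by (intro powr_mono) auto
        hence "real M powr c / 2 \<le> real H" using H by (simp add: powr_half_sqrt)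
        thus "1 / real H \<le> 2 * real M powr (- c)" using Mpos by (simp add: powr_minus field_simps)
        have "1 / (real (32 * M) * l) = 33 / 32 * (1 / t)" unfolding l_def True using t Mpos by simp
        also have "\<dots> \<le> 2 * (1 / t)" using t by (intro mult_right_mono) auto
        finally show "1 / (real (32 * M) * l) \<le> 2 * (1 / t)" .
      qed (use CC[OF j(2)] CC1 Mpos t in \<open>auto simp: l_def\<close>)
      also have "\<dots> = 64 * CC * real M * (1 / t + real M powr (- c))" by (simp add: algebra_simps)
      also have "\<dots> \<le> C * real M * (1 / t + real M powr (- c))" using C t by (intro mult_right_mono) auto
      finally show ?thesis unfolding eq .
    next
      case False
      then obtain i where i: "j = Suc i" by (cases j) auto
      \<comment> \<open>This bounds \<open>t\<close> from below enough to make
        \<open>32 * M * l * H ^ j\<close> at least a constant times \<open>H\<close>, so both terms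
        of the estimate are of order \<open>1 / H\<close> up to harmonic factors.\<close>
      have "\<not> P i" using j(3)[of i] i by simp
      hence big: "1 \<le> t * fact i / real M ^ j * real H ^ i" unfolding P_def i by simp
      have "real H / 33 ^ (j + 1) \<le> real H / 33 ^ (j + 1) * (32 * real j * (t * fact i / real M ^ j * real H ^ i))"
      proof -
        have "1 * 1 \<le> (32 * real j) * (t * fact i / real M ^ j * real H ^ i)"
          using big i by (intro mult_mono) auto
        hence "real H / 33 ^ (j + 1) * 1 \<le> real H / 33 ^ (j + 1) * (32 * real j * (t * fact i / real M ^ j * real H ^ i))"
          by (intro mult_left_mono) auto
        thus ?thesis by simp
      qed
      also have "\<dots> = real (32 * M) * l * real H ^ j"
        unfolding l_def i using Mpos by (simp add: field_simps)
      finally have low: "real H / 33 ^ (j + 1) \<le> real (32 * M) * l * real H ^ j" .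
      define L :: real where "L = harm H"
      have "harm 1 \<le> (harm H :: real)" using H(3) by (rule harm_mono)
      hence L1: "L \<ge> 1" unfolding L_def by (simp add: harm_def)
      have J0: "J > 0" using i j(2) by simp
      \<comment> \<open>All harmonic factors together cost \<open>H powr (1/2)\<close>, which leaves
        \<open>H powr (- 1/2)\<close>.\<close>
      have LJ: "L ^ J \<le> (1 + 2 * real J) ^ J * real H powr (1/2)"
      proof -
        have "L \<le> (1 + 1 / (1 / (2 * real J))) * real H powr (1 / (2 * real J))"
          unfolding L_def using J0 H(3) by (intro harm_le_powr) auto
        hence "L ^ J \<le> ((1 + 2 * real J) * real H powr (1 / (2 * real J))) ^ J"
          using L1 by (intro power_mono) auto
        also have "\<dots> = (1 + 2 * real J) ^ J * real H powr (real J * (1 / (2 * real J)))"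
          using Mpos by (simp add: power_mult_distrib powr_power mult.commute)
        finally show ?thesis using J0 by simp
      qed
      have "1 / real H + L ^ j / (real (32 * M) * l * real H ^ j) \<le> 1 / real H + L ^ j / (real H / 33 ^ (j + 1))"
        using low Mpos L1 by (intro add_left_mono divide_left_mono) (auto simp: l_def t)
      also have "\<dots> = (1 + 33 ^ (j + 1) * L ^ j) / real H" by (simp add: add_divide_distrib mult_ac)
      also have "\<dots> \<le> (33 ^ (J + 1) * L ^ J + 33 ^ (J + 1) * L ^ J) / real H"
      proof (intro divide_right_mono add_mono)
        have "1 * 1 \<le> 33 ^ (J + 1) * L ^ J" using L1 by (intro mult_mono one_le_power) auto
        thus "1 \<le> 33 ^ (J + 1) * L ^ J" by simp
        show "33 ^ (j + 1) * L ^ j \<le> 33 ^ (J + 1) * L ^ J"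
          using j(2) L1 by (intro mult_mono power_increasing) auto
      qed auto
      also have "\<dots> = 2 * 33 ^ (J + 1) * L ^ J / real H" by simp
      also have "\<dots> \<le> 2 * 33 ^ (J + 1) * ((1 + 2 * real J) ^ J * real H powr (1/2)) / real H"
        using LJ by (intro divide_right_mono mult_left_mono) auto
      also have "\<dots> = K * (real H powr (1/2) / real H)" unfolding K_def by simp
      also have "real H powr (1/2) / real H = real H powr (- (1/2))"
        using Mpos powr_add[of "real H" "1/2" "1/2"] by (simp add: powr_minus field_simps)
      also have "\<dots> \<le> (sqrt (real M) / 2) powr (- (1/2))" using H sq1 by (intro powr_mono2') auto
      also have "\<dots> = 2 powr (1/2) * real M powr (- (1/4))"
        using Mpos by (simp add: powr_divide powr_powr powr_minus field_simps flip: powr_half_sqrt)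
      also have "\<dots> \<le> 2 powr 1 * real M powr (- (1/4))" by (intro mult_right_mono powr_mono) auto
      also have "real M powr (- (1/4)) \<le> (real M powr (- c)) ^ (2 ^ j)"
      proof -
        have "(2::real) ^ j \<le> 2 ^ J" using j(2) by (intro power_increasing) auto
        hence "c * 2 ^ j \<le> 1 / 4" unfolding c_def by (simp add: field_simps)
        hence "real M powr (- (1/4)) \<le> real M powr (- (c * 2 ^ j))" using M by (intro powr_mono) auto
        thus ?thesis using Mpos by (simp add: powr_power mult.commute)
      qed
      finally have "1 / real H + L ^ j / (real (32 * M) * l * real H ^ j) \<le> K * (2 * (real M powr (- c)) ^ (2 ^ j))"
        using K1 by simp
      hence "Cf j * real (32 * M) ^ (2 ^ j) * (1 / real H + L ^ j / (real (32 * M) * l * real H ^ j)) \<le>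
          CC * real (32 * M) ^ (2 ^ j) * (K * (2 * (real M powr (- c)) ^ (2 ^ j)))"
        using CC[OF j(2)] CC1 Mpos t L1 by (intro mult_mono) (auto simp: l_def)
      hence "norm (\<Sum>x<31 * M. cis (f x)) ^ (2 ^ j) \<le> (CC * K * 2) * (real (32 * M) * real M powr (- c)) ^ (2 ^ j)"
        using S unfolding L_def by (simp add: power_mult_distrib mult_ac)
      also have "\<dots> \<le> (CC * K * 2) ^ (2 ^ j) * (real (32 * M) * real M powr (- c)) ^ (2 ^ j)"
        using CK by (intro mult_right_mono self_le_power) auto
      also have "\<dots> = (CC * K * 2 * (real (32 * M) * real M powr (- c))) ^ (2 ^ j)"
        by (simp only: power_mult_distrib)
      finally have pow: "norm (\<Sum>x<31 * M. cis (f x)) ^ (2 ^ j) \<le> (CC * K * 2 * (real (32 * M) * real M powr (- c))) ^ (2 ^ j)" .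
      have nonneg: "0 \<le> CC * K * 2 * (real (32 * M) * real M powr (- c))"
        using CC1 K1 by (intro mult_nonneg_nonneg) auto
      have "norm (\<Sum>x<31 * M. cis (f x)) \<le> CC * K * 2 * (real (32 * M) * real M powr (- c))"
        using pow by (subst (asm) power_mono_iff[OF norm_ge_zero nonneg]) auto
      also have "\<dots> = 64 * CC * K * real M * real M powr (- c)" by simp
      also have "\<dots> \<le> C * real M * (1 / t + real M powr (- c))"
        using C CK t by (intro mult_mono) auto
      finally show ?thesis unfolding eq .
    qed
  qed
  have "C \<ge> 1" using C(1) CK by linarith
  thus ?thesis using c main by blast
qed

subsection \<open>Fejer kernels and mean values\<close>

text \<open>As a squared modulus the kernel is visibly nonnegative; \<open>fejer_expansion\<close>
  recovers the triangular weights. It has height \<open>J\<close> and width about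
  \<open>1 / J\<close> at 0.\<close>

definition fejer :: "nat \<Rightarrow> real \<Rightarrow> real" where
  "fejer J u = (norm (\<Sum>j<J. cis (real j * u)))\<^sup>2 / real J"

lemma fejer_nonneg: "fejer J u \<ge> 0"
  unfolding fejer_def by simp

lemma fejer_uminus: "fejer J (- u) = fejer J u"
  unfolding fejer_def using norm_sum_cis_uminus[of "\<lambda>j. real j * u" "{..<J}"] by simp

lemma fejer_le: "fejer J u \<le> real J"
proof -
  have "norm (\<Sum>j<J. cis (real j * u)) \<le> (\<Sum>j<J. 1)" by (intro sum_norm_le) simp
  hence "(norm (\<Sum>j<J. cis (real j * u)))\<^sup>2 \<le> (real J)\<^sup>2" by (intro power_mono) auto
  thus ?thesis unfolding fejer_def by (cases "J = 0") (simp_all add: divide_le_eq power2_eq_square)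
qed

lemma cos_ge_half:
  fixes x :: real
  assumes "\<bar>x\<bar> \<le> 1"
  shows "cos x \<ge> 1 / 2"
proof -
  have "cos (pi / 3) \<le> cos \<bar>x\<bar>" using assms pi_gt3 by (intro cos_monotone_0_pi_le) auto
  thus ?thesis by (simp add: cos_60)
qed

lemma abs_sin_ge_half:
  fixes x :: real
  assumes "\<bar>x\<bar> \<le> 1"
  shows "\<bar>x\<bar> / 2 \<le> \<bar>sin x\<bar>"
proof -
  have c: "cos \<bar>x\<bar> \<ge> 1 / 2" using cos_ge_half[OF assms] by simp
  have "\<bar>x\<bar> * (1 / 2) \<le> tan \<bar>x\<bar> * cos \<bar>x\<bar>" using le_tan[of "\<bar>x\<bar>"] assms c by (intro mult_mono) auto
  also have "\<dots> = sin \<bar>x\<bar>" using c unfolding tan_def by simp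
  also have "\<dots> \<le> \<bar>sin x\<bar>" by (simp add: abs_if)
  finally show ?thesis by simp
qed

text \<open>Within \<open>1 / J\<close> of 0 the trivial bound \<open>J\<close> suffices. Beyond,
  the geometric series applies with \<open>norm (cis u - 1) \<ge> \<bar>u\<bar> / 2\<close>. The
  range of \<open>u\<close> excludes the other peaks of this periodic kernel.\<close>

lemma fejer_decay:
  assumes "\<bar>u\<bar> \<le> 1"
  shows "fejer J u \<le> 64 * real J / (1 + real J * \<bar>u\<bar>)\<^sup>2"
proof (cases "real J * \<bar>u\<bar> \<le> 1")
  case True
  have "(1 + real J * \<bar>u\<bar>)\<^sup>2 \<le> 2\<^sup>2" using True by (intro power_mono) auto
  hence "64 * real J / 4 \<le> 64 * real J / (1 + real J * \<bar>u\<bar>)\<^sup>2"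
    using add_pos_nonneg[of 1 "real J * \<bar>u\<bar>"] by (intro divide_left_mono mult_pos_pos zero_less_power) auto
  thus ?thesis using fejer_le[of J u] by simp
next
  case False
  hence J: "J > 0" and u: "u \<noteq> 0" by (auto intro!: Nat.gr0I)
  have "\<bar>Im (cis u - 1)\<bar> \<le> norm (cis u - 1)" by (rule abs_Im_le_cmod)
  hence n1: "norm (cis u - 1) \<ge> \<bar>u\<bar> / 2" using abs_sin_ge_half[OF assms] by simp
  hence n0: "norm (cis u - 1) > 0" using u by linarith
  have "(\<Sum>j<J. cis (real j * u)) = (\<Sum>j<J. cis u ^ j)" by (intro sum.cong refl) (simp add: Complex.DeMoivre)
  also have "\<dots> = (cis u ^ J - 1) / (cis u - 1)" using n0 by (subst geometric_sum) auto
  finally have "norm (\<Sum>j<J. cis (real j * u)) = norm (cis u ^ J - 1) / norm (cis u - 1)"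
    by (simp add: norm_divide)
  also have "\<dots> \<le> 2 / (\<bar>u\<bar> / 2)"
  proof (intro frac_le)
    show "norm (cis u ^ J - 1) \<le> 2"
      using norm_triangle_ineq4[of "cis u ^ J" 1] by (simp add: norm_power)
  qed (use n1 u in auto)
  finally have "(norm (\<Sum>j<J. cis (real j * u)))\<^sup>2 \<le> (4 / \<bar>u\<bar>)\<^sup>2" by (intro power_mono) auto
  hence "fejer J u \<le> (4 / \<bar>u\<bar>)\<^sup>2 / real J" unfolding fejer_def by (intro divide_right_mono) auto
  also have "\<dots> = 64 * real J / (2 * (real J * \<bar>u\<bar>))\<^sup>2"
    using J u by (simp add: power2_eq_square field_simps)
  also have "\<dots> \<le> 64 * real J / (1 + real J * \<bar>u\<bar>)\<^sup>2"
  proof (intro divide_left_mono power_mono)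
    show "1 + real J * \<bar>u\<bar> \<le> 2 * (real J * \<bar>u\<bar>)" using False by linarith
    have "1 + real J * \<bar>u\<bar> > 0" "2 * (real J * \<bar>u\<bar>) > 0" using False by linarith+
    thus "0 < (2 * (real J * \<bar>u\<bar>))\<^sup>2 * (1 + real J * \<bar>u\<bar>)\<^sup>2" by (rule mult_pos_pos[OF zero_less_power zero_less_power, rotated])
  qed auto
  finally show ?thesis .
qed

lemma fejer_ge:
  assumes "real J * \<bar>u\<bar> \<le> 1" "J > 0"
  shows "fejer J u \<ge> real J / 4"
proof -
  have "real J / 2 = (\<Sum>j<J. 1 / 2)" by simp
  also have "\<dots> \<le> (\<Sum>j<J. cos (real j * u))"
  proof (intro sum_mono cos_ge_half)
    fix j assume "j \<in> {..<J}"
    hence "real j * \<bar>u\<bar> \<le> real J * \<bar>u\<bar>" by (intro mult_right_mono) auto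
    thus "\<bar>real j * u\<bar> \<le> 1" using assms by (simp add: abs_mult)
  qed
  also have "\<dots> = Re (\<Sum>j<J. cis (real j * u))" by simp
  also have "\<dots> \<le> norm (\<Sum>j<J. cis (real j * u))" by (rule complex_Re_le_cmod)
  finally have "(real J / 2)\<^sup>2 \<le> (norm (\<Sum>j<J. cis (real j * u)))\<^sup>2" by (intro power_mono) auto
  thus ?thesis unfolding fejer_def using assms(2) by (simp add: field_simps power2_eq_square)
qed

text \<open>A difference \<open>l\<close> arises from exactly \<open>J - \<bar>l\<bar>\<close> pairs
  when \<open>\<bar>l\<bar> < J\<close>.\<close>

lemma sum_differences:
  fixes f :: "int \<Rightarrow> complex"
  shows "(\<Sum>j<J. \<Sum>j'<J. f (int j - int j')) = (\<Sum>l\<in>{- int J<..<int J}. of_int (int J - \<bar>l\<bar>) * f l)"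
proof (induction J)
  case (Suc J)
  have "(\<Sum>j<Suc J. \<Sum>j'<Suc J. f (int j - int j')) =
     (\<Sum>j<J. \<Sum>j'<J. f (int j - int j')) + (\<Sum>j<J. f (int j - int J)) + (\<Sum>j'<J. f (int J - int j')) + f 0"
    by (simp add: sum.distrib)
  also have "(\<Sum>j<J. f (int j - int J)) = (\<Sum>l\<in>{- int J..<0}. f l)"
    by (rule sum.reindex_bij_witness[of _ "\<lambda>l. nat (l + int J)" "\<lambda>j. int j - int J"]) auto
  also have "(\<Sum>j'<J. f (int J - int j')) = (\<Sum>l\<in>{0<..int J}. f l)"
    by (rule sum.reindex_bij_witness[of _ "\<lambda>l. nat (int J - l)" "\<lambda>j. int J - int j"]) auto
  finally have "(\<Sum>j<Suc J. \<Sum>j'<Suc J. f (int j - int j')) =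
     (\<Sum>l\<in>{- int J<..<int J}. of_int (int J - \<bar>l\<bar>) * f l) +
     ((\<Sum>l\<in>{- int J..<0}. f l) + (f 0 + (\<Sum>l\<in>{0<..int J}. f l)))"
    using Suc.IH by (simp add: algebra_simps)
  also have "(\<Sum>l\<in>{- int J..<0}. f l) + (f 0 + (\<Sum>l\<in>{0<..int J}. f l)) = (\<Sum>l\<in>{- int J..<0} \<union> ({0} \<union> {0<..int J}). f l)"
    by (subst sum.union_disjoint; (subst sum.union_disjoint)?) auto
  also have "{- int J..<0} \<union> ({0} \<union> {0<..int J}) = {- int (Suc J)<..<int (Suc J)}" by auto
  also have "(\<Sum>l\<in>{- int J<..<int J}. of_int (int J - \<bar>l\<bar>) * f l) = (\<Sum>l\<in>{- int (Suc J)<..<int (Suc J)}. of_int (int J - \<bar>l\<bar>) * f l)"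
  proof (intro sum.mono_neutral_left ballI)
    fix l assume "l \<in> {- int (Suc J)<..<int (Suc J)} - {- int J<..<int J}"
    hence "int J - \<bar>l\<bar> = 0" by auto
    thus "complex_of_int (int J - \<bar>l\<bar>) * f l = 0" by (simp only: of_int_0 mult_zero_left)
  qed auto
  finally show ?case by (simp add: sum.distrib[symmetric] algebra_simps)
qed simp

lemma fejer_expansion:
  assumes "J > 0"
  shows "complex_of_real (fejer J u) =
    (\<Sum>l\<in>{- int J<..<int J}. complex_of_real (1 - \<bar>real_of_int l\<bar> / real J) * cis (real_of_int l * u))"
proof -
  have "complex_of_real ((norm (\<Sum>j<J. cis (real j * u)))\<^sup>2) = (\<Sum>j<J. cis (real j * u)) * cnj (\<Sum>j<J. cis (real j * u))"
    by (rule complex_norm_square)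
  also have "\<dots> = (\<Sum>j<J. \<Sum>j'<J. cis (real_of_int (int j - int j') * u))"
    by (simp add: sum_product cis_cnj cis_mult algebra_simps)
  also have "\<dots> = (\<Sum>l\<in>{- int J<..<int J}. of_int (int J - \<bar>l\<bar>) * cis (real_of_int l * u))"
    by (rule sum_differences)
  finally have "complex_of_real (fejer J u) = (\<Sum>l\<in>{- int J<..<int J}. of_int (int J - \<bar>l\<bar>) * cis (real_of_int l * u)) / of_nat J"
    unfolding fejer_def by simp
  also have "\<dots> = (\<Sum>l\<in>{- int J<..<int J}. complex_of_real (1 - \<bar>real_of_int l\<bar> / real J) * cis (real_of_int l * u))"
    unfolding sum_divide_distrib using assms by (intro sum.cong refl) (simp add: field_simps flip: of_int_abs)
  finally show ?thesis .
qed

text \<open>Doubling the kernel length makes the Fejer weights at least \<open>1/2\<close> for \<open>-J < l < J\<close>.\<close>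
lemma fejer_mean_value:
  fixes x :: "'a \<Rightarrow> complex" and u :: "'a \<Rightarrow> real"
  assumes J: "J > 0" and fin: "finite S" and B: "\<And>m. m \<in> S \<Longrightarrow> (\<Sum>m'\<in>S. fejer (2 * J) (u m - u m')) \<le> B"
  shows "(\<Sum>l\<in>{- int J<..<int J}. (norm (\<Sum>m\<in>S. x m * cis (real_of_int l * u m)))\<^sup>2) \<le> 2 * B * (\<Sum>m\<in>S. (norm (x m))\<^sup>2)"
proof -
  define K where "K = 2 * J"
  define T where "T = (\<lambda>l::int. \<Sum>m\<in>S. x m * cis (real_of_int l * u m))"
  define F where "F = (\<lambda>m m'. fejer K (u m - u m'))"
  have Fsym: "F m m' = F m' m" for m m' unfolding F_def using fejer_uminus[of K "u m - u m'"] by simp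
  have F0: "F m m' \<ge> 0" for m m' unfolding F_def by (rule fejer_nonneg)
  have "(\<Sum>l\<in>{- int J<..<int J}. (norm (T l))\<^sup>2) \<le> (\<Sum>l\<in>{- int J<..<int J}. 2 * ((1 - \<bar>real_of_int l\<bar> / real K) * (norm (T l))\<^sup>2))"
  proof (intro sum_mono)
    fix l assume "l \<in> {- int J<..<int J}"
    hence "\<bar>l\<bar> \<le> int J" by auto
    hence "real_of_int \<bar>l\<bar> \<le> real J" by linarith
    hence "1 \<le> 2 * (1 - \<bar>real_of_int l\<bar> / real K)" unfolding K_def using J by (simp add: field_simps)
    hence "1 * (norm (T l))\<^sup>2 \<le> 2 * (1 - \<bar>real_of_int l\<bar> / real K) * (norm (T l))\<^sup>2" by (intro mult_right_mono) auto
    thus "(norm (T l))\<^sup>2 \<le> 2 * ((1 - \<bar>real_of_int l\<bar> / real K) * (norm (T l))\<^sup>2)" by (simp only: mult.assoc mult_1)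
  qed
  also have "\<dots> \<le> (\<Sum>l\<in>{- int K<..<int K}. 2 * ((1 - \<bar>real_of_int l\<bar> / real K) * (norm (T l))\<^sup>2))"
  proof (intro sum_mono2)
    fix l assume "l \<in> {- int K<..<int K} - {- int J<..<int J}"
    hence "\<bar>l\<bar> \<le> int K" by auto
    hence "real_of_int \<bar>l\<bar> \<le> real K" by linarith
    hence "1 - \<bar>real_of_int l\<bar> / real K \<ge> 0" using J by (simp add: K_def field_simps)
    thus "0 \<le> 2 * ((1 - \<bar>real_of_int l\<bar> / real K) * (norm (T l))\<^sup>2)" by simp
  qed (auto simp: K_def)
  finally have 1: "(\<Sum>l\<in>{- int J<..<int J}. (norm (T l))\<^sup>2) \<le> 2 * (\<Sum>l\<in>{- int K<..<int K}. (1 - \<bar>real_of_int l\<bar> / real K) * (norm (T l))\<^sup>2)"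
    by (simp add: sum_distrib_left)
  have "complex_of_real (\<Sum>l\<in>{- int K<..<int K}. (1 - \<bar>real_of_int l\<bar> / real K) * (norm (T l))\<^sup>2) =
      (\<Sum>l\<in>{- int K<..<int K}. complex_of_real (1 - \<bar>real_of_int l\<bar> / real K) * (T l * cnj (T l)))"
    by (simp add: complex_norm_square del: of_real_diff of_real_divide flip: of_real_power)
  also have "\<dots> = (\<Sum>l\<in>{- int K<..<int K}. \<Sum>m\<in>S. \<Sum>m'\<in>S. x m * cnj (x m') * (complex_of_real (1 - \<bar>real_of_int l\<bar> / real K) * cis (real_of_int l * (u m - u m'))))"
  proof (intro sum.cong refl)
    fix l :: int
    have "T l * cnj (T l) = (\<Sum>m\<in>S. \<Sum>m'\<in>S. (x m * cis (real_of_int l * u m)) * (cnj (x m') * cis (- (real_of_int l * u m'))))"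
      unfolding T_def by (simp add: sum_product cis_cnj)
    also have "\<dots> = (\<Sum>m\<in>S. \<Sum>m'\<in>S. x m * cnj (x m') * cis (real_of_int l * (u m - u m')))"
    proof (intro sum.cong refl)
      fix m m'
      have "cis (real_of_int l * (u m - u m')) = cis (real_of_int l * u m) * cis (- (real_of_int l * u m'))"
        by (simp add: cis_mult right_diff_distrib)
      thus "(x m * cis (real_of_int l * u m)) * (cnj (x m') * cis (- (real_of_int l * u m'))) = x m * cnj (x m') * cis (real_of_int l * (u m - u m'))"
        by (simp only: mult_ac)
    qed
    finally show "complex_of_real (1 - \<bar>real_of_int l\<bar> / real K) * (T l * cnj (T l)) =
        (\<Sum>m\<in>S. \<Sum>m'\<in>S. x m * cnj (x m') * (complex_of_real (1 - \<bar>real_of_int l\<bar> / real K) * cis (real_of_int l * (u m - u m'))))"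
      by (simp only: sum_distrib_left mult_ac)
  qed
  also have "\<dots> = (\<Sum>m\<in>S. \<Sum>l\<in>{- int K<..<int K}. \<Sum>m'\<in>S. x m * cnj (x m') * (complex_of_real (1 - \<bar>real_of_int l\<bar> / real K) * cis (real_of_int l * (u m - u m'))))"
    by (rule sum.swap)
  also have "\<dots> = (\<Sum>m\<in>S. \<Sum>m'\<in>S. \<Sum>l\<in>{- int K<..<int K}. x m * cnj (x m') * (complex_of_real (1 - \<bar>real_of_int l\<bar> / real K) * cis (real_of_int l * (u m - u m'))))"
    by (intro sum.cong refl sum.swap)
  also have "\<dots> = (\<Sum>m\<in>S. \<Sum>m'\<in>S. x m * cnj (x m') * complex_of_real (F m m'))"
    unfolding F_def using J by (subst fejer_expansion) (simp_all add: K_def sum_distrib_left)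
  finally have "norm (complex_of_real (\<Sum>l\<in>{- int K<..<int K}. (1 - \<bar>real_of_int l\<bar> / real K) * (norm (T l))\<^sup>2)) =
      norm (\<Sum>m\<in>S. \<Sum>m'\<in>S. x m * cnj (x m') * complex_of_real (F m m'))" by (rule arg_cong)
  also have "\<dots> \<le> (\<Sum>m\<in>S. \<Sum>m'\<in>S. norm (x m * cnj (x m') * complex_of_real (F m m')))"
    by (intro sum_norm_le order_refl)
  \<comment> \<open>Schur's test: the kernel is symmetric and nonnegative, so after this step only
    its row sums matter.\<close>
  also have "\<dots> \<le> (\<Sum>m\<in>S. \<Sum>m'\<in>S. ((norm (x m))\<^sup>2 * F m m' + (norm (x m'))\<^sup>2 * F m m') / 2)"
  proof (intro sum_mono)
    fix m m'
    have "norm (x m) * norm (x m') \<le> ((norm (x m))\<^sup>2 + (norm (x m'))\<^sup>2) / 2"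
      using sum_squares_bound[of "norm (x m)" "norm (x m')"] by simp
    from mult_right_mono[OF this F0[of m m']]
    show "norm (x m * cnj (x m') * complex_of_real (F m m')) \<le> ((norm (x m))\<^sup>2 * F m m' + (norm (x m'))\<^sup>2 * F m m') / 2"
      using F0 by (simp add: norm_mult algebra_simps)
  qed
  also have "\<dots> = ((\<Sum>m\<in>S. \<Sum>m'\<in>S. (norm (x m))\<^sup>2 * F m m') + (\<Sum>m\<in>S. \<Sum>m'\<in>S. (norm (x m'))\<^sup>2 * F m m')) / 2"
    by (simp only: add_divide_distrib sum.distrib sum_divide_distrib)
  also have "(\<Sum>m\<in>S. \<Sum>m'\<in>S. (norm (x m'))\<^sup>2 * F m m') = (\<Sum>m\<in>S. \<Sum>m'\<in>S. (norm (x m))\<^sup>2 * F m m')"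
    by (subst sum.swap) (simp add: Fsym)
  also have "((\<Sum>m\<in>S. \<Sum>m'\<in>S. (norm (x m))\<^sup>2 * F m m') + (\<Sum>m\<in>S. \<Sum>m'\<in>S. (norm (x m))\<^sup>2 * F m m')) / 2 = (\<Sum>m\<in>S. (norm (x m))\<^sup>2 * (\<Sum>m'\<in>S. F m m'))"
    by (simp flip: sum_distrib_left)
  also have "\<dots> \<le> (\<Sum>m\<in>S. (norm (x m))\<^sup>2 * B)"
    using B unfolding F_def K_def by (intro sum_mono mult_left_mono) auto
  also have "\<dots> = B * (\<Sum>m\<in>S. (norm (x m))\<^sup>2)" by (simp add: sum_distrib_left mult.commute)
  finally have "\<bar>\<Sum>l\<in>{- int K<..<int K}. (1 - \<bar>real_of_int l\<bar> / real K) * (norm (T l))\<^sup>2\<bar> \<le> B * (\<Sum>m\<in>S. (norm (x m))\<^sup>2)"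
    by (simp only: norm_of_real)
  with 1 show ?thesis unfolding T_def by linarith
qed

text \<open>Duality: the left side \<open>Q\<close> is the pairing of \<open>b\<close> with the sums
  \<open>T\<close> whose coefficients are the values \<open>V\<close>. Cauchy-Schwarz and the direct
  inequality bound \<open>Q\<^sup>2\<close> by the right side times \<open>Q\<close>. The average
  now runs over points instead of frequencies.\<close>

lemma fejer_mean_value_dual:
  fixes b :: "int \<Rightarrow> complex" and u :: "'a \<Rightarrow> real"
  assumes J: "J > 0" and fin: "finite S" and B: "\<And>m. m \<in> S \<Longrightarrow> (\<Sum>m'\<in>S. fejer (2 * J) (u m - u m')) \<le> B" "B \<ge> 0"
  shows "(\<Sum>m\<in>S. (norm (\<Sum>l\<in>{- int J<..<int J}. b l * cis (- (real_of_int l * u m))))\<^sup>2) \<le> 2 * B * (\<Sum>l\<in>{- int J<..<int J}. (norm (b l))\<^sup>2)"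
proof -
  define L where "L = {- int J<..<int J}"
  define V where "V = (\<lambda>m. \<Sum>l\<in>L. b l * cis (- (real_of_int l * u m)))"
  define T where "T = (\<lambda>l. \<Sum>m\<in>S. V m * cis (real_of_int l * u m))"
  define Q where "Q = (\<Sum>m\<in>S. (norm (V m))\<^sup>2)"
  have Q0: "Q \<ge> 0" unfolding Q_def by (intro sum_nonneg) auto
  have "complex_of_real Q = (\<Sum>m\<in>S. V m * cnj (V m))"
    unfolding Q_def by (simp add: complex_norm_square flip: of_real_power)
  also have "\<dots> = (\<Sum>m\<in>S. \<Sum>l\<in>L. b l * (cis (- (real_of_int l * u m)) * cnj (V m)))"
    by (intro sum.cong refl, subst (1) V_def) (simp add: sum_distrib_right mult.assoc)
  also have "\<dots> = (\<Sum>l\<in>L. \<Sum>m\<in>S. b l * (cis (- (real_of_int l * u m)) * cnj (V m)))" by (rule sum.swap)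
  also have "\<dots> = (\<Sum>l\<in>L. b l * cnj (T l))"
    unfolding T_def by (simp add: sum_distrib_left cis_cnj mult_ac)
  finally have "norm (complex_of_real Q) = norm (\<Sum>l\<in>L. b l * cnj (T l))" by (rule arg_cong)
  also have "\<dots> \<le> (\<Sum>l\<in>L. norm (b l) * norm (T l))"
    by (intro sum_norm_le) (simp add: norm_mult)
  finally have "Q \<le> (\<Sum>l\<in>L. norm (b l) * norm (T l))" using Q0 by simp
  hence "Q\<^sup>2 \<le> (\<Sum>l\<in>L. norm (b l) * norm (T l))\<^sup>2" using Q0 by (intro power_mono) auto
  also have "\<dots> \<le> (\<Sum>l\<in>L. (norm (b l))\<^sup>2) * (\<Sum>l\<in>L. (norm (T l))\<^sup>2)" by (rule Cauchy_Schwarz_ineq_sum)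
  also have "\<dots> \<le> (\<Sum>l\<in>L. (norm (b l))\<^sup>2) * (2 * B * Q)"
    unfolding L_def T_def Q_def using fejer_mean_value[OF J fin B(1)] by (intro mult_left_mono sum_nonneg) auto
  finally have "Q * Q \<le> (2 * B * (\<Sum>l\<in>L. (norm (b l))\<^sup>2)) * Q" by (simp add: power2_eq_square mult_ac)
  moreover have "0 \<le> 2 * B * (\<Sum>l\<in>L. (norm (b l))\<^sup>2)" using B(2) by (intro mult_nonneg_nonneg sum_nonneg) auto
  ultimately have "Q \<le> 2 * B * (\<Sum>l\<in>L. (norm (b l))\<^sup>2)"
    using Q0 by (cases "Q = 0") (auto simp: mult_le_cancel_right)
  thus ?thesis unfolding Q_def V_def L_def .
qed

section \<open>Kernel sums over logarithms of integers\<close>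

text \<open>Each term is at most a consecutive difference of \<open>1 / (s * (1 + s * d))\<close>,
  so the sum telescopes.\<close>

lemma sum_inverse_square_tail:
  fixes s :: real
  assumes "s > 0"
  shows "(\<Sum>d\<in>{a<..b::nat}. 1 / (1 + s * real d)\<^sup>2) \<le> 1 / (s * (1 + s * real a))"
proof (cases "a \<le> b")
  case True
  have "(\<Sum>d\<in>{a<..b}. 1 / (1 + s * real d)\<^sup>2) \<le> 1 / (s * (1 + s * real a)) - 1 / (s * (1 + s * real b))"
    using True
  proof (induction b rule: nat_induct_at_least)
    case base
    show ?case by simp
  next
    case (Suc n)
    have "{a<..Suc n} = insert (Suc n) {a<..n}" using Suc.hyps by auto
    hence "(\<Sum>d\<in>{a<..Suc n}. 1 / (1 + s * real d)\<^sup>2) = 1 / (1 + s * real (Suc n))\<^sup>2 + (\<Sum>d\<in>{a<..n}. 1 / (1 + s * real d)\<^sup>2)"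
      by simp
    moreover have "1 / (1 + s * real (Suc n))\<^sup>2 \<le> 1 / (s * (1 + s * real n)) - 1 / (s * (1 + s * real (Suc n)))"
    proof -
      define p where "p = 1 + s * real n"
      have p: "p > 0" "1 + s * real (Suc n) = p + s" unfolding p_def using assms by (auto simp: algebra_simps intro: add_pos_nonneg)
      have "1 / (s * p) - 1 / (s * (p + s)) = 1 / (p * (p + s))"
      proof -
        have "p + s > 0" "s > 0" using p assms by auto
        thus ?thesis using p(1) by (simp add: divide_simps)
      qed
      moreover have "1 / (p + s)\<^sup>2 \<le> 1 / (p * (p + s))"
        using p assms by (intro divide_left_mono) (auto simp: power2_eq_square intro!: mult_mono)
      ultimately show ?thesis unfolding p(2) p_def[symmetric] by simp
    qed
    ultimately show ?case using Suc.IH by linarith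
  qed
  moreover have "1 / (s * (1 + s * real b)) \<ge> 0" using assms by simp
  ultimately show ?thesis by linarith
qed (use assms in simp)

lemma sum_inverse_square_far:
  fixes s :: real and S :: "nat set"
  assumes s: "s > 0" and fin: "finite S" and far: "\<And>m. m \<in> S \<Longrightarrow> real h < \<bar>real m - real n\<bar>"
  shows "(\<Sum>m\<in>S. 1 / (1 + s * \<bar>real m - real n\<bar>)\<^sup>2) \<le> 2 / (s * (1 + s * real h))"
proof -
  define b where "b = Max (insert n S)"
  have b: "m \<le> b" if "m \<in> S" for m unfolding b_def using fin that by simp
  have nb: "n \<le> b" unfolding b_def using fin by simp
  have part: "(\<Sum>m\<in>A. 1 / (1 + s * \<bar>real m - real n\<bar>)\<^sup>2) \<le> 1 / (s * (1 + s * real h))"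
    if A: "\<And>m. m \<in> A \<Longrightarrow> m \<in> S \<and> \<bar>real m - real n\<bar> = real (f m)" "inj_on f A" "\<And>m. m \<in> A \<Longrightarrow> f m \<le> b" for A f
  proof -
    have "(\<Sum>m\<in>A. 1 / (1 + s * \<bar>real m - real n\<bar>)\<^sup>2) = (\<Sum>m\<in>A. 1 / (1 + s * real (f m))\<^sup>2)"
      using A by (intro sum.cong) auto
    also have "\<dots> = (\<Sum>d\<in>f ` A. 1 / (1 + s * real d)\<^sup>2)" using A(2) by (simp add: sum.reindex)
    also have "\<dots> \<le> (\<Sum>d\<in>{h<..b}. 1 / (1 + s * real d)\<^sup>2)"
      using A far by (intro sum_mono2) force+
    also have "\<dots> \<le> 1 / (s * (1 + s * real h))" by (rule sum_inverse_square_tail[OF s])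
    finally show ?thesis .
  qed
  define above where "above = {m \<in> S. m > n}"
  define below where "below = {m \<in> S. m < n}"
  have S: "S = above \<union> below" unfolding above_def below_def using far by force
  have "finite above" "finite below" "above \<inter> below = {}" unfolding above_def below_def using fin by auto
  hence "(\<Sum>m\<in>S. 1 / (1 + s * \<bar>real m - real n\<bar>)\<^sup>2) =
      (\<Sum>m\<in>above. 1 / (1 + s * \<bar>real m - real n\<bar>)\<^sup>2) + (\<Sum>m\<in>below. 1 / (1 + s * \<bar>real m - real n\<bar>)\<^sup>2)"
    unfolding S by (rule sum.union_disjoint)
  also have "\<dots> \<le> 1 / (s * (1 + s * real h)) + 1 / (s * (1 + s * real h))"
  proof (intro add_mono)
    show "(\<Sum>m\<in>above. 1 / (1 + s * \<bar>real m - real n\<bar>)\<^sup>2) \<le> 1 / (s * (1 + s * real h))"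
      by (rule part[where f = "\<lambda>m. m - n"]) (auto simp: above_def inj_on_def intro: b order_trans[OF diff_le_self])
    show "(\<Sum>m\<in>below. 1 / (1 + s * \<bar>real m - real n\<bar>)\<^sup>2) \<le> 1 / (s * (1 + s * real h))"
      by (rule part[where f = "\<lambda>m. n - m"]) (auto simp: below_def inj_on_def intro: nb order_trans[OF diff_le_self])
  qed
  finally show ?thesis by simp
qed

text \<open>Integers up to \<open>B\<close> thus have logarithms spaced at least
  \<open>1 / B\<close> apart, the spacing on which the mean value theorems rest.\<close>

lemma abs_ln_diff_ge:
  fixes m n :: nat
  assumes "m > 0" "n > 0" "real m \<le> B" "real n \<le> B"
  shows "\<bar>real m - real n\<bar> / B \<le> \<bar>ln (real m) - ln (real n)\<bar>"
proof -
  have *: "(real b - real a) / B \<le> ln (real b) - ln (real a)" if "0 < a" "a \<le> b" "real b \<le> B" for a b :: nat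
  proof -
    have "ln (real a / real b) \<le> real a / real b - 1" using that by (intro ln_le_minus_one) auto
    hence "1 - real a / real b \<le> ln (real b) - ln (real a)" using that by (simp add: ln_div)
    moreover have "(real b - real a) / B \<le> (real b - real a) / real b" using that by (intro divide_left_mono) auto
    moreover have "(real b - real a) / real b = 1 - real a / real b" using that by (simp add: field_simps)
    ultimately show ?thesis by linarith
  qed
  show ?thesis
  proof (cases "m \<le> n")
    case True
    thus ?thesis using *[of m n] assms by (simp add: abs_if)
  next
    case False
    thus ?thesis using *[of n m] assms by (simp add: abs_if)
  qed
qed

lemma fejer_ln_decay:
  fixes m n :: nat
  assumes "m > 0" "n > 0" "real m \<le> B" "real n \<le> B" "\<kappa> > 0" "\<bar>\<kappa> * ln (real m) - \<kappa> * ln (real n)\<bar> \<le> 1"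
  shows "fejer K (\<kappa> * ln (real m) - \<kappa> * ln (real n)) \<le> 64 * real K * (1 / (1 + (real K * \<kappa> / B) * \<bar>real m - real n\<bar>)\<^sup>2)"
proof -
  have B: "B > 0" using assms by linarith
  have "fejer K (\<kappa> * ln (real m) - \<kappa> * ln (real n)) \<le> 64 * real K / (1 + real K * \<bar>\<kappa> * ln (real m) - \<kappa> * ln (real n)\<bar>)\<^sup>2"
    by (rule fejer_decay) fact
  also have "\<dots> \<le> 64 * real K / (1 + (real K * \<kappa> / B) * \<bar>real m - real n\<bar>)\<^sup>2"
  proof (intro divide_left_mono power_mono add_left_mono mult_pos_pos zero_less_power)
    have "real K * \<kappa> * (\<bar>real m - real n\<bar> / B) \<le> real K * \<kappa> * \<bar>ln (real m) - ln (real n)\<bar>"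
      using assms by (intro mult_left_mono abs_ln_diff_ge) auto
    also have "\<dots> = real K * \<bar>\<kappa> * ln (real m) - \<kappa> * ln (real n)\<bar>"
      using assms by (simp add: abs_mult flip: right_diff_distrib)
    finally show "(real K * \<kappa> / B) * \<bar>real m - real n\<bar> \<le> real K * \<bar>\<kappa> * ln (real m) - \<kappa> * ln (real n)\<bar>"
      by simp
  qed (use assms B in \<open>auto intro: add_pos_nonneg\<close>)
  finally show ?thesis by simp
qed

text \<open>The row sum for the mean value theorems. The diagonal gives the \<open>K\<close> term;
  the other points, spaced by at least \<open>\<kappa> / B\<close>, give \<open>B / \<kappa>\<close>
  whatever \<open>K\<close> is.\<close>

lemma sum_fejer_ln:
  fixes S :: "nat set"
  assumes fin: "finite S" and S: "\<And>m. m \<in> S \<Longrightarrow> m > 0 \<and> real m \<le> B" and \<kappa>: "\<kappa> > 0" and K: "K > 0"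
    and close: "\<And>m m'. m \<in> S \<Longrightarrow> m' \<in> S \<Longrightarrow> \<bar>\<kappa> * ln (real m) - \<kappa> * ln (real m')\<bar> \<le> 1" and m: "m \<in> S"
  shows "(\<Sum>m'\<in>S. fejer K (\<kappa> * ln (real m) - \<kappa> * ln (real m'))) \<le> 64 * real K + 128 * B / \<kappa>"
proof -
  define s where "s = real K * \<kappa> / B"
  have B: "B > 0" using S[OF m] by linarith
  have s: "s > 0" unfolding s_def using B K \<kappa> by simp
  have "(\<Sum>m'\<in>S. fejer K (\<kappa> * ln (real m) - \<kappa> * ln (real m'))) =
      fejer K (\<kappa> * ln (real m) - \<kappa> * ln (real m)) + (\<Sum>m'\<in>S - {m}. fejer K (\<kappa> * ln (real m) - \<kappa> * ln (real m')))"
    using fin m by (simp add: sum.remove)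
  also have "fejer K (\<kappa> * ln (real m) - \<kappa> * ln (real m)) \<le> 64 * real K"
    using fejer_le[of K "\<kappa> * ln (real m) - \<kappa> * ln (real m)"] by linarith
  also have "(\<Sum>m'\<in>S - {m}. fejer K (\<kappa> * ln (real m) - \<kappa> * ln (real m'))) \<le>
      (\<Sum>m'\<in>S - {m}. 64 * real K * (1 / (1 + s * \<bar>real m' - real m\<bar>)\<^sup>2))"
  proof (intro sum_mono)
    fix m' assume "m' \<in> S - {m}"
    thus "fejer K (\<kappa> * ln (real m) - \<kappa> * ln (real m')) \<le> 64 * real K * (1 / (1 + s * \<bar>real m' - real m\<bar>)\<^sup>2)"
      using fejer_ln_decay[of m m' B \<kappa> K] S[OF m] S[of m'] close[OF m, of m'] \<kappa>
      unfolding s_def by (simp add: abs_minus_commute)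
  qed
  also have "\<dots> = 64 * real K * (\<Sum>m'\<in>S - {m}. 1 / (1 + s * \<bar>real m' - real m\<bar>)\<^sup>2)"
    by (simp add: sum_distrib_left)
  also have "\<dots> \<le> 64 * real K * (2 / (s * (1 + s * real 0)))"
    using fin s by (intro mult_left_mono sum_inverse_square_far) auto
  also have "\<dots> = 128 * B / \<kappa>" unfolding s_def using K \<kappa> B by (simp add: field_simps)
  finally show ?thesis by simp
qed

subsection \<open>Products of many factors\<close>

text \<open>The ratio 32 leaves room: with \<open>M\<close> close to \<open>z / 8\<close> the range
  contains everything from \<open>z / 6\<close> to \<open>3 * z\<close>, where the factors of the
  counted products lie.\<close>

definition dsum :: "nat \<Rightarrow> real \<Rightarrow> complex" where
  "dsum M t = (\<Sum>a\<in>{M..<32 * M}. cis (t * ln (real a)))"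

definition tuples :: "nat \<Rightarrow> nat \<Rightarrow> (nat \<Rightarrow> nat) set" where
  "tuples M k = PiE {..<k} (\<lambda>_. {M..<32 * M})"

definition tprod :: "nat \<Rightarrow> (nat \<Rightarrow> nat) \<Rightarrow> nat" where
  "tprod k \<omega> = (\<Prod>i<k. \<omega> i)"

definition tuple_count :: "nat \<Rightarrow> nat \<Rightarrow> nat \<Rightarrow> nat" where
  "tuple_count M k m = card {\<omega> \<in> tuples M k. tprod k \<omega> = m}"

lemma finite_tuples: "finite (tuples M k)"
  unfolding tuples_def by (intro finite_PiE) auto

lemma card_tuples: "card (tuples M k) = (31 * M) ^ k"
  unfolding tuples_def by (subst card_PiE) auto

lemma tuplesD: "\<omega> \<in> tuples M k \<Longrightarrow> i < k \<Longrightarrow> M \<le> \<omega> i \<and> \<omega> i < 32 * M"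
  unfolding tuples_def by (auto simp: PiE_iff)

lemma tprod_bounds:
  assumes "\<omega> \<in> tuples M k"
  shows "M ^ k \<le> tprod k \<omega>" "tprod k \<omega> \<le> (32 * M) ^ k"
proof -
  have "(\<Prod>i<k. M) \<le> (\<Prod>i<k. \<omega> i)" using tuplesD[OF assms] by (intro prod_mono) auto
  thus "M ^ k \<le> tprod k \<omega>" by (simp add: tprod_def)
  have "(\<Prod>i<k. \<omega> i) \<le> (\<Prod>i<k. 32 * M)"
    using tuplesD[OF assms] by (intro prod_mono) (auto simp: less_imp_le)
  thus "tprod k \<omega> \<le> (32 * M) ^ k" by (simp add: tprod_def)
qed

lemma tprod_smooth:
  assumes "\<omega> \<in> tuples M k" "prime p" "p dvd tprod k \<omega>" "M > 0"
  shows "p \<le> 32 * M"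
proof -
  obtain i where i: "i < k" "p dvd \<omega> i"
    using assms(2,3) unfolding tprod_def by (auto simp: prime_dvd_prod_iff)
  thus ?thesis using tuplesD[OF assms(1) i(1)] assms(4) dvd_imp_le[OF i(2)] by linarith
qed

lemma dsum_power:
  assumes "M > 0"
  shows "dsum M t ^ k = (\<Sum>\<omega>\<in>tuples M k. cis (t * ln (real (tprod k \<omega>))))"
proof -
  have "dsum M t ^ k = (\<Prod>i<k. \<Sum>a\<in>{M..<32 * M}. cis (t * ln (real a)))" by (simp add: dsum_def)
  also have "\<dots> = (\<Sum>\<omega>\<in>tuples M k. \<Prod>i<k. cis (t * ln (real (\<omega> i))))"
    unfolding tuples_def by (rule prod_sum_PiE) auto
  also have "\<dots> = (\<Sum>\<omega>\<in>tuples M k. cis (t * ln (real (tprod k \<omega>))))"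
  proof (intro sum.cong refl)
    fix \<omega> assume \<omega>: "\<omega> \<in> tuples M k"
    have "(\<Prod>i<j. cis (t * ln (real (\<omega> i)))) = cis (t * ln (real (\<Prod>i<j. \<omega> i))) \<and> (\<Prod>i<j. \<omega> i) > 0" if "j \<le> k" for j
      using that
    proof (induction j)
      case (Suc j)
      have pos: "\<omega> j > 0" using tuplesD[OF \<omega>, of j] Suc.prems assms by auto
      have IH: "(\<Prod>i<j. cis (t * ln (real (\<omega> i)))) = cis (t * ln (real (\<Prod>i<j. \<omega> i)))" "(\<Prod>i<j. \<omega> i) > 0"
        using Suc by auto
      have "ln (real (\<Prod>i<Suc j. \<omega> i)) = ln (real (\<Prod>i<j. \<omega> i)) + ln (real (\<omega> j))"
        using IH(2) pos unfolding prod.lessThan_Suc of_nat_mult by (intro ln_mult_pos) (simp_all only: of_nat_0_less_iff)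
      moreover have "(\<Prod>i<Suc j. cis (t * ln (real (\<omega> i)))) = cis (t * ln (real (\<Prod>i<j. \<omega> i))) * cis (t * ln (real (\<omega> j)))"
        using IH(1) by simp
      ultimately show ?case using IH(2) pos by (simp add: cis_mult distrib_left)
    qed simp
    thus "(\<Prod>i<k. cis (t * ln (real (\<omega> i)))) = cis (t * ln (real (tprod k \<omega>)))" unfolding tprod_def by blast
  qed
  finally show ?thesis .
qed

lemma sum_tuples:
  fixes \<phi> :: "nat \<Rightarrow> 'b :: comm_semiring_1"
  assumes "finite S" "\<And>\<omega>. \<omega> \<in> tuples M k \<Longrightarrow> tprod k \<omega> \<in> S"
  shows "(\<Sum>\<omega>\<in>tuples M k. \<phi> (tprod k \<omega>)) = (\<Sum>m\<in>S. of_nat (tuple_count M k m) * \<phi> m)"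
proof -
  have "(\<Sum>\<omega>\<in>tuples M k. \<phi> (tprod k \<omega>)) = (\<Sum>m\<in>S. \<Sum>\<omega>\<in>{\<omega> \<in> tuples M k. tprod k \<omega> = m}. \<phi> (tprod k \<omega>))"
    using assms finite_tuples by (intro sum.group[symmetric]) auto
  also have "\<dots> = (\<Sum>m\<in>S. \<Sum>\<omega>\<in>{\<omega> \<in> tuples M k. tprod k \<omega> = m}. \<phi> m)"
    by (intro sum.cong refl) auto
  also have "\<dots> = (\<Sum>m\<in>S. of_nat (tuple_count M k m) * \<phi> m)" by (simp add: tuple_count_def)
  finally show ?thesis .
qed

text \<open>Every entry of a tuple with product \<open>m\<close> divides \<open>m\<close>.\<close>

lemma tuple_count_le:
  assumes "m > 0"
  shows "tuple_count M k m \<le> num_divs m ^ k"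
proof -
  have "{\<omega> \<in> tuples M k. tprod k \<omega> = m} \<subseteq> PiE {..<k} (\<lambda>_. {d. d dvd m})"
  proof
    fix \<omega> assume "\<omega> \<in> {\<omega> \<in> tuples M k. tprod k \<omega> = m}"
    hence "\<omega> \<in> extensional {..<k}" "m = (\<Prod>i<k. \<omega> i)" unfolding tuples_def tprod_def by (auto simp: PiE_iff)
    thus "\<omega> \<in> PiE {..<k} (\<lambda>_. {d. d dvd m})" by (auto simp: PiE_iff simp del: dvd_def intro!: dvd_prodI)
  qed
  hence "tuple_count M k m \<le> card (PiE {..<k} (\<lambda>_. {d. d dvd m}))"
    unfolding tuple_count_def using assms by (intro card_mono finite_PiE) auto
  also have "\<dots> = num_divs m ^ k" by (subst card_PiE) (auto simp: num_divs_def)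
  finally show ?thesis .
qed

lemma card_real_interval_ge:
  fixes x w :: real
  assumes "x \<ge> 0"
  shows "w - 1 \<le> real (card {a::nat. x \<le> real a \<and> real a \<le> x + w})"
proof (cases "w \<ge> 1")
  case True
  have "{nat \<lceil>x\<rceil>..nat \<lfloor>x + w\<rfloor>} \<subseteq> {a::nat. x \<le> real a \<and> real a \<le> x + w}"
    using assms True by (auto simp: le_nat_iff nat_le_iff) linarith+
  moreover have "finite {a::nat. x \<le> real a \<and> real a \<le> x + w}"
    by (rule finite_subset[of _ "{..nat \<lfloor>x + w\<rfloor>}"]) (auto simp: le_nat_floor)
  ultimately have "card {nat \<lceil>x\<rceil>..nat \<lfloor>x + w\<rfloor>} \<le> card {a::nat. x \<le> real a \<and> real a \<le> x + w}"
    by (intro card_mono)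
  moreover have "w - 1 \<le> real (card {nat \<lceil>x\<rceil>..nat \<lfloor>x + w\<rfloor>})"
    using assms True by (simp add: of_nat_diff Suc_diff_le) linarith
  ultimately show ?thesis by linarith
qed simp

text \<open>The first \<open>k\<close> factors are free in \<open>[z, z + z/k]\<close>; their
  product stays within a factor 3 of \<open>z ^ k\<close> because
  \<open>(1 + 1/k) ^ k \<le> exp 1\<close>. The last factor then needs only to lie slightly above
  the quotient of \<open>x\<close> by that product, itself between \<open>z / 6\<close> and
  \<open>2 * z\<close>.\<close>

lemma card_tuples_near_ge:
  fixes z c \<eta> :: real
  assumes M: "real M \<le> z / 8" "3 * z < 32 * real M" and z: "z \<ge> 2 * real k + 2"
    and x: "z ^ Suc k / 2 \<le> x" "x \<le> 2 * z ^ Suc k" and \<eta>: "0 < \<eta>" "\<eta> \<le> 1 / 2" "\<eta> * z \<ge> 24"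
    and k: "k > 0"
  shows "(z / (2 * real k)) ^ k * (\<eta> * z / 24) \<le>
    real (card {\<omega> \<in> tuples M (Suc k). x \<le> real (tprod (Suc k) \<omega>) \<and> real (tprod (Suc k) \<omega>) \<le> x * (1 + \<eta>)})"
proof -
  have z0: "z > 0" using z by linarith
  define A where "A = {a::nat. z \<le> real a \<and> real a \<le> z + z / real k}"
  define B where "B = (\<lambda>\<omega>. {a::nat. x / real (tprod k \<omega>) \<le> real a \<and> real a \<le> x / real (tprod k \<omega>) + \<eta> * z / 12})"
  define P where "P = PiE {..<k} (\<lambda>_. A)"
  have finA: "finite A" unfolding A_def
    by (rule finite_subset[of _ "{..nat \<lfloor>z + z / real k\<rfloor>}"]) (auto simp: le_nat_floor)
  have finB: "finite (B \<omega>)" for \<omega> unfolding B_def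
    by (rule finite_subset[of _ "{..nat \<lfloor>x / real (tprod k \<omega>) + \<eta> * z / 12\<rfloor>}"]) (auto simp: le_nat_floor)
  have kz: "z / real k \<le> z" using k z0 by (simp add: divide_le_eq)
  have A: "M \<le> a \<and> a < 32 * M" if "a \<in> A" for a
    using that M z0 kz unfolding A_def by auto
  have tp: "z ^ k \<le> real (tprod k \<omega>)" "real (tprod k \<omega>) \<le> 3 * z ^ k" if "\<omega> \<in> P" for \<omega>
  proof -
    have \<omega>: "z \<le> real (\<omega> i)" "real (\<omega> i) \<le> z * (1 + 1 / real k)" if "i < k" for i
      using \<open>\<omega> \<in> P\<close> that unfolding P_def A_def by (auto simp: PiE_iff algebra_simps)
    have "(\<Prod>i<k. z) \<le> (\<Prod>i<k. real (\<omega> i))" using \<omega> z0 by (intro prod_mono) auto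
    thus "z ^ k \<le> real (tprod k \<omega>)" by (simp add: tprod_def)
    have "(\<Prod>i<k. real (\<omega> i)) \<le> (\<Prod>i<k. z * (1 + 1 / real k))" using \<omega> z0 by (intro prod_mono) auto
    also have "\<dots> = z ^ k * (1 + 1 / real k) ^ k" by (simp add: power_mult_distrib)
    also have "(1 + 1 / real k) ^ k \<le> exp (1 / real k) ^ k"
      using exp_ge_add_one_self[of "1 / real k"] by (intro power_mono) auto
    also have "\<dots> = exp 1" using k by (simp flip: exp_of_nat_mult)
    also have "\<dots> \<le> 3" by (rule exp_le)
    finally show "real (tprod k \<omega>) \<le> 3 * z ^ k" using z0 by (simp add: tprod_def mult_ac)
  qed
  have quot: "z / 6 \<le> x / real (tprod k \<omega>)" "x / real (tprod k \<omega>) \<le> 2 * z" if "\<omega> \<in> P" for \<omega>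
  proof -
    have t0: "real (tprod k \<omega>) > 0" using tp[OF that] z0 zero_less_power[of z k] by linarith
    have "z / 6 * real (tprod k \<omega>) \<le> z / 6 * (3 * z ^ k)" using tp[OF that] z0 by (intro mult_left_mono) auto
    also have "\<dots> \<le> x" using x by simp
    finally show "z / 6 \<le> x / real (tprod k \<omega>)" using t0 by (simp add: pos_le_divide_eq)
    have "x \<le> 2 * z * z ^ k" using x by simp
    also have "\<dots> \<le> 2 * z * real (tprod k \<omega>)" using tp[OF that] z0 by (intro mult_left_mono) auto
    finally show "x / real (tprod k \<omega>) \<le> 2 * z" using t0 by (simp add: pos_divide_le_eq)
  qed
  define \<Psi> where "\<Psi> = (\<lambda>(\<omega>::nat \<Rightarrow> nat, a::nat). fun_upd \<omega> k a)"
  have inj: "inj_on \<Psi> (Sigma P B)"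
  proof (rule inj_onI)
    fix s s' assume s: "s \<in> Sigma P B" "s' \<in> Sigma P B" "\<Psi> s = \<Psi> s'"
    obtain \<omega> a where sa: "s = (\<omega>, a)" by (cases s)
    obtain \<omega>' a' where sa': "s' = (\<omega>', a')" by (cases s')
    have eq: "fun_upd \<omega> k a = fun_upd \<omega>' k a'" using s(3) unfolding \<Psi>_def sa sa' by simp
    have "\<omega> k = undefined" "\<omega>' k = undefined" using s(1,2) unfolding sa sa' P_def by (auto simp: PiE_iff extensional_def)
    hence "\<omega> i = \<omega>' i" for i using fun_cong[OF eq, of i] by (cases "i = k") auto
    moreover have "a = a'" using fun_cong[OF eq, of k] by simp
    ultimately show "s = s'" unfolding sa sa' by auto
  qed
  have range: "\<Psi> ` Sigma P B \<subseteq> {\<omega> \<in> tuples M (Suc k). x \<le> real (tprod (Suc k) \<omega>) \<and> real (tprod (Suc k) \<omega>) \<le> x * (1 + \<eta>)}"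
  proof
    fix \<omega>' assume "\<omega>' \<in> \<Psi> ` Sigma P B"
    then obtain \<omega> a where \<omega>: "\<omega> \<in> P" "a \<in> B \<omega>" "\<omega>' = fun_upd \<omega> k a" unfolding \<Psi>_def by auto
    have t0: "real (tprod k \<omega>) > 0" using tp[OF \<omega>(1)] z0 zero_less_power[of z k] by linarith
    have ab: "x / real (tprod k \<omega>) \<le> real a" "real a \<le> x / real (tprod k \<omega>) + \<eta> * z / 12"
      using \<omega>(2) unfolding B_def by auto
    have "\<eta> * z \<le> 1 / 2 * z" using \<eta> z0 by (intro mult_right_mono) auto
    hence "z / 6 \<le> real a" "real a \<le> 3 * z" using ab quot[OF \<omega>(1)] z0 by linarith+
    hence a: "M \<le> a" "a < 32 * M" using M z0 by linarith+
    have "\<omega>' \<in> tuples M (Suc k)"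
      using \<omega>(1,3) a A unfolding tuples_def P_def by (auto simp: PiE_iff extensional_def less_Suc_eq)
    moreover have tp': "tprod (Suc k) \<omega>' = tprod k \<omega> * a"
      unfolding tprod_def \<omega>(3) by simp
    moreover have "x \<le> real (tprod k \<omega> * a)" using ab(1) t0 by (simp add: pos_divide_le_eq mult.commute)
    moreover have "real (tprod k \<omega> * a) \<le> x * (1 + \<eta>)"
    proof -
      have "real a \<le> x / real (tprod k \<omega>) + \<eta> * (x / real (tprod k \<omega>))"
      proof -
        have "\<eta> * (z / 6) \<le> \<eta> * (x / real (tprod k \<omega>))" using quot[OF \<omega>(1)] \<eta> by (intro mult_left_mono) auto
        moreover have "\<eta> * z \<ge> 0" using \<eta> z0 by simp
        ultimately show ?thesis using ab(2) by linarith
      qed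
      hence "real (tprod k \<omega>) * real a \<le> real (tprod k \<omega>) * (x / real (tprod k \<omega>) + \<eta> * (x / real (tprod k \<omega>)))"
        by (intro mult_left_mono) auto
      thus ?thesis using t0 by (simp add: algebra_simps)
    qed
    ultimately show "\<omega>' \<in> {\<omega> \<in> tuples M (Suc k). x \<le> real (tprod (Suc k) \<omega>) \<and> real (tprod (Suc k) \<omega>) \<le> x * (1 + \<eta>)}"
      by simp
  qed
  have "z / (2 * real k) \<le> z / real k - 1"
    using z k by (simp add: field_simps)
  also have "\<dots> \<le> real (card A)" unfolding A_def using z0 by (intro card_real_interval_ge) auto
  finally have cA: "z / (2 * real k) \<le> real (card A)" .
  have cB: "\<eta> * z / 24 \<le> real (card (B \<omega>))" if "\<omega> \<in> P" for \<omega>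
  proof -
    have "\<eta> * z / 12 - 1 \<le> real (card (B \<omega>))" unfolding B_def
      using quot[OF that] z0 by (intro card_real_interval_ge) linarith
    thus ?thesis using \<eta>(3) by linarith
  qed
  have finP: "finite P" unfolding P_def using finA by (intro finite_PiE) auto
  have "(z / (2 * real k)) ^ k * (\<eta> * z / 24) \<le> real (card A) ^ k * (\<eta> * z / 24)"
    using cA z0 \<eta> by (intro mult_right_mono power_mono) auto
  also have "\<dots> = (\<Sum>\<omega>\<in>P. \<eta> * z / 24)" unfolding P_def by (simp add: card_PiE)
  also have "\<dots> \<le> (\<Sum>\<omega>\<in>P. real (card (B \<omega>)))" by (intro sum_mono cB)
  also have "\<dots> = real (card (Sigma P B))" using finP finB by (simp add: card_SigmaI)
  also have "\<dots> \<le> real (card {\<omega> \<in> tuples M (Suc k). x \<le> real (tprod (Suc k) \<omega>) \<and> real (tprod (Suc k) \<omega>) \<le> x * (1 + \<eta>)})"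
    using card_inj_on_le[OF inj range] finite_tuples by simp
  finally show ?thesis .
qed

section \<open>The kernel-smoothed count of products\<close>

text \<open>A smoothed count of tuples with product near \<open>x\<close>, at relative resolution
  about \<open>1 / (\<kappa> * J)\<close>. The height \<open>J\<close> of the kernel compensates its
  width, so the expected size does not depend on \<open>J\<close> and two resolutions can be
  compared.\<close>

definition ksum :: "nat \<Rightarrow> nat \<Rightarrow> real \<Rightarrow> nat \<Rightarrow> nat \<Rightarrow> real" where
  "ksum M r \<kappa> J x = (\<Sum>\<omega>\<in>tuples M r. fejer J (\<kappa> * ln (real (tprod r \<omega>)) - \<kappa> * ln (real x)))"

text \<open>Two products differ by a factor of at most \<open>32 ^ k\<close>, and
  \<open>ln 32 \<le> 5\<close>. The scale \<open>\<kappa>\<close> thus confines the kernel arguments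
  to \<open>[-1, 1]\<close>, away from the other periods.\<close>

lemma ln_close:
  fixes m m' M k :: nat
  assumes "M > 0" "M ^ k \<le> m" "m \<le> (32 * M) ^ k" "M ^ k \<le> m'" "m' \<le> (32 * M) ^ k"
    and "\<kappa> > 0" "\<kappa> * (5 * real k) \<le> 1"
  shows "\<bar>\<kappa> * ln (real m) - \<kappa> * ln (real m')\<bar> \<le> 1"
proof -
  have bounds: "real k * ln (real M) \<le> ln (real m) \<and> ln (real m) \<le> real k * ln (real M) + 5 * real k"
    if m: "M ^ k \<le> m" "m \<le> (32 * M) ^ k" for m
  proof -
    have "M ^ k > 0" using assms(1) by simp
    hence mpos: "real m > 0" using m(1) by linarith
    have "ln (real M ^ k) \<le> ln (real m)"
    proof (intro ln_mono)
      show "real M ^ k \<le> real m" using m(1) by (metis of_nat_le_iff of_nat_power)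
    qed (use assms(1) mpos in auto)
    moreover have "ln (real m) \<le> ln ((32 * real M) ^ k)"
    proof (intro ln_mono)
      show "real m \<le> (32 * real M) ^ k"
        using m(2) by (metis of_nat_le_iff of_nat_mult of_nat_numeral of_nat_power)
    qed (use assms(1) mpos in auto)
    moreover have "ln ((32 * real M) ^ k) = real k * (ln 32 + ln (real M))"
      using assms(1) by (simp add: ln_realpow ln_mult distrib_left)
    moreover have "ln (32::real) \<le> 5"
    proof -
      have "ln (32::real) = ln (2 ^ 5)" by simp
      also have "\<dots> = 5 * ln 2" by (subst ln_realpow) auto
      also have "\<dots> \<le> 5 * 1" using ln_le_minus_one[of 2] by simp
      finally show ?thesis by simp
    qed
    hence "real k * (ln 32 + ln (real M)) \<le> real k * (5 + ln (real M))" by (intro mult_left_mono) auto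
    ultimately show ?thesis using assms(1) by (simp add: ln_realpow algebra_simps)
  qed
  have "\<bar>ln (real m) - ln (real m')\<bar> \<le> 5 * real k"
    using bounds[OF assms(2,3)] bounds[OF assms(4,5)] by linarith
  hence "\<kappa> * \<bar>ln (real m) - ln (real m')\<bar> \<le> \<kappa> * (5 * real k)" using assms(6) by (intro mult_left_mono) auto
  hence "\<kappa> * \<bar>ln (real m) - ln (real m')\<bar> \<le> 1" using assms(7) by linarith
  thus ?thesis using assms(6) by (simp add: abs_mult flip: right_diff_distrib)
qed

lemma norm_dsum_uminus: "norm (dsum M (- t)) = norm (dsum M t)"
  unfolding dsum_def using norm_sum_cis_uminus[of "\<lambda>a. t * ln (real a)"] by simp

lemma ksum_expansion:
  assumes "M > 0" "J > 0"
  shows "complex_of_real (ksum M r \<kappa> J x) = (\<Sum>l\<in>{- int J<..<int J}.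
    complex_of_real (1 - \<bar>real_of_int l\<bar> / real J) * dsum M (\<kappa> * real_of_int l) ^ r * cis (- (real_of_int l * (\<kappa> * ln (real x)))))"
proof -
  have "complex_of_real (ksum M r \<kappa> J x) = (\<Sum>\<omega>\<in>tuples M r. \<Sum>l\<in>{- int J<..<int J}.
      complex_of_real (1 - \<bar>real_of_int l\<bar> / real J) * cis (real_of_int l * (\<kappa> * ln (real (tprod r \<omega>)) - \<kappa> * ln (real x))))"
    unfolding ksum_def of_real_sum using assms(2) by (simp only: fejer_expansion)
  also have "\<dots> = (\<Sum>l\<in>{- int J<..<int J}. \<Sum>\<omega>\<in>tuples M r.
      complex_of_real (1 - \<bar>real_of_int l\<bar> / real J) * cis (real_of_int l * (\<kappa> * ln (real (tprod r \<omega>)) - \<kappa> * ln (real x))))"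
    by (rule sum.swap)
  also have "\<dots> = (\<Sum>l\<in>{- int J<..<int J}.
      complex_of_real (1 - \<bar>real_of_int l\<bar> / real J) * dsum M (\<kappa> * real_of_int l) ^ r * cis (- (real_of_int l * (\<kappa> * ln (real x)))))"
  proof (intro sum.cong refl)
    fix l :: int
    have "cis (real_of_int l * (\<kappa> * ln (real (tprod r \<omega>)) - \<kappa> * ln (real x))) =
        cis (\<kappa> * real_of_int l * ln (real (tprod r \<omega>))) * cis (- (real_of_int l * (\<kappa> * ln (real x))))" for \<omega>
      by (simp add: cis_mult algebra_simps)
    thus "(\<Sum>\<omega>\<in>tuples M r. complex_of_real (1 - \<bar>real_of_int l\<bar> / real J) * cis (real_of_int l * (\<kappa> * ln (real (tprod r \<omega>)) - \<kappa> * ln (real x)))) =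
      complex_of_real (1 - \<bar>real_of_int l\<bar> / real J) * dsum M (\<kappa> * real_of_int l) ^ r * cis (- (real_of_int l * (\<kappa> * ln (real x))))"
      unfolding dsum_power[OF assms(1)] by (simp only: sum_distrib_left sum_distrib_right mult.assoc)
  qed
  finally show ?thesis .
qed

text \<open>The \<open>k\<close>-th power is a sum over integers up to \<open>(32 * M) ^ k\<close>
  weighted by multiplicities. Bounding one of two multiplicities by \<open>D\<close> reduces their
  sum of squares to the number of tuples.\<close>

lemma dsum_mean_value:
  assumes M: "M > 0" and J: "J > 0" and \<kappa>: "\<kappa> > 0" "\<kappa> * (5 * real k) \<le> 1"
    and D: "\<And>m. m \<in> {1..(32 * M) ^ k} \<Longrightarrow> real (tuple_count M k m) \<le> D"
  shows "(\<Sum>l\<in>{- int J<..<int J}. (norm (dsum M (\<kappa> * real_of_int l) ^ k))\<^sup>2) \<le>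
    2 * (128 * real J + 128 * (32 * real M) ^ k / \<kappa>) * (D * (31 * real M) ^ k)"
proof -
  define S where "S = {M ^ k..(32 * M) ^ k}"
  have Mk: "M ^ k \<ge> 1" using M by simp
  have finS: "finite S" unfolding S_def by simp
  have S: "tprod k \<omega> \<in> S" if "\<omega> \<in> tuples M k" for \<omega>
    using tprod_bounds[OF that] unfolding S_def by simp
  have eq: "dsum M (\<kappa> * real_of_int l) ^ k = (\<Sum>m\<in>S. of_nat (tuple_count M k m) * cis (real_of_int l * (\<kappa> * ln (real m))))" for l
  proof -
    have "dsum M (\<kappa> * real_of_int l) ^ k = (\<Sum>\<omega>\<in>tuples M k. cis (real_of_int l * (\<kappa> * ln (real (tprod k \<omega>)))))"
      unfolding dsum_power[OF M] by (simp add: mult_ac)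
    also have "\<dots> = (\<Sum>m\<in>S. of_nat (tuple_count M k m) * cis (real_of_int l * (\<kappa> * ln (real m))))"
      using finS S by (rule sum_tuples)
    finally show ?thesis .
  qed
  have "(\<Sum>l\<in>{- int J<..<int J}. (norm (dsum M (\<kappa> * real_of_int l) ^ k))\<^sup>2) \<le>
      2 * (64 * real (2 * J) + 128 * real ((32 * M) ^ k) / \<kappa>) * (\<Sum>m\<in>S. (norm (of_nat (tuple_count M k m) :: complex))\<^sup>2)"
    unfolding eq
  proof (rule fejer_mean_value[OF J finS])
    fix m assume "m \<in> S"
    show "(\<Sum>m'\<in>S. fejer (2 * J) (\<kappa> * ln (real m) - \<kappa> * ln (real m'))) \<le> 64 * real (2 * J) + 128 * real ((32 * M) ^ k) / \<kappa>"
    proof (rule sum_fejer_ln[OF finS])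
      show "m > 0 \<and> real m \<le> real ((32 * M) ^ k)" if "m \<in> S" for m
      proof -
        have "M ^ k \<le> m" "m \<le> (32 * M) ^ k" using that unfolding S_def by auto
        thus ?thesis using Mk by (intro conjI) (linarith, simp only: of_nat_le_iff)
      qed
      show "\<bar>\<kappa> * ln (real m) - \<kappa> * ln (real m')\<bar> \<le> 1" if "m \<in> S" "m' \<in> S" for m m'
        using that M \<kappa> unfolding S_def by (intro ln_close[of M k]) auto
    qed (use \<open>m \<in> S\<close> \<kappa> J in auto)
  qed
  also have "(\<Sum>m\<in>S. (norm (of_nat (tuple_count M k m) :: complex))\<^sup>2) \<le> (\<Sum>m\<in>S. D * real (tuple_count M k m))"
    using D Mk unfolding S_def by (intro sum_mono) (auto simp: power2_eq_square intro!: mult_right_mono)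
  also have "\<dots> = D * (\<Sum>m\<in>S. real (tuple_count M k m) * 1)" by (simp add: sum_distrib_left)
  also have "(\<Sum>m\<in>S. real (tuple_count M k m) * 1) = (\<Sum>\<omega>\<in>tuples M k. 1)"
    using finS S by (rule sum_tuples[symmetric])
  also have "\<dots> = (31 * real M) ^ k" by (simp add: card_tuples)
  finally show ?thesis using \<kappa> by (simp add: mult_left_mono)
qed

text \<open>The low frequencies of the two kernels nearly cancel: the weights \<open>\<gamma> l\<close> of the difference are at most
  \<open>\<bar>l\<bar> / J\<^sub>0\<close>, which offsets the weakness of the bound \<open>1 / t\<close> for \<open>dsum\<close> at small \<open>t\<close>.\<close>
lemma ksum_variance:
  fixes M k J J\<^sub>0 :: nat and S :: "nat set"
  assumes M: "M > 0" and J: "0 < J\<^sub>0" "J\<^sub>0 \<le> J" and \<kappa>: "\<kappa> > 0" "\<kappa> * (5 * real (Suc k)) \<le> 1"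
    and S: "S \<subseteq> {M ^ Suc k..(32 * M) ^ Suc k}"
    and D: "\<And>m. m \<in> {1..(32 * M) ^ k} \<Longrightarrow> real (tuple_count M k m) \<le> D" and D0: "D \<ge> 0"
    and C: "C \<ge> 0" and E: "E \<ge> 0" and ds: "\<And>t. 0 < t \<Longrightarrow> t \<le> \<kappa> * real J \<Longrightarrow> norm (dsum M t) \<le> C * (1 / t + E)"
  shows "(\<Sum>x\<in>S. (ksum M (Suc k) \<kappa> J x - ksum M (Suc k) \<kappa> J\<^sub>0 x)\<^sup>2) \<le>
    2 * (128 * real J + 128 * (32 * real M) ^ Suc k / \<kappa>) * ((C * (1 / (\<kappa> * real J\<^sub>0) + E))\<^sup>2 *
    (2 * (128 * real J + 128 * (32 * real M) ^ k / \<kappa>) * (D * (31 * real M) ^ k)))"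
proof -
  define L where "L = {- int J<..<int J}"
  \<comment> \<open>The maximum extends the triangular weights of the short kernel by zero to the
    frequencies of the long one.\<close>
  define \<gamma> where "\<gamma> = (\<lambda>l::int. (1 - \<bar>real_of_int l\<bar> / real J) - max 0 (1 - \<bar>real_of_int l\<bar> / real J\<^sub>0))"
  define b where "b = (\<lambda>l. complex_of_real (\<gamma> l) * dsum M (\<kappa> * real_of_int l) ^ Suc k)"
  define \<Delta> where "\<Delta> = C * (1 / (\<kappa> * real J\<^sub>0) + E)"
  have Jp: "J > 0" using J by simp
  have finS: "finite S" using S by (rule finite_subset) simp
  have Mr: "M ^ Suc k \<ge> 1" using M by simp
  have diff: "complex_of_real (ksum M (Suc k) \<kappa> J x - ksum M (Suc k) \<kappa> J\<^sub>0 x) = (\<Sum>l\<in>L. b l * cis (- (real_of_int l * (\<kappa> * ln (real x)))))" for x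
  proof -
    define e where "e = (\<lambda>l. dsum M (\<kappa> * real_of_int l) ^ Suc k * cis (- (real_of_int l * (\<kappa> * ln (real x)))))"
    have "complex_of_real (ksum M (Suc k) \<kappa> J\<^sub>0 x) = (\<Sum>l\<in>{- int J\<^sub>0<..<int J\<^sub>0}. complex_of_real (1 - \<bar>real_of_int l\<bar> / real J\<^sub>0) * e l)"
      unfolding ksum_expansion[OF M J(1)] e_def by (simp only: mult.assoc)
    also have "\<dots> = (\<Sum>l\<in>{- int J\<^sub>0<..<int J\<^sub>0}. complex_of_real (max 0 (1 - \<bar>real_of_int l\<bar> / real J\<^sub>0)) * e l)"
    proof (intro sum.cong refl)
      fix l assume "l \<in> {- int J\<^sub>0<..<int J\<^sub>0}"
      hence "\<bar>l\<bar> \<le> int J\<^sub>0" by auto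
      hence "real_of_int \<bar>l\<bar> \<le> real J\<^sub>0" by linarith
      hence "max 0 (1 - \<bar>real_of_int l\<bar> / real J\<^sub>0) = 1 - \<bar>real_of_int l\<bar> / real J\<^sub>0" using J by simp
      thus "complex_of_real (1 - \<bar>real_of_int l\<bar> / real J\<^sub>0) * e l = complex_of_real (max 0 (1 - \<bar>real_of_int l\<bar> / real J\<^sub>0)) * e l"
        by (simp only:)
    qed
    also have "\<dots> = (\<Sum>l\<in>L. complex_of_real (max 0 (1 - \<bar>real_of_int l\<bar> / real J\<^sub>0)) * e l)"
    proof (intro sum.mono_neutral_left ballI)
      fix l assume "l \<in> L - {- int J\<^sub>0<..<int J\<^sub>0}"
      hence "int J\<^sub>0 \<le> \<bar>l\<bar>" by auto
      hence "real J\<^sub>0 \<le> real_of_int \<bar>l\<bar>" by linarith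
      hence "max 0 (1 - \<bar>real_of_int l\<bar> / real J\<^sub>0) = 0" using J by simp
      thus "complex_of_real (max 0 (1 - \<bar>real_of_int l\<bar> / real J\<^sub>0)) * e l = 0" by (simp only: of_real_0 mult_zero_left)
    qed (use J in \<open>auto simp: L_def\<close>)
    finally have 0: "complex_of_real (ksum M (Suc k) \<kappa> J\<^sub>0 x) = (\<Sum>l\<in>L. complex_of_real (max 0 (1 - \<bar>real_of_int l\<bar> / real J\<^sub>0)) * e l)" .
    have 1: "complex_of_real (ksum M (Suc k) \<kappa> J x) = (\<Sum>l\<in>L. complex_of_real (1 - \<bar>real_of_int l\<bar> / real J) * e l)"
      unfolding ksum_expansion[OF M Jp] e_def L_def by (simp only: mult.assoc)
    show ?thesis
      unfolding of_real_diff 0 1 sum_subtractf[symmetric] b_def \<gamma>_def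
      by (intro sum.cong refl) (simp only: e_def left_diff_distrib of_real_diff mult.assoc)
  qed
  have \<gamma>: "0 \<le> \<gamma> l" "\<gamma> l \<le> 1" "\<gamma> l \<le> \<bar>real_of_int l\<bar> / real J\<^sub>0" if "l \<in> L" for l
  proof -
    have "\<bar>l\<bar> \<le> int J" using that unfolding L_def by auto
    hence "real_of_int \<bar>l\<bar> \<le> real J" by linarith
    hence "\<bar>real_of_int l\<bar> / real J \<le> 1" using Jp by simp
    moreover have "\<bar>real_of_int l\<bar> / real J \<le> \<bar>real_of_int l\<bar> / real J\<^sub>0"
      using J by (intro divide_left_mono) auto
    moreover have "\<bar>real_of_int l\<bar> / real J \<ge> 0" by simp
    ultimately show "0 \<le> \<gamma> l" "\<gamma> l \<le> 1" "\<gamma> l \<le> \<bar>real_of_int l\<bar> / real J\<^sub>0" unfolding \<gamma>_def by linarith+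
  qed
  have \<Delta>0: "\<Delta> \<ge> 0" unfolding \<Delta>_def using C E \<kappa> by simp
  \<comment> \<open>Only one factor \<open>dsum\<close> is bounded pointwise; the remaining
    \<open>k\<close> go to the mean value theorem. The frequency 0, where there is no cancellation,
    drops out because its weight vanishes.\<close>
  have b1: "\<gamma> l * norm (dsum M (\<kappa> * real_of_int l)) \<le> \<Delta>" if l: "l \<in> L" for l
  proof (cases "l = 0")
    case True
    have "\<gamma> l = 0" unfolding True using \<gamma>(1)[of 0] \<gamma>(3)[of 0] l True by simp
    thus ?thesis using \<Delta>0 by simp
  next
    case False
    define t where "t = \<kappa> * \<bar>real_of_int l\<bar>"
    have t0: "t > 0" unfolding t_def using \<kappa> False by simp
    have "\<bar>l\<bar> \<le> int J" using l unfolding L_def by auto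
    hence "real_of_int \<bar>l\<bar> \<le> real J" by linarith
    hence tJ: "t \<le> \<kappa> * real J" unfolding t_def using \<kappa> by simp
    have "norm (dsum M (\<kappa> * real_of_int l)) = norm (dsum M t)"
      using norm_dsum_uminus[of M "\<kappa> * real_of_int l"] unfolding t_def by (cases "l \<ge> 0") auto
    hence "\<gamma> l * norm (dsum M (\<kappa> * real_of_int l)) \<le> \<gamma> l * (C * (1 / t + E))"
      using ds[OF t0 tJ] \<gamma>[OF l] by (simp add: mult_left_mono)
    also have "\<dots> = C * (\<gamma> l * (1 / t) + \<gamma> l * E)" by (simp only: algebra_simps)
    also have "\<dots> \<le> C * ((\<bar>real_of_int l\<bar> / real J\<^sub>0) * (1 / t) + 1 * E)"
      using \<gamma>[OF l] t0 C E by (intro mult_left_mono add_mono mult_right_mono) auto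
    also have "(\<bar>real_of_int l\<bar> / real J\<^sub>0) * (1 / t) = 1 / (\<kappa> * real J\<^sub>0)"
      unfolding t_def using False by simp
    finally show ?thesis unfolding \<Delta>_def by simp
  qed
  have bl: "(norm (b l))\<^sup>2 \<le> \<Delta>\<^sup>2 * (norm (dsum M (\<kappa> * real_of_int l) ^ k))\<^sup>2" if l: "l \<in> L" for l
  proof -
    have "norm (b l) = (\<gamma> l * norm (dsum M (\<kappa> * real_of_int l))) * norm (dsum M (\<kappa> * real_of_int l) ^ k)"
      unfolding b_def using \<gamma>(1)[OF l] by (simp add: norm_mult)
    also have "\<dots> \<le> \<Delta> * norm (dsum M (\<kappa> * real_of_int l) ^ k)" using b1[OF l] by (intro mult_right_mono) auto
    finally have "(norm (b l))\<^sup>2 \<le> (\<Delta> * norm (dsum M (\<kappa> * real_of_int l) ^ k))\<^sup>2" by (intro power_mono) auto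
    thus ?thesis by (simp add: power_mult_distrib)
  qed
  define B where "B = 64 * real (2 * J) + 128 * real ((32 * M) ^ Suc k) / \<kappa>"
  have B0: "B \<ge> 0" unfolding B_def using \<kappa> by simp
  have "(\<Sum>x\<in>S. (ksum M (Suc k) \<kappa> J x - ksum M (Suc k) \<kappa> J\<^sub>0 x)\<^sup>2) =
      (\<Sum>x\<in>S. (norm (\<Sum>l\<in>L. b l * cis (- (real_of_int l * (\<kappa> * ln (real x))))))\<^sup>2)"
    unfolding diff[symmetric] norm_of_real by simp
  also have "\<dots> \<le> 2 * B * (\<Sum>l\<in>L. (norm (b l))\<^sup>2)"
    unfolding L_def
  proof (rule fejer_mean_value_dual[OF Jp finS _ B0])
    fix m assume "m \<in> S"
    show "(\<Sum>m'\<in>S. fejer (2 * J) (\<kappa> * ln (real m) - \<kappa> * ln (real m'))) \<le> B"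
      unfolding B_def
    proof (rule sum_fejer_ln[OF finS])
      show "m > 0 \<and> real m \<le> real ((32 * M) ^ Suc k)" if "m \<in> S" for m
      proof -
        have "M ^ Suc k \<le> m" "m \<le> (32 * M) ^ Suc k" using that S by auto
        thus ?thesis using Mr by (intro conjI) (linarith, simp only: of_nat_le_iff)
      qed
      show "\<bar>\<kappa> * ln (real m) - \<kappa> * ln (real m')\<bar> \<le> 1" if "m \<in> S" "m' \<in> S" for m m'
        using that S M \<kappa> by (intro ln_close[of M "Suc k"]) (auto simp del: power_Suc)
    qed (use \<open>m \<in> S\<close> \<kappa> Jp in auto)
  qed
  also have "(\<Sum>l\<in>L. (norm (b l))\<^sup>2) \<le> (\<Sum>l\<in>L. \<Delta>\<^sup>2 * (norm (dsum M (\<kappa> * real_of_int l) ^ k))\<^sup>2)"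
    by (intro sum_mono bl)
  also have "\<dots> = \<Delta>\<^sup>2 * (\<Sum>l\<in>L. (norm (dsum M (\<kappa> * real_of_int l) ^ k))\<^sup>2)" by (simp add: sum_distrib_left)
  also have "(\<Sum>l\<in>L. (norm (dsum M (\<kappa> * real_of_int l) ^ k))\<^sup>2) \<le>
      2 * (128 * real J + 128 * (32 * real M) ^ k / \<kappa>) * (D * (31 * real M) ^ k)"
    unfolding L_def
  proof (rule dsum_mean_value[OF M Jp \<kappa>(1) _ D])
    have "\<kappa> * (5 * real k) \<le> \<kappa> * (5 * real (Suc k))" using \<kappa> by (intro mult_left_mono) auto
    thus "\<kappa> * (5 * real k) \<le> 1" using \<kappa> by linarith
  qed
  finally have "(\<Sum>x\<in>S. (ksum M (Suc k) \<kappa> J x - ksum M (Suc k) \<kappa> J\<^sub>0 x)\<^sup>2) \<le>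
     2 * B * (\<Delta>\<^sup>2 * (2 * (128 * real J + 128 * (32 * real M) ^ k / \<kappa>) * (D * (31 * real M) ^ k)))"
    using B0 by (simp add: mult_left_mono)
  thus ?thesis unfolding B_def \<Delta>_def by simp
qed

text \<open>At most \<open>y\<close> products lie within \<open>h\<close> of \<open>x\<close>, each
  of multiplicity at most \<open>D\<close> and kernel value at most \<open>J\<close>; the others are
  handled by the quadratic decay of the kernel. A window poor in smooth numbers thus makes the sum
  small.\<close>

lemma ksum_upper:
  fixes M r J x h y :: nat
  assumes M: "M > 0" and J: "J > 0" and \<kappa>: "\<kappa> > 0" "\<kappa> * (5 * real r) \<le> 1"
    and x: "M ^ r \<le> x" "x \<le> (32 * M) ^ r"
    and D: "\<And>m. m \<in> {1..(32 * M) ^ r} \<Longrightarrow> real (tuple_count M r m) \<le> D"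
    and h: "h > 0" and few: "card {m \<in> tprod r ` tuples M r. \<bar>real m - real x\<bar> \<le> real h} \<le> y"
  shows "ksum M r \<kappa> J x \<le> D * (real y * real J) + D * (128 * ((32 * real M) ^ r)\<^sup>2 / (\<kappa>\<^sup>2 * real J * real h))"
proof -
  define S where "S = tprod r ` tuples M r"
  define F where "F = (\<lambda>m. fejer J (\<kappa> * ln (real m) - \<kappa> * ln (real x)))"
  define Bd where "Bd = (32 * real M) ^ r"
  have Bd0: "Bd > 0" unfolding Bd_def using M by simp
  have finS: "finite S" unfolding S_def using finite_tuples by simp
  have S: "M ^ r \<le> m \<and> m \<le> (32 * M) ^ r" if "m \<in> S" for m using that tprod_bounds unfolding S_def by auto
  have Mr: "M ^ r \<ge> 1" using M by simp
  have D0: "real (tuple_count M r m) \<le> D" if "m \<in> S" for m using D S[OF that] Mr by auto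
  have "(M ^ r) \<in> {1..(32 * M) ^ r}" using Mr by (auto intro: power_mono)
  from D[OF this] have Dn: "D \<ge> 0" by linarith
  have "ksum M r \<kappa> J x = (\<Sum>m\<in>S. real (tuple_count M r m) * F m)"
    unfolding ksum_def F_def using finS by (intro sum_tuples) (auto simp: S_def)
  also have "\<dots> \<le> (\<Sum>m\<in>S. D * F m)"
    using D0 by (intro sum_mono mult_right_mono) (auto simp: F_def fejer_nonneg)
  also have "\<dots> = (\<Sum>m\<in>{m \<in> S. \<bar>real m - real x\<bar> \<le> real h}. D * F m) + (\<Sum>m\<in>{m \<in> S. \<not> \<bar>real m - real x\<bar> \<le> real h}. D * F m)"
    using finS by (subst sum.union_disjoint[symmetric]) (auto intro!: sum.cong)
  also have "(\<Sum>m\<in>{m \<in> S. \<bar>real m - real x\<bar> \<le> real h}. D * F m) \<le> (\<Sum>m\<in>{m \<in> S. \<bar>real m - real x\<bar> \<le> real h}. D * real J)"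
    using Dn by (intro sum_mono mult_left_mono) (auto simp: F_def fejer_le)
  also have "\<dots> = D * (real (card {m \<in> S. \<bar>real m - real x\<bar> \<le> real h}) * real J)" by simp
  also have "\<dots> \<le> D * (real y * real J)" using few Dn unfolding S_def by (intro mult_left_mono mult_right_mono) auto
  also have "(\<Sum>m\<in>{m \<in> S. \<not> \<bar>real m - real x\<bar> \<le> real h}. D * F m) \<le>
      (\<Sum>m\<in>{m \<in> S. \<not> \<bar>real m - real x\<bar> \<le> real h}. D * (64 * real J * (1 / (1 + (real J * \<kappa> / Bd) * \<bar>real m - real x\<bar>)\<^sup>2)))"
  proof (intro sum_mono mult_left_mono)
    fix m assume "m \<in> {m \<in> S. \<not> \<bar>real m - real x\<bar> \<le> real h}"
    hence m: "M ^ r \<le> m" "m \<le> (32 * M) ^ r" using S by auto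
    show "F m \<le> 64 * real J * (1 / (1 + (real J * \<kappa> / Bd) * \<bar>real m - real x\<bar>)\<^sup>2)"
      unfolding F_def
    proof (rule fejer_ln_decay)
      show "m > 0" "x > 0" using m x Mr by linarith+
      show "real m \<le> Bd" "real x \<le> Bd" unfolding Bd_def using m(2) x(2)
        by (metis of_nat_le_iff of_nat_mult of_nat_numeral of_nat_power)+
      show "\<bar>\<kappa> * ln (real m) - \<kappa> * ln (real x)\<bar> \<le> 1" using M m x \<kappa> by (intro ln_close[of M r])
    qed fact
  qed (use Dn in auto)
  also have "\<dots> = D * (64 * real J * (\<Sum>m\<in>{m \<in> S. \<not> \<bar>real m - real x\<bar> \<le> real h}. 1 / (1 + (real J * \<kappa> / Bd) * \<bar>real m - real x\<bar>)\<^sup>2))"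
    by (simp only: sum_distrib_left)
  also have "\<dots> \<le> D * (64 * real J * (2 / ((real J * \<kappa> / Bd) * (1 + (real J * \<kappa> / Bd) * real h))))"
    using Dn finS J \<kappa> Bd0 by (intro mult_left_mono sum_inverse_square_far) auto
  also have "\<dots> \<le> D * (64 * real J * (2 / ((real J * \<kappa> / Bd) * ((real J * \<kappa> / Bd) * real h))))"
    using Dn J \<kappa> Bd0 h by (intro mult_left_mono divide_left_mono mult_pos_pos) (auto intro: add_pos_nonneg)
  also have "64 * real J * (2 / ((real J * \<kappa> / Bd) * ((real J * \<kappa> / Bd) * real h))) = 128 * Bd\<^sup>2 / (\<kappa>\<^sup>2 * real J * real h)"
    using J \<kappa> Bd0 h by (simp add: field_simps power2_eq_square)
  finally show ?thesis unfolding Bd_def by simp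
qed

text \<open>Products between \<open>x\<close> and \<open>x * (1 + 1/J)\<close> lie within the peak
  of the kernel, where it is at least \<open>J / 4\<close>. Their number is proportional to
  \<open>1 / J\<close>, so the result is free of \<open>J\<close>. The direct count works only at
  this coarse resolution, \<open>24 * J \<le> z\<close>.\<close>

lemma ksum_lower:
  fixes M k J x :: nat and z :: real
  assumes M: "real M \<le> z / 8" "3 * z < 32 * real M" and z: "z \<ge> 2 * real k + 2"
    and x: "z ^ Suc k / 2 \<le> real x" "real x \<le> 2 * z ^ Suc k" and k: "k > 0"
    and J: "J \<ge> 2" "24 * real J \<le> z" and \<kappa>: "0 < \<kappa>" "\<kappa> \<le> 1"
  shows "z ^ Suc k / (96 * (2 * real k) ^ k) \<le> ksum M (Suc k) \<kappa> J x"
proof -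
  define \<eta> where "\<eta> = 1 / real J"
  define E where "E = {\<omega> \<in> tuples M (Suc k). real x \<le> real (tprod (Suc k) \<omega>) \<and> real (tprod (Suc k) \<omega>) \<le> real x * (1 + \<eta>)}"
  have z0: "z > 0" using z by linarith
  have xpos: "real x > 0" using x(1) z0 zero_less_power[of z "Suc k"] by linarith
  have E: "(z / (2 * real k)) ^ k * (\<eta> * z / 24) \<le> real (card E)"
    unfolding E_def
    by (rule card_tuples_near_ge) (use assms in \<open>auto simp: \<eta>_def field_simps simp del: power_Suc\<close>)
  have F: "fejer J (\<kappa> * ln (real (tprod (Suc k) \<omega>)) - \<kappa> * ln (real x)) \<ge> real J / 4" if "\<omega> \<in> E" for \<omega>
  proof (rule fejer_ge)
    define m where "m = real (tprod (Suc k) \<omega>)"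
    have m: "real x \<le> m" "m \<le> real x * (1 + \<eta>)" using that unfolding E_def m_def by auto
    have "ln m \<le> ln (real x * (1 + \<eta>))" using m xpos by (intro ln_mono) auto
    also have "\<dots> = ln (real x) + ln (1 + \<eta>)" using xpos by (intro ln_mult_pos) (auto simp: \<eta>_def intro: add_pos_nonneg)
    also have "ln (1 + \<eta>) \<le> \<eta>" by (intro ln_add_one_self_le_self) (simp add: \<eta>_def)
    finally have "ln m - ln (real x) \<le> \<eta>" by simp
    moreover have "ln (real x) \<le> ln m" using m xpos by (intro ln_mono) auto
    ultimately have "\<kappa> * \<bar>ln m - ln (real x)\<bar> \<le> 1 * \<eta>" using \<kappa> by (intro mult_mono) auto
    hence "real J * \<bar>\<kappa> * ln m - \<kappa> * ln (real x)\<bar> \<le> real J * \<eta>"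
      using \<kappa> by (intro mult_left_mono) (simp_all add: abs_mult flip: right_diff_distrib)
    thus "real J * \<bar>\<kappa> * ln (real (tprod (Suc k) \<omega>)) - \<kappa> * ln (real x)\<bar> \<le> 1"
      unfolding \<eta>_def m_def using J by simp
  qed (use J in simp)
  have "z ^ Suc k / (96 * (2 * real k) ^ k) = (z / (2 * real k)) ^ k * (\<eta> * z / 24) * (real J / 4)"
    unfolding \<eta>_def using J k by (simp add: power_divide field_simps)
  also have "\<dots> \<le> real (card E) * (real J / 4)" using E by (intro mult_right_mono) auto
  also have "\<dots> = (\<Sum>\<omega>\<in>E. real J / 4)" by simp
  also have "\<dots> \<le> (\<Sum>\<omega>\<in>E. fejer J (\<kappa> * ln (real (tprod (Suc k) \<omega>)) - \<kappa> * ln (real x)))" by (intro sum_mono F)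
  also have "\<dots> \<le> ksum M (Suc k) \<kappa> J x"
    unfolding ksum_def using finite_tuples by (intro sum_mono2) (auto simp: E_def fejer_nonneg)
  finally show ?thesis .
qed

subsection \<open>Counting the exceptional integers\<close>

lemma eventually_powr_le_linear:
  fixes A q e :: real
  assumes "e > 0" "q > 0"
  shows "\<forall>\<^sub>F N :: nat in sequentially. A * real N powr (1 - e) \<le> q * real N"
proof -
  have "((\<lambda>N::nat. A * real N powr (- e)) \<longlongrightarrow> A * 0) sequentially"
    using assms by (intro tendsto_intros tendsto_neg_powr filterlim_real_sequentially) auto
  hence "\<forall>\<^sub>F N :: nat in sequentially. A * real N powr (- e) < q"
    using assms by (intro order_tendstoD(2)) auto
  thus ?thesis using eventually_gt_at_top[of 0]
  proof eventually_elim
    case (elim N)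
    have "A * real N powr (1 - e) = (A * real N powr (- e)) * real N"
      using elim by (simp add: powr_diff powr_minus field_simps)
    also have "\<dots> \<le> q * real N" using elim by (intro mult_right_mono) auto
    finally show ?case .
  qed
qed

definition large_g :: "real \<Rightarrow> nat set" where
  "large_g \<epsilon> = {n. n > 1 \<and> real n powr \<epsilon> \<le> real (g n)}"

lemma large_g_prime_rep:
  assumes "n \<in> large_g \<epsilon>" "real K \<le> real n powr \<epsilon>"
  shows "prime_rep n K"
proof (rule ccontr)
  assume "\<not> prime_rep n K"
  hence "g n < K" using assms(1) by (intro g_less) (auto simp: large_g_def)
  thus False using assms by (simp add: large_g_def)
qed

text \<open>The kernel of length \<open>J\<close> resolves the interval \<open>(n, n + K]\<close>; the short one of length \<open>J\<^sub>0\<close>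
  provides the main term, because products that close to \<open>n\<close> can be counted directly.\<close>
lemma card_large_g_dyadic:
  fixes \<epsilon> :: real
  assumes \<epsilon>: "0 < \<epsilon>" "\<epsilon> \<le> 1"
  shows "\<exists>\<theta>>0. \<theta> \<le> 1 / 2 \<and> (\<exists>C. \<forall>\<^sub>F N :: nat in sequentially.
    real (card {n \<in> large_g \<epsilon>. N < 2 * n \<and> n \<le> N}) \<le> C * real N powr (1 - \<theta>))"
proof -
  \<comment> \<open>Makes \<open>N powr (1/r)\<close>, the size of the factors, at most
    \<open>N powr (\<epsilon>/8)\<close>.\<close>
  define k where "k = nat \<lceil>8 / \<epsilon>\<rceil>"
  define r where "r = Suc k"
  have k8: "real k \<ge> 8 / \<epsilon>" unfolding k_def by linarith
  have "8 / \<epsilon> \<ge> 8" using \<epsilon> by (simp add: field_simps)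
  hence k1: "real k \<ge> 8" using k8 by linarith
  hence k0: "k > 0" by (intro Nat.gr0I) auto
  have r9: "real r \<ge> 9" using k1 unfolding r_def by simp
  have r0: "real r > 0" using r9 by linarith
  have r\<epsilon>: "1 / real r \<le> \<epsilon> / 8"
  proof -
    have "8 / \<epsilon> \<le> real r" using k8 unfolding r_def by simp
    thus ?thesis using \<epsilon> r0 by (simp add: field_simps)
  qed
  define \<kappa> where "\<kappa> = 1 / (5 * real r)"
  have \<kappa>: "0 < \<kappa>" "\<kappa> \<le> 1" "\<kappa> * (5 * real r) \<le> 1" unfolding \<kappa>_def using r9 by auto
  obtain c C\<^sub>1 where c: "0 < c" "c \<le> 1 / 4" and C\<^sub>1: "C\<^sub>1 \<ge> 1"
    and zeta: "\<And>M t. M \<ge> 1 \<Longrightarrow> 0 < t \<Longrightarrow> t \<le> real M ^ (2 * r) \<Longrightarrow>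
      norm (dsum M t) \<le> C\<^sub>1 * real M * (1 / t + real M powr (- c))"
    using zeta_sum_bound[of "2 * r"] unfolding dsum_def by blast
  \<comment> \<open>A single factor saves \<open>z powr (- c) = N powr (- \<theta>)\<close>. The
    variance contains its square, and one of the two savings pays for multiplicities.\<close>
  define \<theta> where "\<theta> = c / real r"
  have \<theta>: "\<theta> > 0" "\<theta> \<le> 1 / 2"
  proof -
    show "\<theta> > 0" unfolding \<theta>_def using c r0 by simp
    have "c / real r \<le> c / 1" using c r9 by (intro divide_left_mono) auto
    thus "\<theta> \<le> 1 / 2" unfolding \<theta>_def using c by linarith
  qed
  define \<beta> where "\<beta> = min \<theta> (\<epsilon> / 8)"
  \<comment> \<open>Multiplicities are at most \<open>num_divs m ^ r\<close>, so the divisor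
    exponent is \<open>\<beta> / r\<close> to lose only \<open>N powr \<beta>\<close>.\<close>
  define \<delta> where "\<delta> = \<beta> / real r"
  have \<beta>: "\<beta> > 0" "\<beta> \<le> \<theta>" "\<beta> \<le> \<epsilon> / 8" unfolding \<beta>_def using \<theta> \<epsilon> by auto
  have \<delta>: "\<delta> > 0" "\<delta> * real r = \<beta>" unfolding \<delta>_def using \<beta> r0 by auto
  obtain C\<^sub>2 where C\<^sub>2: "C\<^sub>2 \<ge> 1" and nd: "\<And>m. m > 0 \<Longrightarrow> real (num_divs m) \<le> C\<^sub>2 * real m powr \<delta>"
    using num_divs_bound[OF \<delta>(1)] by blast
  define CD where "CD = (C\<^sub>2 * (4 ^ r) powr \<delta>) ^ r"
  have CD: "CD > 0" unfolding CD_def using C\<^sub>2 by simp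
  define c\<^sub>0 where "c\<^sub>0 = 1 / (96 * (2 * real k) ^ k)"
  have c\<^sub>0: "c\<^sub>0 > 0" unfolding c\<^sub>0_def using k0 by simp
  define A\<^sub>1 where "A\<^sub>1 = CD * (4 + 4096 * 16 ^ r / \<kappa>\<^sup>2)"
  define b\<^sub>1 where "b\<^sub>1 = 128 + 128 * 4 ^ r / \<kappa>"
  define b\<^sub>2 where "b\<^sub>2 = 128 + 128 * 4 ^ k / \<kappa>"
  define b\<^sub>3 where "b\<^sub>3 = C\<^sub>1 * (2 / \<kappa> + 16)"
  define A\<^sub>2 where "A\<^sub>2 = 2 * b\<^sub>1 * (b\<^sub>3\<^sup>2 * (2 * b\<^sub>2 * (CD * 4 ^ k)))"
  have b: "b\<^sub>1 > 0" "b\<^sub>2 > 0" "b\<^sub>3 > 0" unfolding b\<^sub>1_def b\<^sub>2_def b\<^sub>3_def using \<kappa> C\<^sub>1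
    by (auto intro!: add_pos_nonneg mult_pos_pos)
  define Bad where "Bad = (\<lambda>N. {n \<in> large_g \<epsilon>. N < 2 * n \<and> n \<le> N})"
  have core: "real (card (Bad N)) \<le> (4 * A\<^sub>2 / c\<^sub>0\<^sup>2) * real N powr (1 - \<theta>)"
    if z_def: "z = real N powr (1 / real r)" and z: "z \<ge> 600" "z \<ge> 2 * real k + 2"
      and big\<epsilon>: "real N powr \<epsilon> \<ge> 64" and main: "A\<^sub>1 * real N powr (1 - \<epsilon> / 4) \<le> (c\<^sub>0 / 2) * real N"
    for N :: nat and z :: real
  proof -
    have N0: "real N > 0" using z z_def by (cases "N = 0") auto
    have N1: "real N \<ge> 1" using N0 by simp
    have z0: "z > 0" using z by linarith
    have zp: "z powr a = real N powr (a / real r)" for a unfolding z_def powr_powr by simp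
    have zr: "z ^ r = real N" using zp[of "real r"] r0 z0 N0 by (simp add: powr_realpow)
    have zk: "z ^ k = real N powr (1 - 1 / real r)"
    proof -
      have "z ^ k = z powr real k" using z0 by (simp add: powr_realpow)
      also have "\<dots> = real N powr (real k / real r)" by (rule zp)
      also have "real k / real r = 1 - 1 / real r" unfolding r_def by (simp add: field_simps)
      finally show ?thesis .
    qed
    define M where "M = nat \<lfloor>z / 8\<rfloor>"
    have M: "real M \<le> z / 8" "3 * z < 32 * real M" "real M \<ge> z / 16" "real M \<ge> 16"
      unfolding M_def using z by linarith+
    have M0: "M > 0" "M \<ge> 1" using M(4) by auto
    \<comment> \<open>Long enough that \<open>N / J\<close>, about
      \<open>N powr (\<epsilon>/2)\<close>, is far below the window \<open>h\<close>; short enough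
      that \<open>J\<close> times the smoothness bound and the multiplicity stays below
      \<open>N\<close>.\<close>
    define J where "J = nat \<lfloor>real N powr (1 - \<epsilon> / 2)\<rfloor>"
    \<comment> \<open>Short enough for the direct count, yet \<open>1 / J\<^sub>0\<close> is already
      of order at most \<open>z powr (- c)\<close>, matching the saving in the other
      frequencies.\<close>
    define J\<^sub>0 where "J\<^sub>0 = nat \<lfloor>sqrt z\<rfloor>"
    have zJ: "z \<le> real N powr (1 - \<epsilon> / 2)"
      unfolding z_def using N1 r\<epsilon> \<epsilon> by (intro powr_mono) auto
    have J: "real J \<le> real N powr (1 - \<epsilon> / 2)" "real J \<ge> real N powr (1 - \<epsilon> / 2) / 2"
      unfolding J_def using zJ z by linarith+
    have sqz: "sqrt z \<ge> 24" "sqrt z * sqrt z = z" using z by (auto intro: real_le_rsqrt)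
    have J\<^sub>0: "real J\<^sub>0 \<le> sqrt z" "real J\<^sub>0 \<ge> sqrt z / 2" unfolding J\<^sub>0_def using sqz by linarith+
    have J\<^sub>02: "J\<^sub>0 \<ge> 2"
    proof -
      have "real J\<^sub>0 \<ge> 2" using J\<^sub>0(2) sqz(1) by linarith
      thus ?thesis by simp
    qed
    have J\<^sub>0z: "24 * real J\<^sub>0 \<le> z"
    proof -
      have "24 * real J\<^sub>0 \<le> sqrt z * sqrt z" using J\<^sub>0(1) sqz by (intro mult_mono) auto
      thus ?thesis using sqz by simp
    qed
    have J\<^sub>0J: "J\<^sub>0 \<le> J"
    proof -
      have "real J\<^sub>0 \<le> real J" using J\<^sub>0z J(2) zJ by linarith
      thus ?thesis by simp
    qed
    have Jpos: "J > 0" using J\<^sub>0J J\<^sub>02 by linarith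
    have JN: "real J \<le> real N"
    proof -
      have "real N powr (1 - \<epsilon> / 2) \<le> real N powr 1" using N1 \<epsilon> by (intro powr_mono) auto
      thus ?thesis using J N0 by simp
    qed
    define K where "K = nat \<lfloor>(real N / 2) powr \<epsilon>\<rfloor>"
    \<comment> \<open>The kernel is centred at \<open>n + h\<close>. Radius \<open>h - 1\<close>
      keeps the window inside the interval \<open>(n, n + K]\<close>, which is open on the
      left.\<close>
    define h where "h = K div 2"
    have halfpow: "(real N / 2) powr \<epsilon> \<ge> real N powr \<epsilon> / 2"
    proof -
      have "(2::real) powr \<epsilon> \<le> 2 powr 1" using \<epsilon> by (intro powr_mono) auto
      thus ?thesis using N0 by (simp add: powr_divide field_simps)
    qed
    have K: "real K \<le> (real N / 2) powr \<epsilon>" "real K \<ge> real N powr \<epsilon> / 4"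
      unfolding K_def using halfpow big\<epsilon> by linarith+
    have h: "2 * h \<le> K" "real h - 1 \<ge> real N powr \<epsilon> / 16"
    proof -
      show "2 * h \<le> K" unfolding h_def by simp
      have "real K \<le> 2 * real h + 1" unfolding h_def by linarith
      thus "real h - 1 \<ge> real N powr \<epsilon> / 16" using K(2) big\<epsilon> by linarith
    qed
    have h1: "h \<ge> 2" 
    proof -
      have "real h \<ge> 2" using h(2) big\<epsilon> by linarith
      thus ?thesis by simp
    qed
    have hN: "2 * real h \<le> real N"
    proof -
      have "real N \<ge> 64"
      proof -
        have "real N powr \<epsilon> \<le> real N powr 1" using N1 \<epsilon> by (intro powr_mono) auto
        thus ?thesis using big\<epsilon> N0 by simp
      qed
      hence "(real N / 2) powr \<epsilon> \<le> (real N / 2) powr 1" using \<epsilon> by (intro powr_mono) auto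
      thus ?thesis using K(1) h(1) N0 by simp
    qed
    have M32: "32 * real M \<le> 4 * z" using M(1) by linarith
    have M32r: "(32 * real M) ^ j \<le> 4 ^ j * z ^ j" for j
      using power_mono[OF M32, of j] by (simp add: power_mult_distrib)
    have D: "real (tuple_count M j m) \<le> CD * real N powr \<beta>" if m: "m \<in> {1..(32 * M) ^ j}" and j: "j \<le> r" for j m
    proof -
      have "real m \<le> (32 * real M) ^ j" using m by (metis atLeastAtMost_iff of_nat_le_iff of_nat_mult of_nat_numeral of_nat_power)
      also have "\<dots> \<le> (32 * real M) ^ r" using M(4) j by (intro power_increasing) auto
      also have "\<dots> \<le> 4 ^ r * real N" using M32r[of r] zr by simp
      finally have mb: "real m \<le> 4 ^ r * real N" .
      have "num_divs m \<ge> 1" using m unfolding num_divs_def by (simp add: Suc_le_eq card_gt_0_iff) (metis dvd_refl)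
      have "real (tuple_count M j m) \<le> real (num_divs m) ^ j" using tuple_count_le[of m M j] m by (metis atLeastAtMost_iff of_nat_le_iff of_nat_power less_eq_Suc_le One_nat_def)
      also have "\<dots> \<le> real (num_divs m) ^ r" using \<open>num_divs m \<ge> 1\<close> j by (intro power_increasing) auto
      also have "\<dots> \<le> (C\<^sub>2 * real m powr \<delta>) ^ r" using nd[of m] m by (intro power_mono) auto
      also have "\<dots> \<le> (C\<^sub>2 * (4 ^ r * real N) powr \<delta>) ^ r"
        using mb \<delta> C\<^sub>2 by (intro power_mono mult_left_mono powr_mono2) auto
      also have "\<dots> = CD * (real N powr \<delta>) ^ r" unfolding CD_def by (simp add: powr_mult power_mult_distrib)
      also have "(real N powr \<delta>) ^ r = real N powr \<beta>" using N0 \<delta> by (simp add: powr_power mult.commute)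
      finally show ?thesis .
    qed
    define G where "G = ksum M r \<kappa>"
    have Mr: "real M ^ r \<le> real N / 2"
    proof -
      have "real M ^ r \<le> (z / 8) ^ r" using M by (intro power_mono) auto
      also have "\<dots> = real N / 8 ^ r" by (simp add: power_divide zr)
      also have "\<dots> \<le> real N / 8 ^ 1" using N0 r9 by (intro divide_left_mono power_increasing) auto
      also have "\<dots> \<le> real N / 2" using N0 by simp
      finally show ?thesis .
    qed
    have Mr': "2 * real N \<le> (32 * real M) ^ r"
    proof -
      have "2 * real N \<le> 3 ^ 1 * real N" using N0 by simp
      also have "\<dots> \<le> 3 ^ r * real N" using N0 r9 by (intro mult_right_mono power_increasing) auto
      also have "\<dots> = (3 * z) ^ r" by (simp add: power_mult_distrib zr)
      also have "\<dots> \<le> (32 * real M) ^ r" using M z0 by (intro power_mono) auto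
      finally show ?thesis .
    qed
    have centre: "real N / 2 \<le> real (n + h)" "real (n + h) \<le> 2 * real N" "M ^ r \<le> n + h" "n + h \<le> (32 * M) ^ r"
      if "n \<in> Bad N" for n
    proof -
      have n: "N < 2 * n" "n \<le> N" using that unfolding Bad_def by auto
      show 1: "real N / 2 \<le> real (n + h)" "real (n + h) \<le> 2 * real N" using n hN by linarith+
      have "real (M ^ r) \<le> real (n + h)" using 1 Mr by simp
      thus "M ^ r \<le> n + h" by (simp only: of_nat_le_iff)
      have "real (n + h) \<le> real ((32 * M) ^ r)" using 1 Mr' by simp
      thus "n + h \<le> (32 * M) ^ r" by (simp only: of_nat_le_iff)
    qed
    have lower: "c\<^sub>0 * real N \<le> G J\<^sub>0 (n + h)" if "n \<in> Bad N" for n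
    proof -
      have "z ^ Suc k / (96 * (2 * real k) ^ k) \<le> ksum M (Suc k) \<kappa> J\<^sub>0 (n + h)"
        using M z centre[OF that] k0 J\<^sub>02 J\<^sub>0z \<kappa> zr unfolding r_def
        by (intro ksum_lower) (auto simp del: power_Suc)
      thus ?thesis unfolding G_def c\<^sub>0_def r_def[symmetric] zr by simp
    qed
    have upper: "G J (n + h) \<le> (c\<^sub>0 / 2) * real N" if n: "n \<in> Bad N" for n
    proof -
      have prep: "prime_rep n K"
      proof (rule large_g_prime_rep)
        show "n \<in> large_g \<epsilon>" using n unfolding Bad_def by simp
        have "(real N / 2) powr \<epsilon> \<le> real n powr \<epsilon>"
          using n \<epsilon> unfolding Bad_def by (intro powr_mono2) auto
        thus "real K \<le> real n powr \<epsilon>" using K(1) by linarith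
      qed
      define S where "S = {m \<in> tprod r ` tuples M r. \<bar>real m - real (n + h)\<bar> \<le> real (h - 1)}"
      have few: "card S \<le> 32 * M"
      proof (rule ccontr)
        assume "\<not> card S \<le> 32 * M"
        moreover have "S \<subseteq> {n<..n + K}"
        proof
          fix m assume "m \<in> S"
          hence "\<bar>real m - real (n + h)\<bar> \<le> real (h - 1)" unfolding S_def by simp
          hence "n < m" "m \<le> n + 2 * h" using h1 by linarith+
          thus "m \<in> {n<..n + K}" using h(1) by auto
        qed
        ultimately have "\<not> prime_rep n K"
          using tprod_smooth M0 by (intro not_prime_rep_if_many_smooth[of S n K "32 * M"]) (auto simp: S_def)
        thus False using prep by simp
      qed
      have "G J (n + h) \<le> (CD * real N powr \<beta>) * (real (32 * M) * real J) +
          (CD * real N powr \<beta>) * (128 * ((32 * real M) ^ r)\<^sup>2 / (\<kappa>\<^sup>2 * real J * real (h - 1)))"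
        unfolding G_def
      proof (rule ksum_upper[OF M0(1) Jpos \<kappa>(1,3) centre(3,4)[OF n]])
        show "real (tuple_count M r m) \<le> CD * real N powr \<beta>" if "m \<in> {1..(32 * M) ^ r}" for m using D[OF that] by simp
        show "h - 1 > 0" using h1 by simp
        show "card {m \<in> tprod r ` tuples M r. \<bar>real m - real (n + h)\<bar> \<le> real (h - 1)} \<le> 32 * M" using few unfolding S_def .
      qed
      also have "\<dots> = CD * (real N powr \<beta> * (real (32 * M) * real J) + real N powr \<beta> * (128 * ((32 * real M) ^ r)\<^sup>2 / (\<kappa>\<^sup>2 * real J * real (h - 1))))"
        by (simp only: distrib_left mult.assoc)
      also have "\<dots> \<le> CD * (4 * real N powr (1 - \<epsilon> / 4) + 4096 * 16 ^ r / \<kappa>\<^sup>2 * real N powr (1 - \<epsilon> / 4))"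
      proof (intro mult_left_mono add_mono)
        have "real N powr \<beta> * (real (32 * M) * real J) \<le> real N powr \<beta> * ((4 * real N powr (1 / real r)) * real N powr (1 - \<epsilon> / 2))"
          using M32 J unfolding z_def by (intro mult_left_mono mult_mono) auto
        also have "\<dots> = 4 * real N powr (\<beta> + (1 / real r + (1 - \<epsilon> / 2)))" by (simp only: powr_add mult_ac)
        also have "\<dots> \<le> 4 * real N powr (1 - \<epsilon> / 4)"
          using N1 r\<epsilon> \<beta> by (intro mult_left_mono powr_mono) auto
        finally show "real N powr \<beta> * (real (32 * M) * real J) \<le> 4 * real N powr (1 - \<epsilon> / 4)" .
        have den: "\<kappa>\<^sup>2 * (real N powr (1 - \<epsilon> / 2) / 2) * (real N powr \<epsilon> / 16) \<le> \<kappa>\<^sup>2 * real J * real (h - 1)"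
          using J h h1 by (intro mult_mono) (auto simp: of_nat_diff)
        have "((32 * real M) ^ r)\<^sup>2 \<le> (4 ^ r * real N)\<^sup>2" using M32r[of r] zr by (intro power_mono) auto
        also have "\<dots> = 16 ^ r * (real N)\<^sup>2" 
        proof -
          have "((4::real) ^ r)\<^sup>2 = 16 ^ r" by (simp add: power2_eq_square flip: power_mult_distrib)
          thus ?thesis by (simp only: power_mult_distrib)
        qed
        finally have num: "128 * ((32 * real M) ^ r)\<^sup>2 \<le> 128 * (16 ^ r * (real N)\<^sup>2)" by simp
        have "real N powr \<beta> * (128 * ((32 * real M) ^ r)\<^sup>2 / (\<kappa>\<^sup>2 * real J * real (h - 1))) \<le>
            real N powr \<beta> * (128 * (16 ^ r * (real N)\<^sup>2) / (\<kappa>\<^sup>2 * (real N powr (1 - \<epsilon> / 2) / 2) * (real N powr \<epsilon> / 16)))"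
          using num den \<kappa> N0 by (intro mult_left_mono frac_le) auto
        also have "\<dots> = 4096 * 16 ^ r / \<kappa>\<^sup>2 * (real N powr \<beta> * real N powr 2 / (real N powr (1 - \<epsilon> / 2) * real N powr \<epsilon>))"
          using N0 \<kappa> by (simp add: field_simps)
        also have "\<dots> \<le> 4096 * 16 ^ r / \<kappa>\<^sup>2 * real N powr (1 - \<epsilon> / 4)"
        proof (intro mult_left_mono)
          have "real N powr \<beta> * real N powr 2 / (real N powr (1 - \<epsilon> / 2) * real N powr \<epsilon>) = real N powr (\<beta> + 2 - (1 - \<epsilon> / 2 + \<epsilon>))"
            by (simp only: powr_add powr_diff)
          also have "\<dots> \<le> real N powr (1 - \<epsilon> / 4)" using N1 \<beta> \<epsilon> by (intro powr_mono) auto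
          finally show "real N powr \<beta> * real N powr 2 / (real N powr (1 - \<epsilon> / 2) * real N powr \<epsilon>) \<le> real N powr (1 - \<epsilon> / 4)" .
        qed auto
        finally show "real N powr \<beta> * (128 * ((32 * real M) ^ r)\<^sup>2 / (\<kappa>\<^sup>2 * real J * real (h - 1))) \<le> 4096 * 16 ^ r / \<kappa>\<^sup>2 * real N powr (1 - \<epsilon> / 4)" .
      qed (use CD in auto)
      also have "\<dots> = A\<^sub>1 * real N powr (1 - \<epsilon> / 4)" unfolding A\<^sub>1_def by (simp add: algebra_simps)
      also have "\<dots> \<le> (c\<^sub>0 / 2) * real N" by (rule main)
      finally show ?thesis .
    qed
    define X where "X = (\<lambda>n. n + h) ` Bad N"
    have cX: "card X = card (Bad N)" unfolding X_def by (rule card_image) simp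
    have "finite (Bad N)" by (rule finite_subset[of _ "{..N}"]) (auto simp: Bad_def)
    hence finX: "finite X" unfolding X_def by simp
    have f1: "128 * real J + 128 * (32 * real M) ^ Suc k / \<kappa> \<le> b\<^sub>1 * real N"
    proof -
      have "128 * (32 * real M) ^ Suc k / \<kappa> \<le> 128 * (4 ^ r * real N) / \<kappa>"
        using M32r[of r] zr \<kappa> unfolding r_def by (intro divide_right_mono mult_left_mono) (auto simp del: power_Suc)
      hence "128 * real J + 128 * (32 * real M) ^ Suc k / \<kappa> \<le> 128 * real N + 128 * (4 ^ r * real N) / \<kappa>"
        using JN by linarith
      also have "\<dots> = b\<^sub>1 * real N" unfolding b\<^sub>1_def by (simp add: algebra_simps)
      finally show ?thesis .
    qed
    have f2: "128 * real J + 128 * (32 * real M) ^ k / \<kappa> \<le> b\<^sub>2 * z ^ k"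
    proof -
      have "real N powr (1 - \<epsilon> / 2) \<le> z ^ k" unfolding zk using N1 r\<epsilon> \<epsilon> by (intro powr_mono) auto
      moreover have "128 * (32 * real M) ^ k / \<kappa> \<le> 128 * (4 ^ k * z ^ k) / \<kappa>"
        using M32r[of k] \<kappa> by (intro divide_right_mono mult_left_mono) auto
      ultimately have "128 * real J + 128 * (32 * real M) ^ k / \<kappa> \<le> 128 * z ^ k + 128 * (4 ^ k * z ^ k) / \<kappa>"
        using J(1) by linarith
      also have "\<dots> = b\<^sub>2 * z ^ k" unfolding b\<^sub>2_def by (simp add: algebra_simps)
      finally show ?thesis .
    qed
    have f3: "C\<^sub>1 * real M * (1 / (\<kappa> * real J\<^sub>0) + real M powr (- c)) \<le> b\<^sub>3 * z powr (1 - c)"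
    proof -
      have "1 / (\<kappa> * real J\<^sub>0) \<le> 1 / (\<kappa> * (z powr c / 2))"
      proof -
        have "z powr c \<le> z powr (1/2)" using z c by (intro powr_mono) auto
        hence "z powr c / 2 \<le> real J\<^sub>0" using J\<^sub>0(2) z0 by (simp add: powr_half_sqrt)
        thus ?thesis using \<kappa> z0 J\<^sub>02 by (intro divide_left_mono mult_left_mono mult_pos_pos) auto
      qed
      also have "\<dots> = 2 / \<kappa> * z powr (- c)" using z0 by (simp add: powr_minus field_simps)
      finally have 1: "1 / (\<kappa> * real J\<^sub>0) \<le> 2 / \<kappa> * z powr (- c)" .
      have "real M powr (- c) \<le> (z / 16) powr (- c)" using M(3) z0 c by (intro powr_mono2') auto
      also have "\<dots> = 16 powr c * z powr (- c)" using z0 by (simp add: powr_divide powr_minus field_simps)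
      also have "\<dots> \<le> 16 powr 1 * z powr (- c)" using c by (intro mult_right_mono powr_mono) auto
      finally have 2: "real M powr (- c) \<le> 16 * z powr (- c)" by simp
      have "C\<^sub>1 * real M * (1 / (\<kappa> * real J\<^sub>0) + real M powr (- c)) \<le> C\<^sub>1 * z * (2 / \<kappa> * z powr (- c) + 16 * z powr (- c))"
        using 1 2 C\<^sub>1 M(1) z0 \<kappa> by (intro mult_mono add_mono) auto
      also have "\<dots> = b\<^sub>3 * (z * z powr (- c))" unfolding b\<^sub>3_def by (simp add: algebra_simps)
      also have "z * z powr (- c) = z powr (1 - c)" using z0 powr_add[of z 1 "- c"] by simp
      finally show ?thesis .
    qed
    have f4: "(31 * real M) ^ k \<le> 4 ^ k * z ^ k"
    proof -
      have "(31 * real M) ^ k \<le> (4 * z) ^ k" using M32 by (intro power_mono) auto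
      thus ?thesis by (simp add: power_mult_distrib)
    qed
    \<comment> \<open>Chebyshev: at every centre coming from an exceptional \<open>n\<close> the two
      kernel sums differ by at least \<open>c\<^sub>0 / 2 * N\<close>.\<close>
    have "real (card (Bad N)) * (c\<^sub>0 / 2 * real N)\<^sup>2 = (\<Sum>x\<in>X. (c\<^sub>0 / 2 * real N)\<^sup>2)" by (simp add: cX)
    also have "\<dots> \<le> (\<Sum>x\<in>X. (G J x - G J\<^sub>0 x)\<^sup>2)"
    proof (intro sum_mono)
      fix x assume "x \<in> X"
      then obtain n where n: "n \<in> Bad N" "x = n + h" unfolding X_def by auto
      have "c\<^sub>0 / 2 * real N \<le> G J\<^sub>0 x - G J x" using lower[OF n(1)] upper[OF n(1)] unfolding n(2) by (simp add: algebra_simps)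
      hence "(c\<^sub>0 / 2 * real N)\<^sup>2 \<le> (G J\<^sub>0 x - G J x)\<^sup>2" using c\<^sub>0 by (intro power_mono) auto
      thus "(c\<^sub>0 / 2 * real N)\<^sup>2 \<le> (G J x - G J\<^sub>0 x)\<^sup>2" by (simp add: power2_commute)
    qed
    also have "\<dots> \<le> 2 * (128 * real J + 128 * (32 * real M) ^ Suc k / \<kappa>) * ((C\<^sub>1 * real M * (1 / (\<kappa> * real J\<^sub>0) + real M powr (- c)))\<^sup>2 *
      (2 * (128 * real J + 128 * (32 * real M) ^ k / \<kappa>) * (CD * real N powr \<beta> * (31 * real M) ^ k)))"
      unfolding G_def r_def
    proof (rule ksum_variance[OF M0(1) _ J\<^sub>0J \<kappa>(1)])
      show "0 < J\<^sub>0" using J\<^sub>02 by simp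
      show "\<kappa> * (5 * real (Suc k)) \<le> 1" using \<kappa>(3) unfolding r_def .
      show "X \<subseteq> {M ^ Suc k..(32 * M) ^ Suc k}"
        using centre(3,4) unfolding X_def r_def by auto
      show "real (tuple_count M k m) \<le> CD * real N powr \<beta>" if "m \<in> {1..(32 * M) ^ k}" for m
        using D[OF that] unfolding r_def by simp
      show "0 \<le> CD * real N powr \<beta>" using CD by simp
      show "0 \<le> C\<^sub>1 * real M" using C\<^sub>1 by simp
      show "norm (dsum M t) \<le> C\<^sub>1 * real M * (1 / t + real M powr (- c))" if t: "0 < t" "t \<le> \<kappa> * real J" for t
      proof (rule zeta[OF M0(2) t(1)])
        have "\<kappa> * real J \<le> 1 * real N" using \<kappa> JN by (intro mult_mono) auto
        also have "\<dots> = z ^ r" using zr by simp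
        also have "\<dots> \<le> (real M * real M) ^ r"
        proof (intro power_mono)
          have "16 * real M \<le> real M * real M" using M(4) by (intro mult_right_mono) auto
          thus "z \<le> real M * real M" using M(3) by linarith
        qed (use z0 in auto)
        also have "\<dots> = real M ^ (2 * r)" by (simp add: power_mult power2_eq_square)
        finally show "t \<le> real M ^ (2 * r)" using t(2) by linarith
      qed
    qed simp
    also have "\<dots> \<le> 2 * (b\<^sub>1 * real N) * ((b\<^sub>3 * z powr (1 - c))\<^sup>2 * (2 * (b\<^sub>2 * z ^ k) * (CD * real N powr \<beta> * (4 ^ k * z ^ k))))"
      by (intro f1 f2 f3 f4 mult_mono power_mono order_refl)
        (use \<kappa> C\<^sub>1 CD b z0 N0 in \<open>auto intro!: mult_nonneg_nonneg add_nonneg_nonneg\<close>)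
    also have "\<dots> = A\<^sub>2 * (real N * (z powr (1 - c))\<^sup>2 * (z ^ k * z ^ k) * real N powr \<beta>)"
      unfolding A\<^sub>2_def by (simp add: power_mult_distrib mult_ac)
    \<comment> \<open>As \<open>z ^ r = N\<close>, the exponents of \<open>N\<close> add up to
      \<open>3 - 2 * \<theta> + \<beta>\<close>, which is at most
      \<open>3 - \<theta>\<close>.\<close>
    also have "\<dots> \<le> A\<^sub>2 * ((real N)\<^sup>2 * real N powr (1 - \<theta>))"
    proof (intro mult_left_mono)
      have "real N * (z powr (1 - c))\<^sup>2 * (z ^ k * z ^ k) * real N powr \<beta> =
          real N powr (1 + ((1 - c) / real r + (1 - c) / real r) + ((1 - 1 / real r) + (1 - 1 / real r)) + \<beta>)"
        unfolding zk zp power2_eq_square using N0 by (simp only: powr_add powr_one of_nat_0_le_iff)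
      also have "\<dots> \<le> real N powr (3 - \<theta>)"
      proof (intro powr_mono)
        have "(1 - c) / real r = 1 / real r - \<theta>" unfolding \<theta>_def by (simp add: diff_divide_distrib)
        thus "1 + ((1 - c) / real r + (1 - c) / real r) + ((1 - 1 / real r) + (1 - 1 / real r)) + \<beta> \<le> 3 - \<theta>"
          using \<beta> by linarith
      qed (use N1 in auto)
      also have "real N powr (3 - \<theta>) = (real N)\<^sup>2 * real N powr (1 - \<theta>)"
        using N0 powr_add[of "real N" 2 "1 - \<theta>"] by simp
      finally show "real N * (z powr (1 - c))\<^sup>2 * (z ^ k * z ^ k) * real N powr \<beta> \<le> (real N)\<^sup>2 * real N powr (1 - \<theta>)" .
      show "0 \<le> A\<^sub>2" using b CD by (simp add: A\<^sub>2_def)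
    qed
    finally have "real (card (Bad N)) * (c\<^sub>0 / 2 * real N)\<^sup>2 \<le> A\<^sub>2 * ((real N)\<^sup>2 * real N powr (1 - \<theta>))" .
    hence "(real (card (Bad N)) * (c\<^sub>0 / 2)\<^sup>2) * (real N)\<^sup>2 \<le> (A\<^sub>2 * real N powr (1 - \<theta>)) * (real N)\<^sup>2"
      by (simp only: power_mult_distrib mult_ac)
    hence "real (card (Bad N)) * (c\<^sub>0 / 2)\<^sup>2 \<le> A\<^sub>2 * real N powr (1 - \<theta>)" using N0 by simp
    hence "real (card (Bad N)) * c\<^sub>0\<^sup>2 / 4 \<le> A\<^sub>2 * real N powr (1 - \<theta>)" by (simp add: power_divide)
    thus ?thesis using c\<^sub>0 by (simp add: field_simps)
  qed
  have lim: "filterlim (\<lambda>N::nat. real N powr a) at_top sequentially" if "a > 0" for a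
    using that by real_asymp
  have "\<forall>\<^sub>F N :: nat in sequentially. real N powr (1 / real r) \<ge> max 600 (2 * real k + 2)"
    using lim[of "1 / real r"] r0 unfolding filterlim_at_top by (simp only: zero_less_divide_1_iff)
  moreover have "\<forall>\<^sub>F N :: nat in sequentially. real N powr \<epsilon> \<ge> 64"
    using lim[of \<epsilon>] \<epsilon> unfolding filterlim_at_top by blast
  moreover have "\<forall>\<^sub>F N :: nat in sequentially. A\<^sub>1 * real N powr (1 - \<epsilon> / 4) \<le> (c\<^sub>0 / 2) * real N"
    using \<epsilon> c\<^sub>0 by (intro eventually_powr_le_linear) auto
  ultimately have "\<forall>\<^sub>F N :: nat in sequentially. real (card (Bad N)) \<le> (4 * A\<^sub>2 / c\<^sub>0\<^sup>2) * real N powr (1 - \<theta>)"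
  proof eventually_elim
    case (elim N)
    thus ?case by (intro core[OF refl]) auto
  qed
  thus ?thesis using \<theta> unfolding Bad_def by blast
qed

text \<open>Induction by halving \<open>N\<close>: since \<open>\<theta> \<le> 1/2\<close>, the
  bound shrinks by a factor at most 3/4 at \<open>N div 2\<close>, and the remaining quarter of
  \<open>C'\<close> covers the upper half of the range.\<close>

lemma card_large_g_power_saving:
  fixes \<epsilon> :: real
  assumes "0 < \<epsilon>" "\<epsilon> \<le> 1"
  shows "\<exists>\<theta>>0. \<exists>C>0. \<forall>N :: nat. real (card {n \<in> large_g \<epsilon>. n \<le> N}) \<le> C * real N powr (1 - \<theta>)"
proof -
  obtain \<theta> C where \<theta>: "\<theta> > 0" "\<theta> \<le> 1 / 2"
    and ev: "\<forall>\<^sub>F N :: nat in sequentially. real (card {n \<in> large_g \<epsilon>. N < 2 * n \<and> n \<le> N}) \<le> C * real N powr (1 - \<theta>)"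
    using card_large_g_dyadic[OF assms] by blast
  then obtain N\<^sub>0 where N\<^sub>0: "\<And>N. N \<ge> N\<^sub>0 \<Longrightarrow> real (card {n \<in> large_g \<epsilon>. N < 2 * n \<and> n \<le> N}) \<le> C * real N powr (1 - \<theta>)"
    unfolding eventually_sequentially by blast
  \<comment> \<open>The summand \<open>4 * \<bar>C\<bar>\<close> closes the induction step;
    \<open>N\<^sub>0\<close> covers the range before the dyadic estimate holds.\<close>
  define C' where "C' = 4 * \<bar>C\<bar> + real N\<^sub>0 + 1"
  have C': "C' \<ge> 4 * C" "C' \<ge> real N\<^sub>0" "C' > 0" unfolding C'_def by linarith+
  have "real (card {n \<in> large_g \<epsilon>. n \<le> N}) \<le> C' * real N powr (1 - \<theta>)" for N :: nat
  proof (induction N rule: less_induct)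
    case (less N)
    show ?case
    proof (cases "N = 0")
      case True
      have "{n \<in> large_g \<epsilon>. n \<le> N} = {}" unfolding True large_g_def by auto
      thus ?thesis using C' by (simp add: True)
    next
      case False
      hence one: "1 \<le> real N powr (1 - \<theta>)" using \<theta> by (intro ge_one_powr_ge_zero) auto
      show ?thesis
      proof (cases "N < N\<^sub>0")
        case True
        have "{n \<in> large_g \<epsilon>. n \<le> N} \<subseteq> {1..N}" unfolding large_g_def by auto
        hence "card {n \<in> large_g \<epsilon>. n \<le> N} \<le> card {1..N}" by (intro card_mono) auto
        hence "real (card {n \<in> large_g \<epsilon>. n \<le> N}) \<le> C' * 1" using True C' by simp
        also have "\<dots> \<le> C' * real N powr (1 - \<theta>)" using one C' by (intro mult_left_mono) auto
        finally show ?thesis .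
      next
        case False
        define p where "p = real N powr (1 - \<theta>)"
        have p0: "p \<ge> 0" unfolding p_def by simp
        have "{n \<in> large_g \<epsilon>. n \<le> N} = {n \<in> large_g \<epsilon>. n \<le> N div 2} \<union> {n \<in> large_g \<epsilon>. N < 2 * n \<and> n \<le> N}"
          by auto
        hence "card {n \<in> large_g \<epsilon>. n \<le> N} \<le> card {n \<in> large_g \<epsilon>. n \<le> N div 2} + card {n \<in> large_g \<epsilon>. N < 2 * n \<and> n \<le> N}"
          by (simp only: card_Un_le)
        hence "real (card {n \<in> large_g \<epsilon>. n \<le> N}) \<le> real (card {n \<in> large_g \<epsilon>. n \<le> N div 2}) + C * p"
          using N\<^sub>0[of N] False unfolding p_def by linarith
        also have "real (card {n \<in> large_g \<epsilon>. n \<le> N div 2}) \<le> C' * real (N div 2) powr (1 - \<theta>)"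
          using \<open>N \<noteq> 0\<close> by (intro less.IH) auto
        also have "\<dots> \<le> C' * (real N / 2) powr (1 - \<theta>)"
          using C' \<theta> by (intro mult_left_mono powr_mono2) auto
        also have "(real N / 2) powr (1 - \<theta>) \<le> 3 / 4 * p"
        proof -
          have "(4 / 3) \<le> sqrt (2 :: real)" by (intro real_le_rsqrt) (simp add: power2_eq_square)
          also have "\<dots> = 2 powr (1 / 2)" by (simp add: powr_half_sqrt)
          also have "\<dots> \<le> 2 powr (1 - \<theta>)" using \<theta> by (intro powr_mono) auto
          finally have "p / 2 powr (1 - \<theta>) \<le> p / (4 / 3)" using p0 by (intro divide_left_mono) auto
          thus ?thesis unfolding p_def by (simp add: powr_divide)
        qed
        also have "C' * (3 / 4 * p) + C * p \<le> C' * p"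
        proof -
          have "4 * C * p \<le> C' * p" using C' p0 by (intro mult_right_mono) auto
          thus ?thesis by simp
        qed
        finally show ?thesis using C' unfolding p_def by simp
      qed
    qed
  qed
  thus ?thesis using \<theta> C' by blast
qed

theorem theorem1p1:
  shows "(\<exists>\<alpha>::real. \<alpha> < 1/2 \<and>
            (\<forall>\<^sub>F n in sequentially. real (g n) < real n powr \<alpha>))
       \<and> (\<forall>\<epsilon>::real. \<epsilon> > 0 \<longrightarrow>
            (\<exists>C::real. C > 0 \<and>
              (\<forall>\<^sub>F X in at_top.
                 real (card {n::nat. 1 < n \<and> real n \<le> X \<and> real (g n) \<ge> real n powr \<epsilon>})
                   \<le> C * X * exp (- (ln X powr (1/3 - \<epsilon>))))))"
proof (intro conjI allI impI)
  show "\<exists>\<alpha>::real. \<alpha> < 1/2 \<and> (\<forall>\<^sub>F n in sequentially. real (g n) < real n powr \<alpha>)"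
    using g_eventually_less_powr by (intro exI[of _ "71/144"]) auto
  fix \<epsilon> :: real
  assume \<epsilon>: "\<epsilon> > 0"
  obtain \<theta> C where \<theta>: "\<theta> > 0" and C: "C > 0"
    and bound: "\<And>N :: nat. real (card {n \<in> large_g (min \<epsilon> 1). n \<le> N}) \<le> C * real N powr (1 - \<theta>)"
    \<comment> \<open>The power saving was shown for exponents up to 1; replacing a larger
      \<open>\<epsilon>\<close> by 1 only enlarges the exceptional set.\<close>
    using card_large_g_power_saving[of "min \<epsilon> 1"] \<epsilon> by auto
  \<comment> \<open>Capping at 1/2 keeps \<open>1 - \<theta>'\<close> positive, so that
    \<open>N\<close> can be replaced by \<open>X\<close>.\<close>
  define \<theta>' where "\<theta>' = min \<theta> (1 / 2)"
  have \<theta>': "0 < \<theta>'" "\<theta>' \<le> \<theta>" "\<theta>' \<le> 1 / 2" unfolding \<theta>'_def using \<theta> by auto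
  have "\<forall>\<^sub>F x :: real in at_top. x powr (1/3) \<le> \<theta>' * x" using \<theta>' by real_asymp
  hence "\<forall>\<^sub>F X :: real in at_top. ln X powr (1/3) \<le> \<theta>' * ln X"
    by (rule eventually_compose_filterlim[OF _ ln_at_top])
  moreover have "\<forall>\<^sub>F X :: real in at_top. X \<ge> exp 1" by (rule eventually_ge_at_top)
  ultimately have "\<forall>\<^sub>F X in at_top.
      real (card {n::nat. 1 < n \<and> real n \<le> X \<and> real (g n) \<ge> real n powr \<epsilon>}) \<le> C * X * exp (- (ln X powr (1/3 - \<epsilon>)))"
  proof eventually_elim
    case (elim X)
    have X: "X \<ge> 1" using elim(2) exp_ge_add_one_self[of 1] by linarith
    have lnX: "ln X \<ge> 1" using elim(2) X by (simp add: ln_ge_iff)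
    define N where "N = nat \<lfloor>X\<rfloor>"
    have N: "real N \<le> X" "N \<ge> 1" unfolding N_def using X by (auto simp: le_nat_floor)
    have "{n::nat. 1 < n \<and> real n \<le> X \<and> real (g n) \<ge> real n powr \<epsilon>} \<subseteq> {n \<in> large_g (min \<epsilon> 1). n \<le> N}"
    proof
      fix n assume n: "n \<in> {n::nat. 1 < n \<and> real n \<le> X \<and> real (g n) \<ge> real n powr \<epsilon>}"
      have "real n powr (min \<epsilon> 1) \<le> real n powr \<epsilon>" using n by (intro powr_mono) auto
      also have "\<dots> \<le> real (g n)" using n by simp
      finally show "n \<in> {n \<in> large_g (min \<epsilon> 1). n \<le> N}"
        using n unfolding large_g_def N_def by (auto simp: le_nat_floor)
    qed
    hence "card {n::nat. 1 < n \<and> real n \<le> X \<and> real (g n) \<ge> real n powr \<epsilon>} \<le> card {n \<in> large_g (min \<epsilon> 1). n \<le> N}"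
      by (intro card_mono finite_subset[of "{n \<in> large_g (min \<epsilon> 1). n \<le> N}" "{..N}"]) auto
    hence "real (card {n::nat. 1 < n \<and> real n \<le> X \<and> real (g n) \<ge> real n powr \<epsilon>}) \<le> C * real N powr (1 - \<theta>)"
      using bound[of N] by linarith
    also have "\<dots> \<le> C * X powr (1 - \<theta>')"
    proof (intro mult_left_mono)
      have "real N powr (1 - \<theta>) \<le> real N powr (1 - \<theta>')" using N \<theta>' by (intro powr_mono) auto
      also have "\<dots> \<le> X powr (1 - \<theta>')" using N \<theta>' by (intro powr_mono2) auto
      finally show "real N powr (1 - \<theta>) \<le> X powr (1 - \<theta>')" .
    qed (use C in auto)
    also have "X powr (1 - \<theta>') = X * exp (- (\<theta>' * ln X))"
      using X by (simp add: powr_def left_diff_distrib exp_diff exp_minus field_simps)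
    also have "C * (X * exp (- (\<theta>' * ln X))) \<le> C * (X * exp (- (ln X powr (1/3 - \<epsilon>))))"
    proof -
      have "ln X powr (1/3 - \<epsilon>) \<le> ln X powr (1/3)" using lnX \<epsilon> by (intro powr_mono) auto
      hence "ln X powr (1/3 - \<epsilon>) \<le> \<theta>' * ln X" using elim(1) by linarith
      thus ?thesis using C X by (intro mult_left_mono) auto
    qed
    finally show ?case by (simp add: mult.assoc)
  qed
  thus "\<exists>C::real. C > 0 \<and> (\<forall>\<^sub>F X in at_top.
      real (card {n::nat. 1 < n \<and> real n \<le> X \<and> real (g n) \<ge> real n powr \<epsilon>}) \<le> C * X * exp (- (ln X powr (1/3 - \<epsilon>))))"
    using C by blast
qed

end
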